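(* Let $(\mathcal{X},d_0)$ be a compact metric space with $d_0\le 1$, and let $p\in[1,\infty]$. Let $\Xi$ be a point process on $\mathcal{X}$ with finite expectation measure $\boldsymbol{\lambda}$, total mass $\lambda=\boldsymbol{\lambda}(\mathcal{X})$, and let $\{N_x\}_{x\in\mathcal{X}}$ be any neighborhood structure. For $x\in\mathcal{X}$ let $\Xi_x$ be a Palm process of $\Xi$ at $x$. Then $$d_2^{(p)}\big(\mathcal{L}(\Xi),\mathrm{Po}(\boldsymbol{\lambda})\big)\le c_2^{(p)}(\lambda)\Big(\int_{\mathcal{X}}\boldsymbol{\lambda}(N_x)\,\boldsymbol{\lambda}(dx)+\mathbb{E}\int_{\mathcal{X}}(\Xi(N_x)-1)\,\Xi(dx)\Big)+\min(\varepsilon_1,\varepsilon_2),$$ where $$\varepsilon_2=c_2^{(p)}(\lambda)\,\mathbb{E}\int_{\mathcal{X}} d_1'\big(\Xi|_{N_x^c},\Xi_x|_{N_x^c}\big)\,\boldsymbol{\lambda}(dx),$$ and $$\varepsilon_1=c_1^{(p)}(\lambda)\,\mathbb{E}\int_{\mathcal{X}}\big|g(x;\Xi|_{N_x^c})-\phi(x)\big|\,\boldsymbol{\mu}(dx),$$ the term $\varepsilon_1$ being available (i.e. the bound holds with it) whenever the density conditions are satisfied for $\Xi$ with respect to some finite measure $\boldsymbol{\mu}$ on $\mathcal{X}$ (if they are not, read $\min(\varepsilon_1,\varepsilon_2)$ as $\varepsilon_2$). Here $$c_1^{(p)}(\lambda)=\begin{cases}\min\big(1,\gamma_1^{(p)}\lambda^{-1/\max(2,p)}\big),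 & 1\le p<\infty,\\ 1,& p=\infty,\end{cases}\qquad c_2^{(p)}(\lambda)=\begin{cases}\min\big(1,\tfrac{11}{6}[1+2\log^+(6\lambda/11)]\lambda^{-1}\big),& p=1,\\ \min\big(1,\gamma_2^{(p)}\lambda^{-1/p}\big),& 1<p<\infty,\\ 1,& p=\infty.\end{cases}$$
   Context: $\mathfrak{N}$ is the space of finite point measures on $\mathcal{X}$ (vague topology, with the $\sigma$-algebra $\mathcal{N}$ generated by it); a point process is a random element of $\mathfrak{N}$; $|\xi|$ is the total mass of $\xi$; $\mathcal{B}$ is the Borel $\sigma$-algebra of $\mathcal{X}$; $\Pi_n$ is the set of permutations of $\{1,\dots,n\}$. For $\xi=\sum_{i=1}^{|\xi|}\delta_{x_i}$, $\eta=\sum_{i=1}^{|\eta|}\delta_{y_i}$, define for $1\le p<\infty$: $d_1^{(p)}(\xi,\eta)=\min_{\pi\in\Pi_n}\big(\frac1n\sum_{i=1}^n d_0(x_i,y_{\pi(i)})^p\big)^{1/p}$ if $|\xi|=|\eta|=n\ge1$, $=1$ if $|\xi|\ne|\eta|$, $=0$ if $|\xi|=|\eta|=0$; and $d_1^{(\infty)}$ likewise with $\min_{\pi}\max_i d_0(x_i,y_{\pi(i)})$ in the first case. Let $\mathcal{F}_2^{(p)}$ be the set of $f:\mathfrak{N}\to[0,1]$ with $|f(\xi)-f(\eta)|\le d_1^{(p)}(\xi,\eta)$ for all $\xi,\eta$, and for probability measures $P,Q$ on $\mathfrak{N}$ set $d_2^{(p)}(P,Q)=\sup_{f\in\mathcal{F}_2^{(p)}}|\int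 f\,dP-\int f\,dQ|$. $\mathrm{Po}(\boldsymbol{\lambda})$ is the distribution of the Poisson process with expectation measure $\boldsymbol{\lambda}$. A Palm process $\Xi_x$ is any point process distributed according to the Palm distribution of $\Xi$ given a point at $x$. A neighborhood structure is a family $\{N_x\}_{x\in\mathcal{X}}$ of measurable sets $N_x\subset\mathcal{X}$ with $x\in N_x$ such that $(\xi,x)\mapsto\xi|_{N_x^c}$ is $(\mathcal{N}\otimes\mathcal{B})$-$\mathcal{N}$-measurable. For a finite measure $\boldsymbol{\mu}$ on $\mathcal{X}$, the density conditions are satisfied for $\Xi$ w.r.t. $\boldsymbol{\mu}$ if $\Xi$ is simple and has Janossy densities $j_n:\mathcal{X}^n\to\mathbb{R}_+$ w.r.t. $\boldsymbol{\mu}^n$, $n\ge0$, which are hereditary ($j_n(x_1,\dots,x_n)=0$ implies $j_{n+1}(x_1,\dots,x_n,x_{n+1})=0$). Then $\phi$ denotes the density of $\boldsymbol{\lambda}$ w.r.t. $\boldsymbol{\mu}$, and $g(x;\xi)$ denotes the conditional density (w.r.t. $\boldsymbol{\mu}$) of having a point of $\Xi$ at $x$ given $\Xi|_{N_x^c}=\xi$, i.e. for $\xi=\sum_{i=1}^k\delta_{x_i}$ on $N_x^c$, $g(x;\xi)=\frac{\sum_{n\ge0}\frac1{n!}\int_{N_x^n} j_{k+n+1}(x,x_1,\dots,x_k,\mathbf{y})\boldsymbol{\mu}^n(d\mathbf{y})}{\sum_{n\ge0}\frac1{n!}\int_{N_x^n} j_{k+n}(x_1,\dots,x_k,\mathbf{y})\boldsymbol{\mu}^n(d\mathbf{y})}$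 (with $0/0=0$). The metric $d_1'$ on $\mathfrak{N}$: for $\xi=\sum_{i=1}^n\delta_{x_i}$, $\eta=\sum_{i=1}^m\delta_{y_i}$ with $n\le m$, $d_1'(\xi,\eta)=(m-n)+\min_{\pi\in\Pi_m}\sum_{i=1}^n d_0(x_i,y_{\pi(i)})$, and $d_1'(\xi,\eta)=d_1'(\eta,\xi)$ otherwise. Constants: $\kappa_0=4e/(1+4e-\sqrt{1+8e})$, $\kappa_1=2-\kappa_0$; $\gamma_1^{(1)}=\sqrt{2/e}+2(\kappa_0e^{\kappa_0})^{-1/2}$; for $1<p\le2$, $\gamma_1^{(p)}=\sqrt{2/e}+2\Big(\frac{2-p}{p\kappa_0^{1-1/p}-\kappa_1(p-1)}\Big)^{(2-p)/(2(p-1))}$; for $2<p<\infty$, $\gamma_1^{(p)}=\frac{p}{p-1}+\frac1{\sqrt{2e}}\frac{p}{p-1}\Big(\frac{p-2}{\sqrt{2e}(p\kappa_0^{1-1/p}-\kappa_1(p-1))}\Big)^{(p-2)/p}$; and for $1<p<\infty$, $\gamma_2^{(p)}=\frac{(1+2^{1/p}+(2/3)^{1/p})p^2}{(p-1)(2p-1)}$. $\log^+ x=\max(\log x,0)$. *)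

theory Defs
  imports "HOL-Probability.Probability" "HOL-Library.Multiset" "HOL-Combinatorics.Permutations"
begin

text \<open>A finite point measure on X is a finite multiset of points of X.\<close>

definition cnt :: "'a set \<Rightarrow> 'a multiset \<Rightarrow> nat" where
  "cnt A \<xi> = size (filter_mset (\<lambda>x. x \<in> A) \<xi>)"

definition restr :: "'a multiset \<Rightarrow> 'a set \<Rightarrow> 'a multiset" where
  "restr \<xi> A = filter_mset (\<lambda>x. x \<in> A) \<xi>"

text \<open>The measurable space of finite point measures (sigma-algebra generated by the counts,
 which coincides with the Borel sigma-algebra of the vague topology).\<close>
definition Nsp :: "'a::topological_space multiset measure" where
  "Nsp = sigma UNIV {{\<xi>. cnt A \<xi> = n} | A n. A \<in> sets borel}"

definition list_of :: "'a multiset \<Rightarrow> 'a list" where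
  "list_of \<xi> = (SOME l. mset l = \<xi>)"

definition vmset :: "nat \<Rightarrow> (nat \<Rightarrow> 'a) \<Rightarrow> 'a multiset" where
  "vmset n xs = mset (map xs [0..<n])"

definition vec_of :: "'a list \<Rightarrow> nat \<Rightarrow> 'a" where
  "vec_of l = restrict (\<lambda>i. l ! i) {..<length l}"

definition d1p :: "ereal \<Rightarrow> 'a::metric_space multiset \<Rightarrow> 'a multiset \<Rightarrow> real" where
  "d1p p \<xi> \<eta> =
    (if size \<xi> \<noteq> size \<eta> then 1 else if size \<xi> = 0 then 0 else
     (let n = size \<xi>; xs = list_of \<xi>; ys = list_of \<eta> in
      if p = \<infinity> then
        Min {Max {dist (xs ! i) (ys ! (\<pi> i)) | i. i < n} | \<pi>. \<pi> permutes {..<n}}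
      else
        Min {((1 / real n) * (\<Sum>i<n. dist (xs ! i) (ys ! (\<pi> i)) powr real_of_ereal p))
               powr (1 / real_of_ereal p) | \<pi>. \<pi> permutes {..<n}}))"

definition d1'_aux :: "'a::metric_space multiset \<Rightarrow> 'a multiset \<Rightarrow> real" where
  "d1'_aux \<xi> \<eta> =
    (let n = size \<xi>; m = size \<eta>; xs = list_of \<xi>; ys = list_of \<eta> in
      real (m - n) + Min {(\<Sum>i<n. dist (xs ! i) (ys ! (\<pi> i))) | \<pi>. \<pi> permutes {..<m}})"

definition d1' :: "'a::metric_space multiset \<Rightarrow> 'a multiset \<Rightarrow> real" where
  "d1' \<xi> \<eta> = (if size \<xi> \<le> size \<eta> then d1'_aux \<xi> \<eta> else d1'_aux \<eta> \<xi>)"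

definition F2 :: "ereal \<Rightarrow> ('a::metric_space multiset \<Rightarrow> real) set" where
  "F2 p = {f. f \<in> borel_measurable Nsp \<and> (\<forall>\<xi>. 0 \<le> f \<xi> \<and> f \<xi> \<le> 1)
              \<and> (\<forall>\<xi> \<eta>. \<bar>f \<xi> - f \<eta>\<bar> \<le> d1p p \<xi> \<eta>)}"

definition d2 :: "ereal \<Rightarrow> 'a::metric_space multiset measure \<Rightarrow> 'a multiset measure \<Rightarrow> real" where
  "d2 p P Q = (SUP f\<in>F2 p. \<bar>(\<integral>\<xi>. f \<xi> \<partial>P) - (\<integral>\<xi>. f \<xi> \<partial>Q)\<bar>)"

definition exp_meas :: "'a::topological_space multiset measure \<Rightarrow> 'a measure" where
  "exp_meas P = measure_of UNIV (sets borel) (\<lambda>A. \<integral>\<^sup>+\<xi>. of_nat (cnt A \<xi>) \<partial>P)"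

text \<open>Law of the Poisson process with finite expectation measure lam:
  Poisson(lam(X)) many i.i.d. points with law lam / lam(X).\<close>
definition Po :: "'a::topological_space measure \<Rightarrow> 'a multiset measure" where
  "Po lam = measure_of UNIV (sets Nsp)
     (\<lambda>B. \<Sum>n. ennreal (exp (- enn2real (emeasure lam UNIV)) / fact n) *
            (\<integral>\<^sup>+xs. indicator B (vmset n xs) \<partial>(PiM {..<n} (\<lambda>_. lam))))"

text \<open>Palm kernel (non-reduced Palm distributions) characterised by the Campbell--Palm formula.\<close>
definition palm_kernel :: "'a::topological_space multiset measure \<Rightarrow> ('a \<Rightarrow> 'a multiset measure) \<Rightarrow> bool" where
  "palm_kernel P Pm \<longleftrightarrow> Pm \<in> borel \<rightarrow>\<^sub>M prob_algebra Nsp \<and>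
     (\<forall>h \<in> borel_measurable (borel \<Otimes>\<^sub>M Nsp).
        (\<integral>\<^sup>+\<xi>. sum_mset (image_mset (\<lambda>x. h (x, \<xi>)) \<xi>) \<partial>P)
        = (\<integral>\<^sup>+x. (\<integral>\<^sup>+\<eta>. h (x, \<eta>) \<partial>Pm x) \<partial>exp_meas P))"

definition nbhd_structure :: "('a::topological_space \<Rightarrow> 'a set) \<Rightarrow> bool" where
  "nbhd_structure Nb \<longleftrightarrow> (\<forall>x. x \<in> Nb x \<and> Nb x \<in> sets borel) \<and>
     (\<lambda>(\<xi>, x). restr \<xi> (- Nb x)) \<in> Nsp \<Otimes>\<^sub>M borel \<rightarrow>\<^sub>M Nsp"

definition janossy :: "'a::topological_space multiset measure \<Rightarrow> 'a measure \<Rightarrow> (nat \<Rightarrow> (nat \<Rightarrow> 'a) \<Rightarrow> real) \<Rightarrow> bool" where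
  "janossy P \<mu> j \<longleftrightarrow>
     (\<forall>n. j n \<in> borel_measurable (PiM {..<n} (\<lambda>_. \<mu>)) \<and> (\<forall>xs. 0 \<le> j n xs) \<and>
          (\<forall>xs \<pi>. xs \<in> extensional {..<n} \<longrightarrow> \<pi> permutes {..<n} \<longrightarrow>
                   j n (restrict (xs \<circ> \<pi>) {..<n}) = j n xs)) \<and>
     (\<forall>n B. B \<in> sets Nsp \<longrightarrow>
        emeasure P {\<xi> \<in> B. size \<xi> = n}
        = ennreal (1 / fact n) * (\<integral>\<^sup>+xs. ennreal (j n xs) * indicator B (vmset n xs) \<partial>(PiM {..<n} (\<lambda>_. \<mu>))))"

definition hereditary :: "(nat \<Rightarrow> (nat \<Rightarrow> 'a) \<Rightarrow> real) \<Rightarrow> bool" where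
  "hereditary j \<longleftrightarrow> (\<forall>n xs y. xs \<in> extensional {..<n} \<longrightarrow> j n xs = 0 \<longrightarrow> j (Suc n) (xs(n := y)) = 0)"

definition density_conditions :: "'a::topological_space multiset measure \<Rightarrow> 'a measure \<Rightarrow> (nat \<Rightarrow> (nat \<Rightarrow> 'a) \<Rightarrow> real) \<Rightarrow> bool" where
  "density_conditions P \<mu> j \<longleftrightarrow> finite_measure \<mu> \<and> sets \<mu> = sets borel \<and>
     (AE \<xi> in P. \<forall>x. count \<xi> x \<le> 1) \<and> janossy P \<mu> j \<and> hereditary j"

definition jan_sum :: "(nat \<Rightarrow> (nat \<Rightarrow> 'a) \<Rightarrow> real) \<Rightarrow> 'a measure \<Rightarrow> 'a set \<Rightarrow> 'a list \<Rightarrow> ennreal" where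
  "jan_sum j \<mu> A l = (\<Sum>n. ennreal (1 / fact n) *
      (\<integral>\<^sup>+ys. ennreal (j (length l + n) (vec_of (l @ map ys [0..<n]))) * indicator (PiE {..<n} (\<lambda>_. A)) ys
         \<partial>(PiM {..<n} (\<lambda>_. \<mu>))))"

text \<open>Conditional density g(x; xi) of a point at x given the configuration xi on N_x^c (0/0 = 0).\<close>
definition gcond :: "(nat \<Rightarrow> (nat \<Rightarrow> 'a) \<Rightarrow> real) \<Rightarrow> 'a measure \<Rightarrow> ('a \<Rightarrow> 'a set) \<Rightarrow> 'a \<Rightarrow> 'a multiset \<Rightarrow> real" where
  "gcond j \<mu> Nb x \<xi> = (let l = list_of \<xi>; num = jan_sum j \<mu> (Nb x) (x # l); den = jan_sum j \<mu> (Nb x) l in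
      if den = 0 then 0 else enn2real (num / den))"

definition kappa0 :: real where
  "kappa0 = 4 * exp 1 / (1 + 4 * exp 1 - sqrt (1 + 8 * exp 1))"

definition kappa1 :: real where "kappa1 = 2 - kappa0"

definition pw :: "real \<Rightarrow> real \<Rightarrow> real" where
  "pw b e = (if e = 0 then 1 else b powr e)"

definition gamma1 :: "real \<Rightarrow> real" where
  "gamma1 p =
    (if p = 1 then sqrt (2 / exp 1) + 2 * (kappa0 * exp kappa0) powr (-1/2)
     else if p \<le> 2 then sqrt (2 / exp 1) +
        2 * pw ((2 - p) / (p * kappa0 powr (1 - 1/p) - kappa1 * (p - 1))) ((2 - p) / (2 * (p - 1)))
     else p / (p - 1) + 1 / sqrt (2 * exp 1) * (p / (p - 1)) *
        pw ((p - 2) / (sqrt (2 * exp 1) * (p * kappa0 powr (1 - 1/p) - kappa1 * (p - 1)))) ((p - 2) / p))"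

definition gamma2 :: "real \<Rightarrow> real" where
  "gamma2 p = (1 + 2 powr (1/p) + (2/3) powr (1/p)) * p^2 / ((p - 1) * (2 * p - 1))"

definition logp :: "real \<Rightarrow> real" where "logp x = max (ln x) 0"

definition c1 :: "ereal \<Rightarrow> real \<Rightarrow> real" where
  "c1 p lam = (if p = \<infinity> then 1 else
     min 1 (gamma1 (real_of_ereal p) * lam powr (- 1 / max 2 (real_of_ereal p))))"

definition c2 :: "ereal \<Rightarrow> real \<Rightarrow> real" where
  "c2 p lam = (if p = \<infinity> then 1 else if p = 1 then
       min 1 (11/6 * (1 + 2 * logp (6 * lam / 11)) * inverse lam)
     else min 1 (gamma2 (real_of_ereal p) * lam powr (- 1 / real_of_ereal p)))"

end

theory Submission
  imports Defs
begin

text \<open>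
  Stein's method with an immigration-death interpolation. For \<open>u\<close> between 0 and 1 let \<open>T\<^sub>u f(\<xi>)\<close> be the
  expectation of \<open>f\<close> at the superposition of the \<open>(1 - u)\<close>-thinning of \<open>\<xi>\<close> and an independent Poisson
  process with intensity \<open>u M\<close>, so that \<open>T\<^sub>0 f = f\<close> and \<open>T\<^sub>1 f\<close> is the Poisson expectation. With
  \<open>V u x\<close> the operator \<open>T\<^sub>u\<close> applied to the first difference of \<open>f\<close> at \<open>x\<close>, the derivative of \<open>T\<^sub>u f(\<xi>)\<close> in
  \<open>u\<close> is \<open>\<integral> V u x \<xi> M(dx) - (\<Sum>x\<in>\<xi>. V u x (\<xi> - x))\<close>. Integrating over \<open>u\<close>, the function
  \<open>W x \<xi> = \<integral>\<^sub>0\<^sup>1 V u x \<xi> du\<close> solves the Stein equation. Replacing \<open>\<xi>\<close> by its restriction to the complement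
  of \<open>N\<^sub>x\<close> produces the two neighbourhood integrals; what remains is compared through the Palm coupling, or
  through the Janossy densities.

  For the Stein factors, first and second differences of the smoothed \<open>f\<close> are differences of Poisson-weighted
  sums in which functions of configurations of equal size \<open>m\<close> differ by at most \<open>m\<^sup>-\<^sup>1\<^sup>/\<^sup>p\<close>, so only the mass
  that cannot be matched at equal sizes has to be paid in full.
\<close>

section \<open>Poisson weights and Stein factors\<close>

text \<open>The parameter is u = 1 - exp(-t), with t the time of the immigration-death process. The
  first difference at x of the usual Stein solution integrates over t a difference weighted by the
  survival probability exp(-t) of the added point; as exp(-t) dt = du, \<open>W\<close> is this
  first difference up to sign, now over a bounded interval. Neither the Markov process nor the Stein
  solution is constructed. A second point brings a further survival factor 1 - u, so the trivial
  bound 2 on second differences integrates to 1, the cap in \<open>c2\<close>.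

  The exponent 1/p has one source: moving one of m points alters one of m terms in a mean of p-th
  powers, hence f by at most m^(-1/p) times the distance. Averaging over a Poisson number of points
  of mean s = u * l gives s^(-1/p). The other rate, 1 / sqrt (2 e s), bounds the total variation
  distance between a Poisson distribution and its shift by one.

  The obstacle outside the estimates is joint measurability: thinning and Janossy densities are
  defined on enumerated points, and their measurability has to be lifted from vectors to point
  measures.\<close>

definition poi :: "real \<Rightarrow> nat \<Rightarrow> real" where
  "poi s k = exp (- s) * s ^ k / fact k"

section \<open>Moments of the Poisson distribution\<close>

lemma poi_nonneg: "0 \<le> s \<Longrightarrow> 0 \<le> poi s k"
  by (simp add: poi_def)

lemma poi_Suc: "poi s (Suc k) * real (Suc k) = s * poi s k"
  by (simp add: poi_def field_simps del: of_nat_Suc)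

lemma poi_sums: "poi s sums 1"
proof -
  have "(\<lambda>k. exp (- s) * (s ^ k /\<^sub>R fact k)) sums (exp (- s) * exp s)"
    by (intro sums_mult exp_converges)
  then show ?thesis
    by (simp add: poi_def[abs_def] exp_minus field_simps scaleR_conv_of_real)
qed

lemma sums_shift_1:
  fixes f :: "nat \<Rightarrow> real"
  assumes "(\<lambda>k. f (Suc k)) sums S" "f 0 = 0"
  shows "f sums S"
  using assms by (subst (asm) sums_Suc_iff) simp

lemma poi_mean_sums: "(\<lambda>k. real k * poi s k) sums s"
proof -
  have "(\<lambda>k. s * poi s k) sums (s * 1)" by (intro sums_mult poi_sums)
  then have "(\<lambda>k. real (Suc k) * poi s (Suc k)) sums s"
    using poi_Suc[of s] by (simp add: mult.commute)
  then show ?thesis by (subst (asm) sums_Suc_iff) simp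
qed

lemma poi_second_sums: "(\<lambda>k. (real k)\<^sup>2 * poi s k) sums (s\<^sup>2 + s)"
proof -
  have "(\<lambda>k. s * (real k * poi s k) + s * poi s k) sums (s * s + s * 1)"
    by (intro sums_add sums_mult poi_mean_sums poi_sums)
  moreover have "s * (real k * poi s k) + s * poi s k = (real (Suc k))\<^sup>2 * poi s (Suc k)" for k
  proof -
    have "s * (real k * poi s k) + s * poi s k = real (Suc k) * (s * poi s k)"
      by (simp add: algebra_simps)
    also have "\<dots> = real (Suc k) * (poi s (Suc k) * real (Suc k))" by (simp only: poi_Suc)
    finally show ?thesis by (simp only: power2_eq_square ac_simps)
  qed
  ultimately have "(\<lambda>k. (real (Suc k))\<^sup>2 * poi s (Suc k)) sums (s\<^sup>2 + s)"
    by (simp add: power2_eq_square)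
  then show ?thesis by (subst (asm) sums_Suc_iff) simp
qed

lemma poi_variance_sums: "(\<lambda>k. (real k - s)\<^sup>2 * poi s k) sums s"
proof -
  have "(\<lambda>k. (real k)\<^sup>2 * poi s k - 2 * s * (real k * poi s k) + s\<^sup>2 * poi s k)
          sums ((s\<^sup>2 + s) - 2 * s * s + s\<^sup>2 * 1)"
    by (intro sums_add sums_diff sums_mult poi_second_sums poi_mean_sums poi_sums)
  moreover have "(real k)\<^sup>2 * poi s k - 2 * s * (real k * poi s k) + s\<^sup>2 * poi s k
      = (real k - s)\<^sup>2 * poi s k" for k
    by (simp add: algebra_simps power2_eq_square)
  ultimately show ?thesis by (simp add: power2_eq_square)
qed

section \<open>Tangent-line inequalities for powers, and bounds on Poisson weights\<close>

lemma concave_powr_le: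
  fixes y a :: real
  assumes "0 < y" "0 \<le> a" "a \<le> 1"
  shows "y powr a \<le> 1 + a * (y - 1)"
  using Youngs_inequality_0[of a "1 - a" y 1] assms by (simp add: algebra_simps)

text \<open>The concave case with exponent 1/a, evaluated at \<open>y powr a\<close> and solved for
  that power.\<close>

lemma convex_powr_ge:
  fixes y a :: real
  assumes "0 < y" "1 \<le> a"
  shows "1 + a * (y - 1) \<le> y powr a"
proof -
  have "(y powr a) powr (1/a) \<le> 1 + (1/a) * (y powr a - 1)"
    by (rule concave_powr_le) (use assms in auto)
  also have "(y powr a) powr (1/a) = y" using assms by (simp add: powr_powr)
  finally show ?thesis using assms by (simp add: field_simps)
qed

lemma summable_poi_bounded:
  assumes "0 \<le> s" "\<And>k. \<bar>F k\<bar> \<le> C"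
  shows "summable (\<lambda>k. poi s k * F k)"
proof (rule summable_comparison_test')
  show "summable (\<lambda>k. poi s k * C)"
    using poi_sums sums_summable summable_mult2 by blast
  show "norm (poi s n * F n) \<le> poi s n * C" for n
    using assms by (auto simp: abs_mult poi_nonneg intro!: mult_mono)
qed

text \<open>For a Poisson variable N of mean s, the expectation of s / (N + 1) is P(N >= 1), since
  multiplying the weight at k by s / (k + 1) gives the weight at k + 1. The tangent-line inequality
  for \<open>(s / real (Suc k)) powr a\<close> reduces every exponent between 0 and 1 to this
  case.\<close>

lemma poi_powr_bound:
  assumes s: "0 < s" and a: "0 \<le> a" "a \<le> 1"
  shows "(\<Sum>k. poi s k * real (Suc k) powr (- a)) \<le> s powr (- a)"
proof -
  have nn: "0 \<le> poi s k" for k using s by (simp add: poi_nonneg)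
  have sm1: "summable (\<lambda>k. poi s (Suc k))" using poi_sums sums_summable summable_Suc_iff by blast
  have eq: "poi s k * (s / real (Suc k)) = poi s (Suc k)" for k
    using poi_Suc[of s k] s by (simp add: field_simps del: of_nat_Suc)
  have le: "poi s k * real (Suc k) powr (- a) \<le> s powr (- a) * ((1 - a) * poi s k + a * poi s (Suc k))" for k
  proof -
    have "(s / real (Suc k)) powr a \<le> 1 + a * (s / real (Suc k) - 1)"
      by (rule concave_powr_le) (use s a in auto)
    then have "poi s k * (s / real (Suc k)) powr a \<le> poi s k * (1 + a * (s / real (Suc k) - 1))"
      using nn by (rule mult_left_mono)
    also have "\<dots> = (1 - a) * poi s k + a * (poi s k * (s / real (Suc k)))"
      by (simp add: algebra_simps)
    finally have "poi s k * (s / real (Suc k)) powr a \<le> (1 - a) * poi s k + a * poi s (Suc k)"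
      by (simp only: eq)
    moreover have "real (Suc k) powr (- a) = s powr (- a) * (s / real (Suc k)) powr a"
      using s by (simp add: powr_divide powr_minus field_simps)
    ultimately show ?thesis using s by (simp add: mult.left_commute)
  qed
  have sm0: "summable (poi s)" using poi_sums sums_summable by blast
  have sm2: "summable (\<lambda>k. s powr (- a) * ((1 - a) * poi s k + a * poi s (Suc k)))"
    by (intro summable_mult summable_add sm0 sm1)
  have smA: "summable (\<lambda>k. poi s k * real (Suc k) powr (- a))"
  proof (rule summable_poi_bounded)
    show "\<bar>real (Suc k) powr - a\<bar> \<le> 1" for k
      using a powr_mono[of "-a" 0 "real (Suc k)"] by simp
  qed (use s in simp)
  have "(\<Sum>k. poi s k * real (Suc k) powr (- a)) \<le> (\<Sum>k. s powr (- a) * ((1 - a) * poi s k + a * poi s (Suc k)))"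
    by (intro suminf_le le smA sm2)
  also have "\<dots> = s powr (- a) * ((1 - a) * (\<Sum>k. poi s k) + a * (\<Sum>k. poi s (Suc k)))"
    by (simp add: suminf_mult suminf_add[symmetric] sm0 sm1 summable_mult summable_add)
  also have "(\<Sum>k. poi s k) = 1" using poi_sums sums_unique by metis
  also have "(\<Sum>k. poi s (Suc k)) = 1 - poi s 0"
    using suminf_split_head[OF sm0] poi_sums[of s] sums_unique by metis
  also have "s powr (- a) * ((1 - a) * 1 + a * (1 - poi s 0)) \<le> s powr (- a) * 1"
    using nn[of 0] a by (intro mult_left_mono) (auto simp: algebra_simps)
  finally show ?thesis by simp
qed

text \<open>The left-hand side is the integral of the concave function \<open>ln\<close> over an interval centred at \<open>m\<close>.\<close>

lemma midpoint_ln: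
  fixes m :: real
  assumes m: "1/2 < m"
  shows "((m + 1/2) * ln (m + 1/2) - (m + 1/2)) - ((m - 1/2) * ln (m - 1/2) - (m - 1/2)) \<le> ln m"
proof -
  define \<psi> where "\<psi> t = ((m + t) * ln (m + t) - (m + t)) - ((m - t) * ln (m - t) - (m - t)) - 2 * t * ln m" for t
  have "\<psi> (1/2) \<le> \<psi> 0"
  proof (rule DERIV_nonpos_imp_nonincreasing[of 0 "1/2" \<psi>])
    fix t :: real assume t: "0 \<le> t" "t \<le> 1/2"
    have d: "(\<psi> has_real_derivative (ln (m + t) + ln (m - t) - 2 * ln m)) (at t)"
      unfolding \<psi>_def using t m
      by (auto intro!: derivative_eq_intros)
    have "ln (m + t) + ln (m - t) = ln ((m + t) * (m - t))"
      using t m by (simp add: ln_mult)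
    also have "\<dots> \<le> ln (m * m)"
      using t m by (intro ln_mono mult_pos_pos) (auto simp: algebra_simps)
    also have "\<dots> = 2 * ln m" using m by (simp add: ln_mult)
    finally show "\<exists>y. (\<psi> has_real_derivative y) (at t) \<and> y \<le> 0" using d by auto
  qed simp
  then show ?thesis by (simp add: \<psi>_def)
qed

text \<open>For fixed k the product of sqrt s and \<open>poi s k\<close> is largest at s = k + 1/2.
  There the claim is a Stirling-type bound on k!, and the induction step is the midpoint inequality
  for ln at k + 1.\<close>

lemma poi_le:
  assumes s: "0 < s"
  shows "poi s k \<le> 1 / sqrt (2 * exp 1 * s)"
proof -
  \<comment> \<open>The logarithm of the claim at s = k + 1/2. It is an equality for k = 0, which is
    where the constant 2e comes from.\<close>
  have base: "ln 2 / 2 + 1 / 2 + (real k + 1/2) * ln (real k + 1/2) - (real k + 1/2) - ln (fact k) \<le> 0" for k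
  proof (induction k)
    case 0
    then show ?case by (simp add: ln_div)
  next
    case (Suc k)
    have "ln (fact (Suc k)) = ln (real (Suc k)) + ln (fact k :: real)"
      by (simp add: ln_mult)
    then show ?case using Suc midpoint_ln[of "real (Suc k)"] by (simp add: algebra_simps)
  qed
  let ?h = "real k + 1/2"
  \<comment> \<open>This says that \<open>?h * ln s - s\<close> is largest at \<open>s = ?h\<close>,
    which carries the claim from there to every s.\<close>
  have "ln (s / ?h) \<le> s / ?h - 1" using s by (intro ln_le_minus_one) auto
  then have "?h * ln (s / ?h) \<le> ?h * (s / ?h - 1)" by (intro mult_left_mono) auto
  also have "\<dots> = s - ?h" by (simp add: field_simps)
  finally have "?h * (ln s - ln ?h) \<le> s - ?h" using s by (simp add: ln_div)
  with base[of k] have *: "(ln 2 + 1 + ln s) / 2 - s + real k * ln s - ln (fact k) \<le> 0"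
    by (simp add: algebra_simps add_divide_distrib)
  have "ln (sqrt (2 * exp 1 * s) * poi s k) = ln (2 * exp 1 * s) / 2 - s + real k * ln s - ln (fact k)"
    using s by (simp add: poi_def ln_mult ln_div ln_realpow ln_sqrt)
  also have "\<dots> = (ln 2 + 1 + ln s) / 2 - s + real k * ln s - ln (fact k)"
    using s by (simp add: ln_mult)
  finally have "ln (sqrt (2 * exp 1 * s) * poi s k) \<le> 0" using * by simp
  then have "sqrt (2 * exp 1 * s) * poi s k \<le> 1"
    using s by (subst (asm) ln_le_zero_iff) (auto simp: poi_def)
  then show ?thesis using s by (simp add: field_simps)
qed

section \<open>First and second differences of Poisson-weighted sums\<close>

lemma poi_shift_diff:
  assumes s: "0 < s" and F: "\<And>k. 0 \<le> F k" "\<And>k. F k \<le> 1"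
  shows "\<bar>(\<Sum>k. poi s k * F (Suc k)) - (\<Sum>k. poi s k * F k)\<bar> \<le> 1 / sqrt (2 * exp 1 * s)"
proof -
  \<comment> \<open>The Poisson weights minus their shift by one. Their sign changes once, after the
    integer part of s, so the positive part telescopes to \<open>poi s n0\<close>: the total
    variation distance is a single Poisson probability.\<close>
  define r where "r m = poi s m - (if m = 0 then 0 else poi s (m - 1))" for m
  have sm: "summable (\<lambda>k. poi s k * E k)" if "\<And>k. 0 \<le> E k" "\<And>k. E k \<le> 1" for E
    by (rule summable_poi_bounded[where C = 1]) (use s that in \<open>auto simp: abs_le_iff intro: order_trans\<close>)
  have rs: "(\<lambda>m. r m * E m) sums ((\<Sum>k. poi s k * E k) - (\<Sum>k. poi s k * E (Suc k)))"
    if E: "\<And>k. 0 \<le> E k" "\<And>k. E k \<le> 1" for E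
  proof -
    have "(\<lambda>k. poi s k * E (Suc k)) sums (\<Sum>k. poi s k * E (Suc k))"
      using sm[of "\<lambda>k. E (Suc k)"] E by (intro summable_sums) auto
    then have "(\<lambda>m. (if m = 0 then 0 else poi s (m - 1)) * E m) sums (\<Sum>k. poi s k * E (Suc k))"
      by - (rule sums_shift_1, simp_all)
    from sums_diff[OF summable_sums[OF sm[of E, OF E]] this] show ?thesis
      by (simp add: r_def algebra_simps)
  qed
  define n0 where "n0 = nat \<lfloor>s\<rfloor>"
  have n0: "m \<le> n0 \<longleftrightarrow> real m \<le> s" for m
    unfolding n0_def using s by (simp add: le_nat_iff le_floor_iff)
  have sgn: "(m \<le> n0 \<longrightarrow> 0 \<le> r m) \<and> (\<not> m \<le> n0 \<longrightarrow> r m \<le> 0)" for m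
  proof (cases m)
    case 0 then show ?thesis using s by (simp add: r_def poi_nonneg)
  next
    case (Suc k)
    have e: "s * r m = (s - real m) * poi s m"
      using poi_Suc[of s k] Suc by (simp add: r_def algebra_simps del: of_nat_Suc)
    have "real m \<le> s \<Longrightarrow> 0 \<le> s * r m" unfolding e using s by (simp add: poi_nonneg)
    moreover have "\<not> real m \<le> s \<Longrightarrow> s * r m \<le> 0" unfolding e using s by (simp add: poi_nonneg mult_nonpos_nonneg)
    ultimately show ?thesis using s by (auto simp: n0 zero_le_mult_iff mult_le_0_iff)
  qed
  have tel: "(\<Sum>m\<le>n. r m) = poi s n" for n
    by (induction n) (auto simp: r_def)
  have up: "(\<Sum>k. poi s k * E k) - (\<Sum>k. poi s k * E (Suc k)) \<le> 1 / sqrt (2 * exp 1 * s)"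
    if E: "\<And>k. 0 \<le> E k" "\<And>k. E k \<le> 1" for E
  proof -
    have "(\<lambda>m. if m \<in> {..n0} then r m else 0) sums (\<Sum>m\<in>{..n0}. r m)"
      by (rule sums_If_finite_set) simp
    then have fin: "(\<lambda>m. if m \<le> n0 then r m else 0) sums poi s n0" by (simp add: tel)
    have "r m * E m \<le> (if m \<le> n0 then r m else 0)" for m
      using sgn[of m] E[of m] by (auto intro: mult_left_le mult_nonpos_nonneg)
    then have "(\<Sum>k. poi s k * E k) - (\<Sum>k. poi s k * E (Suc k)) \<le> poi s n0"
      by (intro sums_le[OF _ rs[of E, OF E] fin]) simp
    also have "\<dots> \<le> 1 / sqrt (2 * exp 1 * s)" by (rule poi_le[OF s])
    finally show ?thesis .
  qed
  have sm0: "summable (poi s)" using poi_sums sums_summable by blast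
  have one: "(\<Sum>k. poi s k * (1 - E k)) = 1 - (\<Sum>k. poi s k * E k)"
    if "\<And>k. 0 \<le> E k" "\<And>k. E k \<le> 1" for E
  proof -
    have "(\<Sum>k. poi s k * (1 - E k)) = (\<Sum>k. poi s k - poi s k * E k)" by (simp add: algebra_simps)
    also have "\<dots> = (\<Sum>k. poi s k) - (\<Sum>k. poi s k * E k)"
      by (rule suminf_diff[symmetric]) (use sm0 sm[of E] that in auto)
    finally show ?thesis using poi_sums[of s] sums_unique by metis
  qed
  \<comment> \<open>The one-sided bound for 1 - F is the opposite bound for F, because the total
    mass 1 cancels.\<close>
  have "(\<Sum>k. poi s k * (1 - F k)) - (\<Sum>k. poi s k * (1 - F (Suc k))) \<le> 1 / sqrt (2 * exp 1 * s)"
    using up[of "\<lambda>k. 1 - F k"] F by auto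
  then have "(\<Sum>k. poi s k * F (Suc k)) - (\<Sum>k. poi s k * F k) \<le> 1 / sqrt (2 * exp 1 * s)"
    using one[of F] one[of "\<lambda>k. F (Suc k)"] F by auto
  then show ?thesis using up[of F] F by (auto simp: abs_le_iff)
qed

text \<open>In the application \<open>F k\<close> and \<open>G k\<close> are means of f with k
  random points added, without and with one further fixed point. \<open>G k\<close> and
  \<open>F (Suc k)\<close> concern equally many points and differ by the cost of a move; the
  remaining shift of the index is paid for by total variation.\<close>

lemma poi_first_difference:
  assumes s: "0 < s" and a: "0 \<le> a" "a \<le> 1"
    and F: "\<And>k. 0 \<le> F k" "\<And>k. F k \<le> 1" and G: "\<And>k. 0 \<le> G k" "\<And>k. G k \<le> 1"
    and FG: "\<And>k. \<bar>G k - F (Suc k)\<bar> \<le> real (Suc k) powr (- a)"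
  shows "\<bar>(\<Sum>k. poi s k * G k) - (\<Sum>k. poi s k * F k)\<bar> \<le> 1 / sqrt (2 * exp 1 * s) + s powr (- a)"
proof -
  have sm: "summable (\<lambda>k. poi s k * E k)" if "\<And>k. 0 \<le> E k" "\<And>k. E k \<le> 1" for E
    by (rule summable_poi_bounded[where C = 1]) (use s that in \<open>auto simp: abs_le_iff intro: order_trans\<close>)
  have sm1: "summable (\<lambda>k. poi s k * real (Suc k) powr (- a))"
    by (rule sm) (use a powr_mono[of "-a" 0] in auto)
  have d: "\<bar>poi s k * (G k - F (Suc k))\<bar> \<le> poi s k * real (Suc k) powr (- a)" for k
    unfolding abs_mult using FG[of k] s by (simp add: poi_nonneg mult_left_mono)
  have sma: "summable (\<lambda>k. \<bar>poi s k * (G k - F (Suc k))\<bar>)"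
    by (rule summable_comparison_test'[OF sm1]) (use d in auto)
  have "\<bar>(\<Sum>k. poi s k * G k) - (\<Sum>k. poi s k * F (Suc k))\<bar> = \<bar>\<Sum>k. poi s k * (G k - F (Suc k))\<bar>"
    by (subst suminf_diff) (use sm[of G] sm[of "\<lambda>k. F (Suc k)"] F G in \<open>auto simp: algebra_simps\<close>)
  also have "\<dots> \<le> (\<Sum>k. \<bar>poi s k * (G k - F (Suc k))\<bar>)" by (rule summable_rabs[OF sma])
  also have "\<dots> \<le> (\<Sum>k. poi s k * real (Suc k) powr (- a))" by (intro suminf_le d sma sm1)
  also have "\<dots> \<le> s powr (- a)" by (rule poi_powr_bound[OF s a])
  finally show ?thesis using poi_shift_diff[OF s, of F] F by auto
qed

text \<open>The masses \<open>a\<close> at \<open>K\<close> and \<open>c\<close> at \<open>F\<close> are matched with the mass \<open>b\<close> at each of \<open>G\<close> and \<open>H\<close>: matched mass costs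
  \<open>\<delta>\<close>, and only the excess costs up to 1.\<close>

lemma transport_le:
  fixes a b c \<delta> :: real
  assumes w: "0 \<le> a" "0 \<le> b" "0 \<le> c"
    and r: "K \<le> 1" "F \<le> 1" "0 \<le> G" "0 \<le> H"
    and d: "K - G \<le> \<delta>" "K - H \<le> \<delta>" "F - G \<le> \<delta>" "F - H \<le> \<delta>" and \<delta>: "0 \<le> \<delta>"
  shows "a * K - b * (G + H) + c * F \<le> 2 * b * \<delta> + max 0 (a + c - 2 * b)"
proof -
  define \<Gamma> where "\<Gamma> = min G H"
  have \<Gamma>: "0 \<le> \<Gamma>" "K \<le> \<Gamma> + \<delta>" "F \<le> \<Gamma> + \<delta>" "2 * \<Gamma> \<le> G + H" using r d by (auto simp: \<Gamma>_def)
  \<comment> \<open>The worst case has G and H at their common minimum, and K and F at the largest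
    value that the cap 1 and the cost \<delta> allow.\<close>
  define \<Phi> where "\<Phi> = min 1 (\<Gamma> + \<delta>)"
  have \<Phi>: "K \<le> \<Phi>" "F \<le> \<Phi>" "\<Phi> \<le> 1" "\<Phi> \<le> \<Gamma> + \<delta>" "0 \<le> \<Phi>" using \<Gamma> r \<delta> by (auto simp: \<Phi>_def)
  have "a * K - b * (G + H) + c * F \<le> a * \<Phi> - b * (2 * \<Gamma>) + c * \<Phi>"
    using w \<Phi> \<Gamma> by (intro add_mono diff_mono mult_left_mono) auto
  also have "\<dots> = (a + c) * \<Phi> - 2 * b * \<Gamma>" by (simp add: algebra_simps)
  also have "\<dots> \<le> 2 * b * \<delta> + max 0 (a + c - 2 * b)"
  proof (cases "a + c \<le> 2 * b")
    case True
    have "(a + c) * \<Phi> \<le> 2 * b * \<Phi>" using True \<Phi> by (intro mult_right_mono) auto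
    also have "\<dots> \<le> 2 * b * (\<Gamma> + \<delta>)" using w \<Phi> by (intro mult_left_mono) auto
    finally show ?thesis using True by (simp add: algebra_simps)
  next
    case False
    have "(a + c - 2 * b) * \<Phi> \<le> (a + c - 2 * b) * 1" using False \<Phi> by (intro mult_left_mono) auto
    moreover have "2 * b * \<Phi> \<le> 2 * b * (\<Gamma> + \<delta>)" using w \<Phi> by (intro mult_left_mono) auto
    ultimately show ?thesis using False by (simp add: algebra_simps)
  qed
  finally show ?thesis .
qed

text \<open>Everything is re-indexed by the total number m of extra points: F with m, G and H with m
  - 1 and one fixed point, K with m - 2 and two. The weights at m become \<open>poi s m\<close>,
  \<open>q1 m\<close> twice, and \<open>q2 m\<close>; their second difference is
  \<open>poi s m\<close> times ((m - s)^2 - m) / s^2. The variance dominates its positive part and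
  the mean its negative part, and each sums to 1/s.\<close>

lemma poi_second_difference:
  assumes s: "0 < s" and a: "0 \<le> a" "a \<le> 1"
    and F: "\<And>k. 0 \<le> F k" "\<And>k. F k \<le> 1" and G: "\<And>k. 0 \<le> G k" "\<And>k. G k \<le> 1"
    and H: "\<And>k. 0 \<le> H k" "\<And>k. H k \<le> 1" and K: "\<And>k. 0 \<le> K k" "\<And>k. K k \<le> 1"
    and FG: "\<And>k. \<bar>G k - F (Suc k)\<bar> \<le> real (Suc k) powr (- a)"
    and FH: "\<And>k. \<bar>H k - F (Suc k)\<bar> \<le> real (Suc k) powr (- a)"
    and GK: "\<And>k. \<bar>K k - G (Suc k)\<bar> \<le> real (Suc (Suc k)) powr (- a)"
    and HK: "\<And>k. \<bar>K k - H (Suc k)\<bar> \<le> real (Suc (Suc k)) powr (- a)"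
  shows "\<bar>(\<Sum>k. poi s k * K k) - (\<Sum>k. poi s k * G k) - (\<Sum>k. poi s k * H k) + (\<Sum>k. poi s k * F k)\<bar>
    \<le> 2 * s powr (- a) + 1 / s"
proof -
  have sm: "(\<lambda>k. poi s k * E k) sums (\<Sum>k. poi s k * E k)" if "\<And>k. 0 \<le> E k" "\<And>k. E k \<le> 1" for E
    by (rule summable_sums, rule summable_poi_bounded[where C = 1]) (use s that in \<open>auto simp: abs_le_iff intro: order_trans\<close>)
  define q1 where "q1 m = real m * poi s m / s" for m
  define q2 where "q2 m = real m * (real m - 1) * poi s m / s\<^sup>2" for m
  have q1S: "q1 (Suc k) = poi s k" for k
    using poi_Suc[of s k] s by (simp add: q1_def field_simps del: of_nat_Suc)
  have q2S: "q2 (Suc (Suc k)) = poi s k" for k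
  proof -
    have "q2 (Suc (Suc k)) = real (Suc k) * (poi s (Suc (Suc k)) * real (Suc (Suc k))) / s\<^sup>2"
      by (simp add: q2_def)
    also have "\<dots> = s * (poi s (Suc k) * real (Suc k)) / s\<^sup>2"
      by (subst poi_Suc) (simp add: ac_simps del: of_nat_Suc)
    also have "\<dots> = poi s k" using s by (simp only: poi_Suc) (simp add: power2_eq_square)
    finally show ?thesis .
  qed
  \<comment> \<open>At sizes too small for the fixed points these values carry weight 0; setting
    them to \<open>F m\<close> keeps the comparisons in \<open>dist\<close> valid there.\<close>
  define Gt where "Gt m = (if m = 0 then F m else G (m - 1))" for m
  define Ht where "Ht m = (if m = 0 then F m else H (m - 1))" for m
  define Kt where "Kt m = (if m < 2 then F m else K (m - 2))" for m
  define \<delta> where "\<delta> m = real m powr (- a)" for m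
  have sF: "(\<lambda>m. poi s m * F m) sums (\<Sum>k. poi s k * F k)" using sm F by auto
  have sG: "(\<lambda>m. q1 m * Gt m) sums (\<Sum>k. poi s k * G k)"
    by (rule sums_shift_1) (use sm[of G] G in \<open>auto simp: q1S Gt_def q1_def[of 0]\<close>)
  have sH: "(\<lambda>m. q1 m * Ht m) sums (\<Sum>k. poi s k * H k)"
    by (rule sums_shift_1) (use sm[of H] H in \<open>auto simp: q1S Ht_def q1_def[of 0]\<close>)
  have sK: "(\<lambda>m. q2 m * Kt m) sums (\<Sum>k. poi s k * K k)"
    by (rule sums_shift_1, rule sums_shift_1) (use sm[of K] K in \<open>auto simp: q2S Kt_def q2_def[of 0] q2_def[of "Suc 0"]\<close>)
  define t where "t m = q2 m * Kt m - q1 m * (Gt m + Ht m) + poi s m * F m" for m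
  have st: "t sums ((\<Sum>k. poi s k * K k) - (\<Sum>k. poi s k * G k) - (\<Sum>k. poi s k * H k) + (\<Sum>k. poi s k * F k))"
    using sums_add[OF sums_diff[OF sums_diff[OF sK sG] sH] sF] by (simp add: t_def[abs_def] algebra_simps)
  have q: "0 \<le> poi s m" "0 \<le> q1 m" "0 \<le> q2 m" for m
  proof -
    have "0 \<le> real m * (real m - 1)" by (cases m) auto
    then show "0 \<le> poi s m" "0 \<le> q1 m" "0 \<le> q2 m" using s by (simp_all add: poi_nonneg q1_def q2_def)
  qed
  have c: "q2 m + poi s m - 2 * q1 m = poi s m * ((real m - s)\<^sup>2 - real m) / s\<^sup>2" for m
    using s by (simp add: q1_def q2_def field_simps power2_eq_square)
  have \<delta>0: "0 \<le> \<delta> m" for m by (simp add: \<delta>_def)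
  have dist: "\<bar>Kt m - Gt m\<bar> \<le> \<delta> m" "\<bar>Kt m - Ht m\<bar> \<le> \<delta> m" "\<bar>F m - Gt m\<bar> \<le> \<delta> m" "\<bar>F m - Ht m\<bar> \<le> \<delta> m" for m
  proof -
    consider "m = 0" | "m = Suc 0" | k where "m = Suc (Suc k)" by (cases m; cases "m - 1") auto
    then have "\<bar>Kt m - Gt m\<bar> \<le> \<delta> m \<and> \<bar>Kt m - Ht m\<bar> \<le> \<delta> m \<and> \<bar>F m - Gt m\<bar> \<le> \<delta> m \<and> \<bar>F m - Ht m\<bar> \<le> \<delta> m"
    proof cases
      case 1 then show ?thesis using \<delta>0[of 0] by (simp add: Kt_def Gt_def Ht_def)
    next
      case 2 then show ?thesis using FG[of 0] FH[of 0] by (auto simp: Kt_def Gt_def Ht_def \<delta>_def abs_minus_commute)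
    next
      case 3 then show ?thesis using FG[of "Suc k"] FH[of "Suc k"] GK[of k] HK[of k]
        by (auto simp: Kt_def Gt_def Ht_def \<delta>_def abs_minus_commute)
    qed
    then show "\<bar>Kt m - Gt m\<bar> \<le> \<delta> m" "\<bar>Kt m - Ht m\<bar> \<le> \<delta> m" "\<bar>F m - Gt m\<bar> \<le> \<delta> m" "\<bar>F m - Ht m\<bar> \<le> \<delta> m" by auto
  qed
  have rng: "0 \<le> Kt m" "Kt m \<le> 1" "0 \<le> Gt m" "Gt m \<le> 1" "0 \<le> Ht m" "Ht m \<le> 1" for m
    using F G H K by (auto simp: Kt_def Gt_def Ht_def)
  have up: "t m \<le> 2 * q1 m * \<delta> m + (real m - s)\<^sup>2 * poi s m / s\<^sup>2" for m
  proof -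
    have "t m \<le> 2 * q1 m * \<delta> m + max 0 (q2 m + poi s m - 2 * q1 m)"
      unfolding t_def using q[of m] rng[of m] F[of m] dist[of m] \<delta>0[of m]
      by (intro transport_le) linarith+
    also have "max 0 (q2 m + poi s m - 2 * q1 m) \<le> (real m - s)\<^sup>2 * poi s m / s\<^sup>2"
      unfolding c using q[of m] s by (auto simp: divide_right_mono algebra_simps mult_nonneg_nonneg)
    finally show ?thesis by simp
  qed
  have lo: "- t m \<le> 2 * q1 m * \<delta> m + real m * poi s m / s\<^sup>2" for m
  proof -
    \<comment> \<open>Passing to the complements turns the left side into the excess mass minus
      \<open>t m\<close>, so for the lower bound only the negative part of the excess has to be
      paid.\<close>
    have "q2 m * (1 - Kt m) - q1 m * ((1 - Gt m) + (1 - Ht m)) + poi s m * (1 - F m) \<le> 2 * q1 m * \<delta> m + max 0 (q2 m + poi s m - 2 * q1 m)"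
      using q[of m] rng[of m] F[of m] dist[of m] \<delta>0[of m] by (intro transport_le) linarith+
    then have "- t m \<le> 2 * q1 m * \<delta> m + max (- (q2 m + poi s m - 2 * q1 m)) 0"
      by (auto simp: t_def algebra_simps max_def)
    also have "max (- (q2 m + poi s m - 2 * q1 m)) 0 \<le> real m * poi s m / s\<^sup>2"
    proof -
      have "0 \<le> (real m - s)\<^sup>2 * poi s m / s\<^sup>2" "0 \<le> real m * poi s m / s\<^sup>2" using q[of m] by auto
      then show ?thesis unfolding c by (simp add: right_diff_distrib diff_divide_distrib ac_simps)
    qed
    finally show ?thesis by simp
  qed
  have sd: "(\<lambda>m. 2 * q1 m * \<delta> m) sums (2 * (\<Sum>k. poi s k * real (Suc k) powr (- a)))"
  proof -
    have "(\<lambda>k. poi s k * real (Suc k) powr (- a)) sums (\<Sum>k. poi s k * real (Suc k) powr (- a))"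
      by (rule sm) (use a powr_mono[of "-a" 0] in auto)
    then have "(\<lambda>m. q1 m * \<delta> m) sums (\<Sum>k. poi s k * real (Suc k) powr (- a))"
      unfolding q1S[symmetric] \<delta>_def by (rule sums_shift_1) (simp add: q1_def)
    from sums_mult[OF this, of 2] show ?thesis by (simp add: mult.assoc)
  qed
  have v: "(\<lambda>m. (real m - s)\<^sup>2 * poi s m / s\<^sup>2) sums (s / s\<^sup>2)"
    by (intro sums_divide poi_variance_sums)
  have mm: "(\<lambda>m. real m * poi s m / s\<^sup>2) sums (s / s\<^sup>2)"
    by (intro sums_divide poi_mean_sums)
  have ss: "s / s\<^sup>2 = 1 / s" using s by (simp add: power2_eq_square)
  have "(\<Sum>k. poi s k * K k) - (\<Sum>k. poi s k * G k) - (\<Sum>k. poi s k * H k) + (\<Sum>k. poi s k * F k)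
    \<le> 2 * (\<Sum>k. poi s k * real (Suc k) powr (- a)) + s / s\<^sup>2"
    by (rule sums_le[OF _ st sums_add[OF sd v]]) (rule up)
  moreover have "- ((\<Sum>k. poi s k * K k) - (\<Sum>k. poi s k * G k) - (\<Sum>k. poi s k * H k) + (\<Sum>k. poi s k * F k))
    \<le> 2 * (\<Sum>k. poi s k * real (Suc k) powr (- a)) + s / s\<^sup>2"
    by (rule sums_le[OF _ sums_minus[OF st] sums_add[OF sd mm]]) (rule lo)
  ultimately show ?thesis using poi_powr_bound[OF s a] by (simp add: ss abs_le_iff)
qed

section \<open>The constants \<open>c1\<close> and \<open>c2\<close> as integrals over u\<close>

definition expo :: "ereal \<Rightarrow> real" where
  "expo p = (if p = \<infinity> then 0 else 1 / real_of_ereal p)"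

lemma expo_bounds: "1 \<le> p \<Longrightarrow> 0 \<le> expo p" "1 \<le> p \<Longrightarrow> expo p \<le> 1"
  by (cases p; simp add: expo_def one_ereal_def)+

text \<open>Rationalising the denominator shows that \<open>kappa0\<close> is the larger root k of 2
  e (k - 1)^2 = k. The threshold identity is the square root of this equation, with the sign settled
  by \<open>1 < kappa0\<close>.\<close>

lemma kappa0_gt_1: "1 < kappa0"
  and kappa0_threshold: "sqrt (2 / exp 1) * sqrt kappa0 = 2 * (kappa0 - 1)"
proof -
  define e where "e = (exp 1 :: real)"
  define r where "r = sqrt (1 + 8 * e)"
  have e: "0 < e" by (simp add: e_def)
  have r: "r * r = 1 + 8 * e" "0 < r" using e by (simp_all add: r_def)
  have r1: "r < 1 + 4 * e" using e unfolding r_def by (intro real_less_lsqrt) (auto simp: power2_eq_square algebra_simps)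
  have k: "kappa0 = 4 * e / (1 + 4 * e - r)" by (simp add: kappa0_def e_def r_def)
  have "(1 + 4 * e - r) * (1 + 4 * e + r) = 16 * e * e" using r(1) by (simp add: algebra_simps)
  then have k2: "kappa0 = 1 + (1 + r) / (4 * e)"
    unfolding k using r1 e by (simp add: field_simps)
  have k3: "0 < (1 + r) / (4 * e)" using e r(2) by simp
  show k4: "1 < kappa0" unfolding k2 using k3 by simp
  have "(2 * (kappa0 - 1))\<^sup>2 = 2 / e * kappa0"
  proof -
    have "(1 + r)\<^sup>2 = 2 + 2 * r + 8 * e" using r(1) by (simp add: power2_eq_square algebra_simps)
    moreover have "(2 * (kappa0 - 1))\<^sup>2 = (1 + r)\<^sup>2 / (4 * e\<^sup>2)"
      unfolding k2 using e by (simp add: field_simps power2_eq_square)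
    ultimately show ?thesis unfolding k2 using e by (simp add: field_simps power2_eq_square)
  qed
  moreover have "0 \<le> 2 * (kappa0 - 1)" using k4 by simp
  ultimately have "sqrt (2 / e * kappa0) = 2 * (kappa0 - 1)" by (metis real_sqrt_unique)
  then show "sqrt (2 / exp 1) * sqrt kappa0 = 2 * (kappa0 - 1)"
    by (simp only: e_def real_sqrt_mult)
qed

text \<open>\<open>kappa0\<close> solves \<open>1 / sqrt (2 e s) + 1 / s = 1\<close>. Integrating the minimum of 1 and
  \<open>1 / sqrt (2 e s) + s powr (- 1/p)\<close> with this threshold leaves \<open>(kappa1 + rem1 p l) / l\<close> after the square root
  term; maximising it over \<open>l\<close> produces the constants in \<open>gamma1\<close>.\<close>

definition rem1 :: "real \<Rightarrow> real \<Rightarrow> real" where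
  "rem1 p l = (if p = 1 then ln (l / kappa0) else p / (p - 1) * (l powr (1 - 1/p) - kappa0 powr (1 - 1/p)))"

text \<open>A tangent-line inequality in each range of p: for ln if p = 1, for a convex power of
  \<open>l powr (1 - 1/p)\<close> if 1 < p < 2, for a convex power of \<open>sqrt l\<close> if p >
  2. At p = 2 both rates agree and only a negative term is dropped. The slower of the rates 1/2 and
  1/p survives, hence the exponent \<open>1 / max 2 p\<close>.\<close>

lemma gamma1_bound:
  assumes p: "1 \<le> p" and l: "0 < l"
  shows "sqrt (2 / exp 1) * l powr (- 1/2) + (kappa1 + rem1 p l) / l \<le> gamma1 p * l powr (- 1 / max 2 p)"
proof -
  have k0: "0 < kappa0" using kappa0_gt_1 by simp
  define q where "q = 1 - 1/p"
  define D where "D = p * kappa0 powr q - kappa1 * (p - 1)"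
  have D0: "0 < D" if "1 < p"
  proof -
    have "1 \<le> kappa0 powr q" using kappa0_gt_1 that by (simp add: q_def ge_one_powr_ge_zero)
    then have "p * 1 \<le> p * kappa0 powr q" using p by (intro mult_left_mono) auto
    moreover have "kappa1 * (p - 1) \<le> 1 * (p - 1)" using that kappa0_gt_1 by (intro mult_right_mono) (auto simp: kappa1_def)
    ultimately show ?thesis by (simp add: D_def)
  qed
  have rem: "kappa1 + rem1 p l = p / (p - 1) * l powr q - D / (p - 1)" if "1 < p"
  proof -
    have "D / (p - 1) = p / (p - 1) * kappa0 powr q - kappa1"
      using that by (simp add: D_def diff_divide_distrib)
    then show ?thesis using that by (simp add: rem1_def q_def right_diff_distrib)
  qed
  consider "p = 1" | "p = 2" | "1 < p" "p < 2" | "2 < p" using p by linarith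
  then show ?thesis
  proof cases
    case 1
    \<comment> \<open>Normalised so that x = 1, the point where ln touches its tangent, is l =
      kappa0 * exp kappa0; this explains the constant for p = 1.\<close>
    define x where "x = sqrt (l / (kappa0 * exp kappa0))"
    have x: "0 < x" using l k0 by (simp add: x_def)
    have "ln (l / kappa0) = 2 * ln x + kappa0"
      using l k0 by (simp add: x_def ln_sqrt ln_div ln_mult field_simps)
    then have "kappa1 + rem1 p l = 2 + 2 * ln x" using 1 by (simp add: rem1_def kappa1_def)
    also have "\<dots> \<le> 2 * x" using ln_le_minus_one[OF x] by simp
    finally have "(kappa1 + rem1 p l) / l \<le> 2 * x / l" using l by (simp add: divide_right_mono)
    also have "2 * x / l = 2 * (kappa0 * exp kappa0) powr (-1/2) * l powr (-1/2)"
      using l k0 by (simp add: x_def powr_minus powr_half_sqrt real_sqrt_divide field_simps)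
    finally show ?thesis using 1 by (simp add: gamma1_def algebra_simps)
  next
    case 2
    have "(kappa1 + rem1 p l) / l = (2 * sqrt l - D) / l"
      using 2 l k0 by (simp add: rem1_def D_def q_def powr_half_sqrt algebra_simps)
    also have "\<dots> \<le> 2 * sqrt l / l" using D0 2 l by (simp add: divide_right_mono)
    also have "\<dots> = 2 * l powr (- 1/2)" using l by (simp add: powr_minus powr_half_sqrt field_simps)
    finally show ?thesis using 2 by (simp add: gamma1_def pw_def algebra_simps)
  next
    case 3
    \<comment> \<open>With this R the tangent to \<open>(R * z) powr (1 + e)\<close> at z = 1 / R,
      scaled by 2 / R, has exactly the slope p / (p - 1) and the intercept - D / (p - 1) of the
      expression to be bounded.\<close>
    define R where "R = (2 - p) / D"
    define e where "e = (2 - p) / (2 * (p - 1))"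
    have R: "0 < R" using 3 D0 by (simp add: R_def)
    have e: "0 < e" using 3 by (simp add: e_def)
    define z where "z = l powr q"
    have z: "0 < z" using l by (simp add: z_def)
    have qe: "q * (1 + e) = 1/2" using 3 by (simp add: q_def e_def field_simps)
    have zz: "z powr (1 + e) = sqrt l"
      using l by (simp add: z_def powr_powr qe powr_half_sqrt less_imp_le)
    have "kappa1 + rem1 p l = p / (p - 1) * z - D / (p - 1)" using rem 3 by (simp add: z_def)
    also have "\<dots> = 2 / R * (1 + (1 + e) * (R * z - 1))"
    proof -
      have "2 / R * (1 + (1 + e) * (R * z - 1)) = 2 * (1 + e) * z - 2 * e / R"
        using R by (simp add: field_simps)
      also have "2 * (1 + e) = p / (p - 1)" using 3 by (simp add: e_def field_simps)
      also have "2 * e / R = D / (p - 1)"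
      proof -
        have "2 * e = (2 - p) / (p - 1)" using 3 by (simp add: e_def frac_eq_eq algebra_simps)
        then show ?thesis using 3 D0 by (simp add: R_def)
      qed
      finally show ?thesis ..
    qed
    also have "\<dots> \<le> 2 / R * (R * z) powr (1 + e)"
      using R z e by (intro mult_left_mono convex_powr_ge) auto
    also have "\<dots> = 2 * R powr e * sqrt l"
      using R z by (simp add: powr_mult zz) (simp add: powr_add)
    finally have "(kappa1 + rem1 p l) / l \<le> 2 * R powr e * sqrt l / l"
      using l by (simp add: divide_right_mono)
    also have "\<dots> = 2 * R powr e * l powr (- 1/2)"
      using l by (simp add: powr_minus powr_half_sqrt field_simps)
    finally show ?thesis using 3 e
      by (simp add: gamma1_def pw_def R_def D_def q_def e_def algebra_simps)
  next
    case 4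
    \<comment> \<open>For p > 2 the square root is the lower-order term. Together with the negative
      constant it lies on a tangent to a multiple of its power \<open>l powr q\<close>, so that only
      the rate 1/p remains.\<close>
    define R where "R = (p - 2) / (sqrt (2 * exp 1) * D)"
    define a where "a = (p - 2) / p"
    define z where "z = sqrt l"
    have R: "0 < R" using 4 D0 by (simp add: R_def)
    have a: "0 < a" using 4 by (simp add: a_def)
    have z: "0 < z" using l by (simp add: z_def)
    have aq: "1/2 * (1 + a) = q" using 4 by (simp add: q_def a_def field_simps)
    have "z = l powr (1/2)" using l by (simp add: z_def powr_half_sqrt)
    then have zz: "z powr (1 + a) = l powr q" by (simp only: powr_powr aq)
    have s2: "sqrt (2 / exp 1) = 2 / sqrt (2 * exp 1)"
      by (simp add: real_sqrt_divide real_sqrt_mult field_simps)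
    have "sqrt (2 / exp 1) * z - D / (p - 1) = 1 / sqrt (2 * exp 1) * (p / (p - 1)) / R * (1 + (1 + a) * (R * z - 1))"
    proof -
      have "1 / sqrt (2 * exp 1) * (p / (p - 1)) / R * (1 + (1 + a) * (R * z - 1))
         = 1 / sqrt (2 * exp 1) * (p / (p - 1) * (1 + a)) * z - 1 / sqrt (2 * exp 1) * (p / (p - 1) * a) / R"
      proof -
        have "X * Y / R * (1 + (1 + a) * (R * z - 1)) = X * (Y * (1 + a)) * z - X * (Y * a) / R" for X Y :: real
          using R by (simp add: field_simps)
        then show ?thesis .
      qed
      also have "p / (p - 1) * (1 + a) = 2" using 4 by (simp add: a_def field_simps)
      also have "p / (p - 1) * a = (p - 2) / (p - 1)" using 4 by (simp add: a_def field_simps)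
      also have "1 / sqrt (2 * exp 1) * ((p - 2) / (p - 1)) / R = D / (p - 1)"
      proof -
        have "1 / S * (x / y) / (x / (S * D)) = D / y" if "0 < S" "0 < x" "0 < y" for S x y :: real
          using D0 4 that by simp
        from this[of "sqrt (2 * exp 1)" "p - 2" "p - 1"] show ?thesis unfolding R_def using 4 by simp
      qed
      finally show ?thesis by (simp add: s2)
    qed
    also have "\<dots> \<le> 1 / sqrt (2 * exp 1) * (p / (p - 1)) / R * (R * z) powr (1 + a)"
      using R z a 4 by (intro mult_left_mono convex_powr_ge) auto
    also have "\<dots> = 1 / sqrt (2 * exp 1) * (p / (p - 1)) * R powr a * l powr q"
      using R z by (simp add: powr_mult zz) (simp add: powr_add)
    finally have *: "(sqrt (2 / exp 1) * z - D / (p - 1)) / l \<le> 1 / sqrt (2 * exp 1) * (p / (p - 1)) * R powr a * l powr q / l"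
      by (rule divide_right_mono) (use l in simp)
    have lq: "l powr q / l = l powr (- 1/p)" using l by (simp add: q_def powr_diff powr_minus field_simps)
    have lz: "z / l = l powr (- 1/2)" using l by (simp add: z_def powr_minus powr_half_sqrt field_simps)
    have "sqrt (2 / exp 1) * l powr (- 1/2) + (kappa1 + rem1 p l) / l
       = (sqrt (2 / exp 1) * z - D / (p - 1)) / l + p / (p - 1) * (l powr q / l)"
      unfolding lz[symmetric] using 4 by (simp add: rem add_divide_distrib diff_divide_distrib)
    also have "\<dots> \<le> 1 / sqrt (2 * exp 1) * (p / (p - 1)) * R powr a * (l powr q / l) + p / (p - 1) * (l powr q / l)"
      using * by simp
    also have "\<dots> = gamma1 p * l powr (- 1 / max 2 p)"
    proof -
      have "gamma1 p = p / (p - 1) + 1 / sqrt (2 * exp 1) * (p / (p - 1)) * R powr a"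
        unfolding gamma1_def pw_def R_def D_def q_def a_def using 4 by (simp del: real_sqrt_mult)
      moreover have "- 1 / max 2 p = - 1/p" using 4 by (simp add: max_def)
      ultimately show ?thesis unfolding lq by (simp only: distrib_right)
    qed
    finally show ?thesis .
  qed
qed

definition bd1 :: "real \<Rightarrow> real \<Rightarrow> real" where
  "bd1 a s = min 1 (1 / sqrt (2 * exp 1 * s) + s powr (- a))"

text \<open>The value 2 is the trivial bound for a second difference of a function into [0, 1]. The
  factor 3 collects \<open>2 * s powr (- a)\<close> and 1/s: the latter is at most
  \<open>s powr (- a)\<close> once s >= 1, and below that the trivial bound is the smaller
  one.\<close>

definition bd2 :: "real \<Rightarrow> real \<Rightarrow> real" where
  "bd2 a s = min 2 (3 * s powr (- a))"

text \<open>A majorant is integrated in place of the minimum: 1 up to u = kappa0 / l, the other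
  bound beyond. Each branch is a valid bound by itself, so the same cut serves every p; for p = 1 it
  is the exact crossing.\<close>

lemma bd1_integral_aux:
  assumes p: "1 \<le> p" and l: "kappa0 < l"
  obtains g I where "(g has_integral I) {0..1}" "\<And>u. 0 < u \<Longrightarrow> u < 1 \<Longrightarrow> bd1 (1/p) (u * l) \<le> g u"
    "I \<le> gamma1 p * l powr (- 1 / max 2 p)"
proof -
  have k1: "1 < kappa0" by (rule kappa0_gt_1)
  have l0: "0 < l" using k1 l by linarith
  define k where "k = kappa0 / l"
  have k: "0 < k" "k < 1" using k1 l l0 by (auto simp: k_def)
  define c where "c = 1 / sqrt (2 * exp 1 * l)"
  define g where "g u = (if u \<le> k then 1 else c * u powr (- 1/2) + l powr (- 1/p) * u powr (- 1/p))" for u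
  define F where "F u = c * (2 * sqrt u) + l powr (- 1/p) * (if p = 1 then ln u else u powr (1 - 1/p) / (1 - 1/p))" for u
  have i1: "(g has_integral k) {0..k}"
    by (rule has_integral_eq[of _ "\<lambda>_. 1"]) (use k has_integral_const_real[of "1::real" 0 k] in \<open>auto simp: g_def\<close>)
  have "((\<lambda>u. c * u powr (- 1/2) + l powr (- 1/p) * u powr (- 1/p)) has_integral (F 1 - F k)) {k..1}"
  proof (rule fundamental_theorem_of_calculus)
    fix u assume u: "u \<in> {k..1}"
    then have u0: "0 < u" using k by auto
    have "(F has_real_derivative (c * u powr (- 1/2) + l powr (- 1/p) * u powr (- 1/p))) (at u)"
    proof (cases "p = 1")
      case True
      show ?thesis unfolding F_def using True u0 l0
        by (auto intro!: derivative_eq_intros simp: powr_minus powr_half_sqrt field_simps)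
    next
      case False
      define b where "b = 1 - 1/p"
      have b: "b \<noteq> 0" "b - 1 = - 1/p" using p False by (auto simp: b_def field_simps)
      have "((\<lambda>u. u powr b / b) has_real_derivative u powr (b - 1)) (at u)"
        using u0 b by (auto intro!: derivative_eq_intros)
      then have d: "((\<lambda>u. u powr b / b) has_real_derivative u powr (- 1/p)) (at u)" by (simp only: b)
      have dsq: "((\<lambda>u. 2 * sqrt u) has_real_derivative u powr (- 1/2)) (at u)"
        using u0 by (auto intro!: derivative_eq_intros simp: powr_minus powr_half_sqrt field_simps)
      have "((\<lambda>u. c * (2 * sqrt u) + l powr (- 1/p) * (u powr b / b)) has_real_derivative
          (c * u powr (- 1/2) + l powr (- 1/p) * u powr (- 1/p))) (at u)"
        by (rule DERIV_add DERIV_cmult d dsq)+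
      then show ?thesis unfolding F_def using False by (simp add: b_def)
    qed
    then show "(F has_vector_derivative c * u powr (- 1 / 2) + l powr (- 1 / p) * u powr (- 1 / p)) (at u within {k..1})"
      by (simp add: has_real_derivative_iff_has_vector_derivative has_vector_derivative_at_within)
  qed (use k in auto)
  then have i2: "(g has_integral (F 1 - F k)) {k..1}"
    by (rule has_integral_spike_finite[of "{k}", rotated 2]) (auto simp: g_def)
  have "(g has_integral (k + (F 1 - F k))) {0..1}"
    by (rule has_integral_combine[OF _ _ i1 i2]) (use k in auto)
  moreover have "bd1 (1/p) (u * l) \<le> g u" if "0 < u" "u < 1" for u
    using that l0 by (auto simp: g_def bd1_def c_def powr_mult powr_minus powr_half_sqrt real_sqrt_mult field_simps)
  moreover have "k + (F 1 - F k) \<le> gamma1 p * l powr (- 1 / max 2 p)"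
  proof -
    have cc: "c * 2 = sqrt (2 / exp 1) * l powr (- 1/2)"
      using l0 by (simp add: c_def powr_minus powr_half_sqrt real_sqrt_mult real_sqrt_divide field_simps)
    have ck: "c * 2 * sqrt k = 2 * (kappa0 - 1) / l"
    proof -
      have "l powr (- 1/2) * sqrt (kappa0 / l) = sqrt kappa0 / l"
        using l0 by (simp add: powr_minus powr_half_sqrt real_sqrt_divide field_simps)
      then have "c * 2 * sqrt k = sqrt (2 / exp 1) * sqrt kappa0 / l"
        unfolding cc k_def by (simp only: mult.assoc times_divide_eq_right)
      then show ?thesis by (simp only: kappa0_threshold)
    qed
    have rr: "l powr (- 1/p) * (if p = 1 then ln 1 - ln k else (1 - k powr (1 - 1/p)) / (1 - 1/p)) = rem1 p l / l"
    proof (cases "p = 1")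
      case True
      then show ?thesis using l0 k1 by (simp add: rem1_def k_def ln_div powr_minus field_simps)
    next
      case False
      then have p1: "1 < p" using p by simp
      have "k powr (1 - 1/p) = kappa0 powr (1 - 1/p) / l powr (1 - 1/p)"
        using k1 l0 by (simp add: k_def powr_divide)
      moreover have "l powr (- 1/p) = l powr (1 - 1/p) / l" using l0 by (simp add: powr_diff powr_minus field_simps)
      moreover have "1 / (1 - 1/p) = p / (p - 1)" using p1 by (simp add: field_simps)
      ultimately have X1: "l powr (- 1/p) * ((1 - k powr (1 - 1/p)) / (1 - 1/p))
          = l powr (1 - 1/p) / l * (1 - kappa0 powr (1 - 1/p) / l powr (1 - 1/p)) * (p / (p - 1))"
        by (simp only: times_divide_eq_right[symmetric] mult.assoc) (simp add: divide_inverse)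
      have gen: "B / l * (1 - A / B) * X = X * (B - A) / l" if "0 < B" for A B X :: real
        using that l0 by (simp add: field_simps)
      have X2: "l powr (1 - 1/p) / l * (1 - kappa0 powr (1 - 1/p) / l powr (1 - 1/p)) * (p / (p - 1))
          = p / (p - 1) * (l powr (1 - 1/p) - kappa0 powr (1 - 1/p)) / l"
        by (rule gen) (use l0 in simp)
      show ?thesis unfolding rem1_def if_not_P[OF False] using X1 X2 by (rule trans)
    qed
    \<comment> \<open>The initial piece contributes kappa0 / l and the lower limit of the square
      root term - 2 (kappa0 - 1) / l. Their sum (2 - kappa0) / l is the origin of
      \<open>kappa1\<close>.\<close>
    have "F 1 - F k = c * 2 - c * 2 * sqrt k + l powr (- 1/p) * (if p = 1 then ln 1 - ln k else (1 - k powr (1 - 1/p)) / (1 - 1/p))"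
      by (simp add: F_def algebra_simps diff_divide_distrib)
    then have "k + (F 1 - F k) = sqrt (2 / exp 1) * l powr (- 1/2) + (kappa1 + rem1 p l) / l"
      unfolding rr ck unfolding cc by (simp add: k_def kappa1_def add_divide_distrib diff_divide_distrib)
    also have "\<dots> \<le> gamma1 p * l powr (- 1 / max 2 p)" by (rule gamma1_bound[OF p l0])
    finally show ?thesis .
  qed
  ultimately show thesis using that by blast
qed

text \<open>If \<open>c1\<close> is not 1 then \<open>kappa0 < l\<close>, so the cut lies inside the
  unit interval: at l = kappa0 the left side of \<open>gamma1_bound\<close> equals 1, while its
  right side decreases in l.\<close>

lemma bd1_integral:
  assumes p: "1 \<le> p" and l: "0 < l"
  obtains g I where "(g has_integral I) {0..1}" "\<And>u. 0 < u \<Longrightarrow> u < 1 \<Longrightarrow> bd1 (expo p) (u * l) \<le> g u"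
    "I \<le> c1 p l"
proof (cases "c1 p l = 1")
  case True
  show thesis
    by (rule that[of "\<lambda>_. 1" 1]) (use True has_integral_const_real[of "1::real" 0 1] in \<open>auto simp: bd1_def\<close>)
next
  case False
  then obtain r where r: "p = ereal r" "1 \<le> r" using p by (cases p) (auto simp: c1_def one_ereal_def)
  have c: "c1 p l = gamma1 r * l powr (- 1 / max 2 r)" "gamma1 r * l powr (- 1 / max 2 r) < 1"
    using False r by (auto simp: c1_def min_def split: if_splits)
  have "kappa0 < l"
  proof (rule ccontr)
    assume "\<not> kappa0 < l"
    then have le: "l \<le> kappa0" by simp
    have k1: "1 < kappa0" by (rule kappa0_gt_1)
    have "rem1 r kappa0 = 0" using k1 by (simp add: rem1_def)
    moreover have "sqrt (2 / exp 1) * kappa0 powr (- 1/2) = 2 * (kappa0 - 1) / kappa0"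
    proof -
      have "sqrt (2 / exp 1) * kappa0 powr (- 1/2) = sqrt (2 / exp 1) * sqrt kappa0 / (sqrt kappa0 * sqrt kappa0)"
        using k1 by (simp add: powr_minus powr_half_sqrt inverse_eq_divide del: real_sqrt_mult_self)
      also have "sqrt kappa0 * sqrt kappa0 = kappa0" using k1 by simp
      finally show ?thesis by (simp only: kappa0_threshold)
    qed
    ultimately have "sqrt (2 / exp 1) * kappa0 powr (- 1/2) + (kappa1 + rem1 r kappa0) / kappa0 = 1"
      using k1 by (simp add: kappa1_def field_simps)
    then have one: "1 \<le> gamma1 r * kappa0 powr (- 1 / max 2 r)" using gamma1_bound[OF r(2), of kappa0] k1 by simp
    have "0 < gamma1 r * kappa0 powr (- 1 / max 2 r)" using one by linarith
    then have "0 < gamma1 r" by (simp add: zero_less_mult_iff)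
    moreover have "kappa0 powr (- 1 / max 2 r) \<le> l powr (- 1 / max 2 r)"
      using le l r by (intro powr_mono2') auto
    ultimately have "gamma1 r * kappa0 powr (- 1 / max 2 r) \<le> gamma1 r * l powr (- 1 / max 2 r)" by simp
    with one c show False by simp
  qed
  from bd1_integral_aux[OF r(2) this] show thesis
    using that c r by (simp add: expo_def) metis
qed

text \<open>The weight 1 - u is the survival probability of the second point. For p > 1 the power
  bound is integrated over the whole interval, being integrable at 0; for p = 1 it is not, and the
  cut produces the logarithm.\<close>

lemma bd2_integral:
  assumes p: "1 \<le> p" and l: "0 < l"
  obtains g I where "(g has_integral I) {0..1}" "\<And>u. 0 < u \<Longrightarrow> u < 1 \<Longrightarrow> (1 - u) * bd2 (expo p) (u * l) \<le> g u"
    "I \<le> c2 p l"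
proof (cases "c2 p l = 1")
  case True
  have "((\<lambda>u::real. (1 - u) * 2) has_integral ((2 * 1 - 1\<^sup>2) - (2 * 0 - 0\<^sup>2))) {0..1}"
    by (rule fundamental_theorem_of_calculus)
       (auto intro!: derivative_eq_intros simp flip: has_real_derivative_iff_has_vector_derivative)
  then show thesis
    by (intro that[of "\<lambda>u. (1 - u) * 2" 1]) (use True in \<open>auto simp: bd2_def simp del: left_diff_distrib_numeral intro!: mult_left_mono\<close>)
next
  case False
  then obtain r where r: "p = ereal r" "1 \<le> r" using p by (cases p) (auto simp: c2_def one_ereal_def)
  show thesis
  proof (cases "r = 1")
    case True
    \<comment> \<open>The cut for p = 1, where the branches 2 and 2 a / u agree. Since 2 a l = 11/3
      exceeds the 3 of \<open>bd2\<close>, the second branch is a majorant; the integral is a^2 - 2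
      a ln a, at most a - 2 a ln a.\<close>
    define a where "a = 11 / (6 * l)"
    have c2: "c2 p l = min 1 (a * (1 + 2 * max (ln (1 / a)) 0))"
      using True r by (simp add: c2_def logp_def a_def field_simps)
    have a0: "0 < a" using l by (simp add: a_def)
    have a1: "a < 1"
    proof (rule ccontr)
      assume "\<not> a < 1"
      then have a: "1 \<le> a" by simp
      then have "a * 1 \<le> a * (1 + 2 * max (ln (1 / a)) 0)" by (intro mult_left_mono) auto
      with a have "c2 p l = 1" unfolding c2 by simp
      with False show False by simp
    qed
    then have c2': "c2 p l = a - 2 * a * ln a"
      using False a0 unfolding c2 by (auto simp: ln_div min_def max_def algebra_simps split: if_splits)
    define g where "g u = (if u \<le> a then (1 - u) * 2 else (1 - u) * (2 * a / u))" for u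
    have i0: "((\<lambda>u::real. (1 - u) * 2) has_integral ((2 * a - a\<^sup>2) - (2 * 0 - 0\<^sup>2))) {0..a}"
      by (rule fundamental_theorem_of_calculus)
         (use a0 in \<open>auto intro!: derivative_eq_intros simp flip: has_real_derivative_iff_has_vector_derivative\<close>)
    have i1: "(g has_integral (2 * a - a\<^sup>2)) {0..a}"
      using has_integral_eq[OF _ i0, of g] by (simp add: g_def)
    have "((\<lambda>u::real. (1 - u) * (2 * a / u)) has_integral ((2 * a * (ln 1 - 1)) - (2 * a * (ln a - a)))) {a..1}"
      by (rule fundamental_theorem_of_calculus)
         (use a0 a1 in \<open>auto intro!: derivative_eq_intros simp: field_simps simp flip: has_real_derivative_iff_has_vector_derivative\<close>)
    then have i2: "(g has_integral ((2 * a * (ln 1 - 1)) - (2 * a * (ln a - a)))) {a..1}"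
      by (rule has_integral_spike_finite[of "{a}", rotated 2]) (auto simp: g_def)
    have i: "(g has_integral (2 * a - a\<^sup>2 + ((2 * a * (ln 1 - 1)) - (2 * a * (ln a - a))))) {0..1}"
      by (rule has_integral_combine[OF _ _ i1 i2]) (use a0 a1 in auto)
    have "a * a \<le> a * 1" using a0 a1 by (intro mult_left_mono) auto
    then have le: "2 * a - a\<^sup>2 + ((2 * a * (ln 1 - 1)) - (2 * a * (ln a - a))) \<le> c2 p l"
      unfolding c2' by (simp add: power2_eq_square algebra_simps)
    have "(1 - u) * bd2 (expo p) (u * l) \<le> g u" if u: "0 < u" "u < 1" for u
    proof -
      have "3 * (u * l) powr (- 1) \<le> 2 * a / u"
        using u l by (simp add: a_def powr_minus field_simps)
      then have "bd2 (expo p) (u * l) \<le> (if u \<le> a then 2 else 2 * a / u)"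
        using r True by (auto simp: bd2_def expo_def one_ereal_def)
      then have "(1 - u) * bd2 (expo p) (u * l) \<le> (1 - u) * (if u \<le> a then 2 else 2 * a / u)"
        using u by (intro mult_left_mono) auto
      then show ?thesis by (cases "u \<le> a") (simp_all add: g_def)
    qed
    with i le show thesis using that by blast
  next
    case False2: False
    then have r1: "1 < r" using r by simp
    define a where "a = 1 / r"
    have a: "0 < a" "a < 1" using r1 by (auto simp: a_def)
    have c2': "c2 p l = gamma2 r * l powr (- a)"
      using False r False2 by (auto simp: c2_def a_def min_def one_ereal_def split: if_splits)
    define F where "F u = 3 * l powr (- a) * (u powr (1 - a) / (1 - a) - u powr (2 - a) / (2 - a))" for u
    have "((\<lambda>u. (1 - u) * (3 * (u * l) powr (- a))) has_integral (F 1 - F 0)) {0..1}"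
    proof (rule fundamental_theorem_of_calculus_interior)
      show "continuous_on {0..1} F"
        unfolding F_def using a by (intro continuous_intros continuous_on_powr') auto
      fix u :: real assume u: "u \<in> {0<..<1}"
      have "u powr (1 - a) = u * u powr (- a)" using u by (simp add: powr_diff powr_minus field_simps)
      then have v: "3 * l powr (- a) * (u powr (- a) - u powr (1 - a)) = (1 - u) * (3 * (u * l) powr - a)"
        using u l by (simp add: powr_mult algebra_simps)
      have d: "((\<lambda>u. u powr b / b) has_real_derivative u powr (b - 1)) (at u)" if "0 < b" for b
        using u that by (auto intro!: derivative_eq_intros)
      have "1 - a - 1 = - a" "2 - a - 1 = 1 - a" by simp_all
      then have d1: "((\<lambda>u. u powr (1 - a) / (1 - a)) has_real_derivative u powr (- a)) (at u)"
        and d2: "((\<lambda>u. u powr (2 - a) / (2 - a)) has_real_derivative u powr (1 - a)) (at u)"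
        using d[of "1 - a"] d[of "2 - a"] a by simp_all
      from DERIV_cmult[OF DERIV_diff[OF d1 d2], of "3 * l powr (- a)"]
      show "(F has_vector_derivative (1 - u) * (3 * (u * l) powr - a)) (at u)"
        unfolding has_real_derivative_iff_has_vector_derivative[symmetric] v F_def .
    qed auto
    moreover have "F 1 - F 0 \<le> c2 p l"
    proof -
      \<comment> \<open>The integral carries a factor 3 where \<open>gamma2\<close> has 1 + 2 powr a
        + (2/3) powr a. The arithmetic-geometric mean inequality compares the two, because 2 * 2/3
        is at least 1.\<close>
      have "2 \<le> 2 powr a + (2/3) powr a"
      proof -
        have "0 \<le> (2 powr (a/2) - (2/3) powr (a/2))\<^sup>2" by simp
        also have "\<dots> = 2 powr a + (2/3) powr a - 2 * (4/3) powr (a/2)"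
        proof -
          have "(2 powr (a/2))\<^sup>2 = 2 powr a" "((2/3) powr (a/2))\<^sup>2 = (2/3 :: real) powr a"
            by (simp_all add: power2_eq_square powr_add[symmetric])
          moreover have "2 powr (a/2) * (2/3) powr (a/2) = (4/3 :: real) powr (a/2)"
            by (subst powr_mult[symmetric]) simp_all
          ultimately show ?thesis by (simp only: power2_diff mult.assoc)
        qed
        finally have "2 * (4/3) powr (a/2) \<le> 2 powr a + (2/3) powr a" by simp
        moreover have "1 \<le> (4/3::real) powr (a/2)" using a by (intro ge_one_powr_ge_zero) auto
        ultimately show ?thesis by simp
      qed
      then have "3 * (r\<^sup>2 / ((r - 1) * (2 * r - 1))) \<le> (1 + 2 powr a + (2/3) powr a) * (r\<^sup>2 / ((r - 1) * (2 * r - 1)))"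
        using r1 by (intro mult_right_mono) auto
      also have "\<dots> = gamma2 r" by (simp add: gamma2_def a_def)
      finally have "3 * (r\<^sup>2 / ((r - 1) * (2 * r - 1))) * l powr (- a) \<le> c2 p l"
        unfolding c2' by (rule mult_right_mono) simp
      moreover have "1 / (1 - a) - 1 / (2 - a) = r\<^sup>2 / ((r - 1) * (2 * r - 1))"
        using r1 by (simp add: a_def field_simps power2_eq_square)
      ultimately show ?thesis using a by (simp add: F_def mult.commute mult.left_commute)
    qed
    moreover have "(1 - u) * bd2 (expo p) (u * l) \<le> (1 - u) * (3 * (u * l) powr (- a))" if "0 < u" "u < 1" for u
      using that r by (auto simp: bd2_def expo_def a_def intro!: mult_left_mono)
    ultimately show thesis using that by blast
  qed
qed

section \<open>Measurability on the space of point measures\<close>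

lemma vmset_Suc: "vmset (Suc n) v = add_mset (v n) (vmset n v)"
  by (simp add: vmset_def)

lemma vmset_0 [simp]: "vmset 0 v = {#}"
  by (simp add: vmset_def)

lemma size_vmset [simp]: "size (vmset n v) = n"
  by (simp add: vmset_def)

lemma vmset_cong: "(\<And>i. i < n \<Longrightarrow> v i = w i) \<Longrightarrow> vmset n v = vmset n w"
  unfolding vmset_def by (intro arg_cong[of _ _ mset] map_cong) auto

lemma mset_list_of [simp]: "mset (list_of \<xi>) = \<xi>"
  unfolding list_of_def by (rule someI_ex) (rule ex_mset)

lemma vmset_vec_of: "vmset (length l) (vec_of l) = mset l"
proof -
  have "map (vec_of l) [0..<length l] = l" by (rule nth_equalityI) (auto simp: vec_of_def)
  then show ?thesis by (simp add: vmset_def)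
qed

lemma vec_of_map_upt: "vec_of (map v [0..<n]) = restrict v {..<n}"
  by (auto simp: vec_of_def fun_eq_iff)

lemma cnt_empty [simp]: "cnt A {#} = 0" by (simp add: cnt_def)

lemma cnt_add_mset [simp]: "cnt A (add_mset x \<xi>) = (if x \<in> A then 1 else 0) + cnt A \<xi>"
  by (simp add: cnt_def)

lemma cnt_union [simp]: "cnt A (\<xi> + \<eta>) = cnt A \<xi> + cnt A \<eta>"
  by (simp add: cnt_def)

lemma cnt_UNIV [simp]: "cnt UNIV \<xi> = size \<xi>"
  by (simp add: cnt_def)

lemma cnt_diff_single: "cnt A (\<xi> - {#x#}) = cnt A \<xi> - (if x \<in> A \<and> x \<in># \<xi> then 1 else 0)"
proof (cases "x \<in># \<xi>")
  case True
  then obtain \<eta> where "\<xi> = add_mset x \<eta>" by (meson mset_add)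
  then show ?thesis by simp
next
  case False
  then show ?thesis by (simp add: diff_single_trivial)
qed

lemma cnt_pos_iff: "0 < cnt A \<xi> \<longleftrightarrow> (\<exists>x\<in>#\<xi>. x \<in> A)"
  by (auto simp: cnt_def nonempty_has_size[symmetric] filter_mset_eq_mempty_iff)

lemma space_Nsp [simp]: "space Nsp = UNIV"
  by (simp add: Nsp_def space_measure_of_conv)

lemma sets_Nsp: "sets Nsp = sigma_sets UNIV {{\<xi>. cnt A \<xi> = n} | A n. A \<in> sets borel}"
  unfolding Nsp_def by (rule sets_measure_of) auto

lemma measurable_NspI:
  fixes g :: "'m \<Rightarrow> 'a::topological_space multiset"
  assumes "\<And>A. A \<in> sets borel \<Longrightarrow> (\<lambda>m. cnt A (g m)) \<in> M \<rightarrow>\<^sub>M count_space UNIV"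
  shows "g \<in> M \<rightarrow>\<^sub>M Nsp"
proof (rule measurable_sigma_sets[OF sets_Nsp])
  fix Y :: "'a multiset set" assume "Y \<in> {{\<xi>. cnt A \<xi> = n} | A n. A \<in> sets borel}"
  then obtain A n where Y: "Y = {\<xi>. cnt A \<xi> = n}" "A \<in> sets borel" by auto
  have "g -` Y \<inter> space M = (\<lambda>m. cnt A (g m)) -` {n} \<inter> space M" by (auto simp: Y)
  also have "\<dots> \<in> sets M" by (rule measurable_sets[OF assms[OF Y(2)]]) simp
  finally show "g -` Y \<inter> space M \<in> sets M" .
qed auto

lemma measurable_cnt:
  assumes "A \<in> sets borel" "g \<in> M \<rightarrow>\<^sub>M Nsp"
  shows "(\<lambda>m. cnt A (g m)) \<in> M \<rightarrow>\<^sub>M count_space UNIV"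
proof -
  have "cnt A \<in> Nsp \<rightarrow>\<^sub>M count_space UNIV"
  proof (rule measurable_count_space_eq2_countable[THEN iffD2])
    show "cnt A \<in> space Nsp \<rightarrow> UNIV \<and> (\<forall>a\<in>UNIV. cnt A -` {a} \<inter> space Nsp \<in> sets Nsp)"
      using assms(1) by (auto simp: sets_Nsp vimage_def intro!: sigma_sets.Basic)
  qed
  from measurable_compose[OF assms(2) this] show ?thesis .
qed

lemma measurable_size [measurable (raw)]:
  "g \<in> M \<rightarrow>\<^sub>M Nsp \<Longrightarrow> (\<lambda>m. size (g m)) \<in> M \<rightarrow>\<^sub>M count_space UNIV"
  using measurable_cnt[of UNIV g M] by simp

lemma measurable_add_mset [measurable (raw)]:
  assumes [measurable]: "f \<in> M \<rightarrow>\<^sub>M borel" "g \<in> M \<rightarrow>\<^sub>M Nsp"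
  shows "(\<lambda>m. add_mset (f m) (g m)) \<in> M \<rightarrow>\<^sub>M Nsp"
proof (rule measurable_NspI)
  fix A :: "'b set" assume [measurable]: "A \<in> sets borel"
  note measurable_cnt[measurable (raw)]
  show "(\<lambda>m. cnt A (add_mset (f m) (g m))) \<in> M \<rightarrow>\<^sub>M count_space UNIV"
    unfolding cnt_add_mset by measurable
qed

lemma measurable_union_mset [measurable (raw)]:
  assumes [measurable]: "f \<in> M \<rightarrow>\<^sub>M Nsp" "g \<in> M \<rightarrow>\<^sub>M Nsp"
  shows "(\<lambda>m. f m + g m) \<in> M \<rightarrow>\<^sub>M Nsp"
proof (rule measurable_NspI)
  fix A :: "'b set" assume [measurable]: "A \<in> sets borel"
  note measurable_cnt[measurable (raw)]
  show "(\<lambda>m. cnt A (f m + g m)) \<in> M \<rightarrow>\<^sub>M count_space UNIV"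
    unfolding cnt_union by measurable
qed

lemma measurable_vmset_family:
  assumes "\<And>i. i < n \<Longrightarrow> X i \<in> M \<rightarrow>\<^sub>M borel"
  shows "(\<lambda>m. vmset n (\<lambda>i. X i m)) \<in> M \<rightarrow>\<^sub>M Nsp"
  using assms by (induction n) (auto simp: vmset_Suc intro!: measurable_add_mset)

lemma measurable_vmset: "vmset n \<in> PiM {..<n} (\<lambda>_. borel) \<rightarrow>\<^sub>M Nsp"
  using measurable_vmset_family[of n "\<lambda>i v. v i" "PiM {..<n} (\<lambda>_. borel)"]
  by (simp add: measurable_component_singleton)

section \<open>Measurability of sums over points\<close>

lemma sum_mset_conv_count:
  fixes h :: "'a \<Rightarrow> ennreal"
  assumes "finite S" "set_mset \<xi> \<subseteq> S"
  shows "(\<Sum>x\<in>#\<xi>. h x) = (\<Sum>x\<in>S. of_nat (count \<xi> x) * h x)"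
  using assms(2)
proof (induction \<xi>)
  case (add a \<xi>)
  have "(\<Sum>x\<in>S. of_nat (count (add_mset a \<xi>) x) * h x) = (\<Sum>x\<in>S. of_nat (count \<xi> x) * h x + (if x = a then h a else 0))"
    by (intro sum.cong refl) (auto simp: distrib_right add.commute)
  also have "\<dots> = (\<Sum>x\<in>S. of_nat (count \<xi> x) * h x) + h a"
    using assms(1) add.prems by (simp add: sum.distrib)
  finally show ?case using add by (simp add: add.commute)
qed simp

lemma sum_mset_conv_pmf:
  fixes h :: "'a \<Rightarrow> ennreal"
  assumes "\<xi> \<noteq> {#}"
  shows "(\<Sum>x\<in>#\<xi>. h x) = of_nat (size \<xi>) * (\<integral>\<^sup>+x. h x \<partial>measure_pmf (pmf_of_multiset \<xi>))"
proof -
  have s: "0 < size \<xi>" using assms by (simp add: nonempty_has_size)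
  have "(\<integral>\<^sup>+x. h x \<partial>measure_pmf (pmf_of_multiset \<xi>)) = (\<Sum>x\<in>set_mset \<xi>. h x * ennreal (pmf (pmf_of_multiset \<xi>) x))"
    using assms by (subst nn_integral_measure_pmf_finite) auto
  also have "\<dots> = (\<Sum>x\<in>set_mset \<xi>. h x * ennreal (real (count \<xi> x) / real (size \<xi>)))"
    using assms by simp
  finally have "of_nat (size \<xi>) * (\<integral>\<^sup>+x. h x \<partial>measure_pmf (pmf_of_multiset \<xi>))
     = (\<Sum>x\<in>set_mset \<xi>. h x * (ennreal (real (size \<xi>)) * ennreal (real (count \<xi> x) / real (size \<xi>))))"
    by (simp add: sum_distrib_left ac_simps ennreal_of_nat_eq_real_of_nat)
  also have "\<dots> = (\<Sum>x\<in>set_mset \<xi>. h x * of_nat (count \<xi> x))"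
    using s by (intro sum.cong refl) (simp add: ennreal_mult[symmetric] ennreal_of_nat_eq_real_of_nat)
  also have "\<dots> = (\<Sum>x\<in>#\<xi>. h x)"
    by (simp add: sum_mset_conv_count[OF finite_set_mset order_refl] mult.commute)
  finally show ?thesis ..
qed

text \<open>A sum over the points is their number times the mean over a uniformly chosen point. The
  law of that point is a kernel, its value on a set being a ratio of counts, and integrals against
  kernels are measurable.\<close>

lemma measurable_sum_points [measurable (raw)]:
  fixes h :: "'m \<Rightarrow> 'a::topological_space \<Rightarrow> ennreal"
  assumes h: "(\<lambda>(m, x). h m x) \<in> borel_measurable (M \<Otimes>\<^sub>M borel)" and \<xi>: "\<xi> \<in> M \<rightarrow>\<^sub>M Nsp"
  shows "(\<lambda>m. \<Sum>x\<in>#\<xi> m. h m x) \<in> borel_measurable M"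
proof -
  \<comment> \<open>For the empty configuration the zero measure keeps \<open>L\<close> a
    subprobability kernel; the factor \<open>size\<close> vanishes there.\<close>
  define L where "L m = (if \<xi> m = {#} then null_measure borel else distr (measure_pmf (pmf_of_multiset (\<xi> m))) (borel :: 'a measure) (\<lambda>x. x))" for m
  note measurable_cnt[measurable (raw)]
  have em: "emeasure (L m) A = of_nat (cnt A (\<xi> m)) / of_nat (size (\<xi> m))" if "A \<in> sets borel" for m A
  proof (cases "\<xi> m = {#}")
    case True then show ?thesis by (simp add: L_def)
  next
    case False
    have "of_nat (cnt A \<zeta>) = (\<Sum>x\<in>#\<zeta>. indicator A x :: ennreal)" for \<zeta>
      by (induction \<zeta>) (auto simp: indicator_def)
    then have "of_nat (cnt A (\<xi> m)) = of_nat (size (\<xi> m)) * emeasure (L m) A"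
      using that False by (simp add: sum_mset_conv_pmf L_def emeasure_distr)
    moreover have "of_nat (size (\<xi> m)) \<noteq> (0 :: ennreal)" "of_nat (size (\<xi> m)) \<noteq> (top :: ennreal)"
      using False by simp_all
    ultimately show ?thesis
      by (metis ennreal_mult_divide_eq mult.commute)
  qed
  have L: "L \<in> M \<rightarrow>\<^sub>M subprob_algebra borel"
  proof (rule measurable_subprob_algebra)
    fix m
    show "sets (L m) = sets borel" by (simp add: L_def)
    show "subprob_space (L m)"
    proof (cases "\<xi> m = {#}")
      case True then show ?thesis by (auto simp: L_def intro!: subprob_spaceI)
    next
      case False
      then show ?thesis unfolding L_def
        by (auto intro!: prob_space_imp_subprob_space measure_pmf.prob_space_distr)
    qed
  next
    fix A :: "'a set" assume [measurable]: "A \<in> sets borel"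
    note \<xi>[measurable]
    show "(\<lambda>m. emeasure (L m) A) \<in> borel_measurable M"
      by (subst em) measurable
  qed
  have "(\<lambda>m. of_nat (size (\<xi> m)) * (\<integral>\<^sup>+x. h m x \<partial>L m)) \<in> borel_measurable M"
    using nn_integral_measurable_subprob_algebra2[OF h L] \<xi> by simp
  moreover have "of_nat (size (\<xi> m)) * (\<integral>\<^sup>+x. h m x \<partial>L m) = (\<Sum>x\<in>#\<xi> m. h m x)" if m: "m \<in> space M" for m
  proof (cases "\<xi> m = {#}")
    case True then show ?thesis by simp
  next
    case False
    have "(\<lambda>x. h m x) \<in> borel_measurable borel"
      using measurable_compose[OF measurable_Pair1'[OF m] h] by simp
    then show ?thesis using False by (simp add: L_def nn_integral_distr sum_mset_conv_pmf)
  qed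
  ultimately show ?thesis by (rule measurable_cong[THEN iffD1, rotated])
qed

section \<open>Membership, deletion of a point, and lifting from vectors\<close>

locale compact_points =
  fixes X :: "'a::metric_space itself"
  assumes compact_UNIV: "compact (UNIV :: 'a set)"
begin

text \<open>Compactness gives a finite net at every scale 1 / (n + 1). Since \<xi> has finitely many
  points, x is one of them once at each scale some net ball contains both x and a point of \<xi>, a
  countable condition on counts. Deletion of a point is measurable because of this.\<close>

lemma pred_member:
  "Measurable.pred ((borel :: 'a measure) \<Otimes>\<^sub>M Nsp) (\<lambda>(x, \<xi>). x \<in># \<xi>)"
proof -
  have "\<exists>C::'a set. finite C \<and> UNIV \<subseteq> (\<Union>c\<in>C. ball c (1 / real (Suc n)))" for n
    using compact_UNIV by (auto simp: compact_eq_totally_bounded)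
  then obtain C :: "nat \<Rightarrow> 'a set" where C: "\<And>n. finite (C n)" "\<And>n. UNIV \<subseteq> (\<Union>c\<in>C n. ball c (1 / real (Suc n)))"
    by metis
  have eq: "x \<in># \<xi> \<longleftrightarrow> (\<forall>n. \<exists>c\<in>C n. x \<in> ball c (1 / real (Suc n)) \<and> cnt (ball c (1 / real (Suc n))) \<xi> \<noteq> 0)" for x \<xi>
  proof
    assume x: "x \<in># \<xi>"
    show "\<forall>n. \<exists>c\<in>C n. x \<in> ball c (1 / real (Suc n)) \<and> cnt (ball c (1 / real (Suc n))) \<xi> \<noteq> 0"
    proof
      fix n
      obtain c where "c \<in> C n" "x \<in> ball c (1 / real (Suc n))" using C(2)[of n] by blast
      then show "\<exists>c\<in>C n. x \<in> ball c (1 / real (Suc n)) \<and> cnt (ball c (1 / real (Suc n))) \<xi> \<noteq> 0"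
        using x cnt_pos_iff[of "ball c (1 / real (Suc n))" \<xi>] by (intro bexI[of _ c]) auto
    qed
  next
    assume R: "\<forall>n. \<exists>c\<in>C n. x \<in> ball c (1 / real (Suc n)) \<and> cnt (ball c (1 / real (Suc n))) \<xi> \<noteq> 0"
    show "x \<in># \<xi>"
    proof (rule ccontr)
      assume x: "x \<notin># \<xi>"
      have "\<exists>d>0. \<forall>y\<in>#\<xi>. y \<noteq> x \<longrightarrow> d \<le> dist x y"
        by (rule finite_set_avoid) simp
      then obtain d where d: "0 < d" "\<And>y. y \<in># \<xi> \<Longrightarrow> d \<le> dist x y" using x by metis
      obtain n where n: "1 / real (Suc n) < d / 2" using d(1) reals_Archimedean[of "d/2"] by (auto simp: inverse_eq_divide)
      from R obtain c where c: "x \<in> ball c (1 / real (Suc n))" "cnt (ball c (1 / real (Suc n))) \<xi> \<noteq> 0" by blast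
      then obtain y where y: "y \<in># \<xi>" "y \<in> ball c (1 / real (Suc n))" using cnt_pos_iff[of "ball c (1 / real (Suc n))" \<xi>] by auto
      have "dist x y \<le> dist c x + dist c y" by (metis dist_commute dist_triangle)
      also have "\<dots> < d" using c(1) y(2) n by simp
      finally show False using d(2)[OF y(1)] by simp
    qed
  qed
  note measurable_cnt[measurable (raw)]
  note C(1)[intro, simp]
  have "Measurable.pred (borel \<Otimes>\<^sub>M Nsp) (\<lambda>z. \<forall>n. \<exists>c\<in>C n. fst z \<in> ball c (1 / real (Suc n)) \<and> cnt (ball c (1 / real (Suc n))) (snd z) \<noteq> 0)"
  proof (intro pred_intros_countable pred_intros_finite pred_intros_logic C(1))
    fix n and c :: 'a
    have b: "ball c (1 / real (Suc n)) \<in> sets borel" by simp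
    then show "Measurable.pred (borel \<Otimes>\<^sub>M Nsp) (\<lambda>z :: 'a \<times> 'a multiset. fst z \<in> ball c (1 / real (Suc n)))"
      by (rule pred_sets2) simp
    have [measurable]: "(\<lambda>z :: 'a \<times> 'a multiset. cnt (ball c (1 / real (Suc n))) (snd z)) \<in> borel \<Otimes>\<^sub>M Nsp \<rightarrow>\<^sub>M count_space UNIV"
      by (rule measurable_cnt[OF b]) simp
    show "Measurable.pred (borel \<Otimes>\<^sub>M Nsp) (\<lambda>z :: 'a \<times> 'a multiset. cnt (ball c (1 / real (Suc n))) (snd z) = 0)"
      by measurable
  qed
  then show ?thesis by (simp add: eq case_prod_beta)
qed

lemma measurable_diff_single:
  assumes [measurable]: "f \<in> M \<rightarrow>\<^sub>M (borel :: 'a measure)" "g \<in> M \<rightarrow>\<^sub>M Nsp"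
  shows "(\<lambda>m. g m - {#f m#}) \<in> M \<rightarrow>\<^sub>M Nsp"
proof (rule measurable_NspI)
  fix A :: "'a set" assume [measurable]: "A \<in> sets borel"
  note measurable_cnt[measurable (raw)]
  have "(\<lambda>m. (f m, g m)) \<in> M \<rightarrow>\<^sub>M borel \<Otimes>\<^sub>M Nsp" by measurable
  from measurable_compose[OF this pred_member] have [measurable]: "Measurable.pred M (\<lambda>m. f m \<in># g m)" by simp
  show "(\<lambda>m. cnt A (g m - {#f m#})) \<in> M \<rightarrow>\<^sub>M count_space UNIV"
    unfolding cnt_diff_single by measurable
qed

text \<open>Backward induction: \<open>i\<close> points are still in the point measure and \<open>n - i\<close> already in the vector; summing
  over the point to be moved next counts each value \<open>i + 1\<close> times.\<close>

lemma borel_measurable_by_vectors_aux: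
  fixes g :: "'m \<Rightarrow> 'a multiset \<Rightarrow> ennreal"
  assumes g: "(\<lambda>(m, v). g m (vmset n v)) \<in> borel_measurable (M \<Otimes>\<^sub>M PiM {..<n} (\<lambda>_. borel))"
  shows "i \<le> n \<Longrightarrow> (\<lambda>((m, v), \<xi>). g m (vmset (n - i) v + \<xi>) * of_bool (size \<xi> = i))
    \<in> borel_measurable ((M \<Otimes>\<^sub>M PiM {..<n - i} (\<lambda>_. borel)) \<Otimes>\<^sub>M Nsp)"
proof (induction i)
  case 0
  have "(\<lambda>z. (case fst z of (m, v) \<Rightarrow> g m (vmset n v)) * of_bool (size (snd z) = 0))
    \<in> borel_measurable ((M \<Otimes>\<^sub>M PiM {..<n} (\<lambda>_. borel)) \<Otimes>\<^sub>M Nsp)"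
    using g by measurable
  also have "(\<lambda>z. (case fst z of (m, v) \<Rightarrow> g m (vmset n v)) * of_bool (size (snd z) = 0))
     = (\<lambda>((m, v), \<xi>). g m (vmset (n - 0) v + \<xi>) * of_bool (size \<xi> = 0))"
    by (auto simp: fun_eq_iff)
  finally show ?case by simp
next
  case (Suc i)
  define k where "k = n - Suc i"
  have k: "n - i = Suc k" using Suc.prems by (simp add: k_def)
  let ?F = "\<lambda>((m, v), \<xi>). g m (vmset (Suc k) v + \<xi>) * of_bool (size \<xi> = i)"
  have IH: "?F \<in> borel_measurable ((M \<Otimes>\<^sub>M PiM {..<Suc k} (\<lambda>_. borel)) \<Otimes>\<^sub>M Nsp)"
    using Suc by (simp add: k)
  let ?M = "(M \<Otimes>\<^sub>M PiM {..<k} (\<lambda>_. borel :: 'a measure)) \<Otimes>\<^sub>M Nsp"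
  note measurable_diff_single[measurable (raw)]
  have [measurable]: "(\<lambda>z. (snd (fst (fst z)))(k := snd z)) \<in> ?M \<Otimes>\<^sub>M borel \<rightarrow>\<^sub>M PiM {..<Suc k} (\<lambda>_. borel)"
  proof -
    have "(\<lambda>z. (snd (fst (fst z)), snd z)) \<in> ?M \<Otimes>\<^sub>M borel \<rightarrow>\<^sub>M PiM {..<k} (\<lambda>_. borel) \<Otimes>\<^sub>M borel" by measurable
    from measurable_compose[OF this measurable_add_dim[of k "{..<k}" "\<lambda>_. borel"]] show ?thesis
      by (simp add: lessThan_Suc)
  qed
  have m1: "(\<lambda>z. ((fst (fst (fst z)), (snd (fst (fst z)))(k := snd z)), snd (fst z) - {#snd z#}))
     \<in> ?M \<Otimes>\<^sub>M borel \<rightarrow>\<^sub>M (M \<Otimes>\<^sub>M PiM {..<Suc k} (\<lambda>_. borel)) \<Otimes>\<^sub>M Nsp"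
    by measurable
  have m2: "(\<lambda>(z, x). ?F ((fst (fst z), (snd (fst z))(k := x)), snd z - {#x#})) \<in> borel_measurable (?M \<Otimes>\<^sub>M borel)"
    using measurable_compose[OF m1 IH] by (simp add: case_prod_beta)
  have "(\<lambda>z. (\<Sum>x\<in>#snd z. ?F ((fst (fst z), (snd (fst z))(k := x)), snd z - {#x#})) / of_nat (Suc i)) \<in> borel_measurable ?M"
    by (intro borel_measurable_divide_ennreal measurable_sum_points[OF m2] measurable_snd measurable_const) simp
  also have "(\<lambda>z. (\<Sum>x\<in>#snd z. ?F ((fst (fst z), (snd (fst z))(k := x)), snd z - {#x#})) / of_nat (Suc i))
     = (\<lambda>((m, v), \<xi>). g m (vmset k v + \<xi>) * of_bool (size \<xi> = Suc i))" (is "?lhs = ?rhs")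
  proof (rule ext)
    fix z :: "('m \<times> (nat \<Rightarrow> 'a)) \<times> 'a multiset"
    obtain m v \<xi> where z: "z = ((m, v), \<xi>)" by (metis surj_pair)
    have *: "?F ((m, v(k := x)), \<xi> - {#x#}) = g m (vmset k v + \<xi>) * of_bool (size \<xi> = Suc i)" if "x \<in># \<xi>" for x
    proof -
      from that obtain \<zeta> where \<zeta>: "\<xi> = add_mset x \<zeta>" by (rule mset_add)
      have "vmset (Suc k) (v(k := x)) = add_mset x (vmset k v)"
        by (simp add: vmset_Suc cong: vmset_cong)
      then show ?thesis by (simp add: \<zeta>)
    qed
    have "(\<Sum>x\<in>#\<xi>. ?F ((m, v(k := x)), \<xi> - {#x#})) = (\<Sum>x\<in>#\<xi>. g m (vmset k v + \<xi>) * of_bool (size \<xi> = Suc i))"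
      by (intro arg_cong[of _ _ sum_mset] image_mset_cong *)
    also have "\<dots> = of_nat (size \<xi>) * (g m (vmset k v + \<xi>) * of_bool (size \<xi> = Suc i))"
      by simp
    finally have "(\<Sum>x\<in>#\<xi>. ?F ((m, v(k := x)), \<xi> - {#x#})) / of_nat (Suc i)
      = g m (vmset k v + \<xi>) * of_bool (size \<xi> = Suc i)"
      using ennreal_mult_divide_eq[of "of_nat (Suc i)" "g m (vmset k v + \<xi>)"]
      by (cases "size \<xi> = Suc i") (simp_all add: mult.commute[of "of_nat (Suc i)"] del: of_nat_Suc)
    then show "?lhs z = ?rhs z"
      by (simp add: z)
  qed
  finally show ?case by (simp add: k_def)
qed

text \<open>Functions given by recursion over the points or through an enumeration are visibly
  measurable only after composition with \<open>vmset\<close>. The indicator of a preimage is cut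
  according to the number n of points; taking i = n in the preceding induction empties the vector
  part.\<close>

lemma measurable_by_vectors:
  fixes g :: "'m \<Rightarrow> 'a multiset \<Rightarrow> 'b"
  assumes g: "\<And>n. (\<lambda>(m, v). g m (vmset n v)) \<in> M \<Otimes>\<^sub>M PiM {..<n} (\<lambda>_. borel) \<rightarrow>\<^sub>M L"
  shows "(\<lambda>(m, \<xi>). g m \<xi>) \<in> M \<Otimes>\<^sub>M Nsp \<rightarrow>\<^sub>M L"
proof (rule measurableI)
  fix z assume z: "z \<in> space (M \<Otimes>\<^sub>M (Nsp :: 'a multiset measure))"
  obtain m \<xi> where zz: "z = (m, \<xi>)" by (cases z)
  obtain l where l: "mset l = \<xi>" using ex_mset by blast
  have "(m, vec_of l) \<in> space (M \<Otimes>\<^sub>M PiM {..<length l} (\<lambda>_. borel :: 'a measure))"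
    using z by (auto simp: zz space_pair_measure space_PiM vec_of_def)
  from measurable_space[OF g this] show "(case z of (m, \<xi>) \<Rightarrow> g m \<xi>) \<in> space L"
    by (simp add: zz vmset_vec_of l)
next
  fix A assume A: "A \<in> sets L"
  define h where "h m \<xi> = (indicator A (g m \<xi>) :: ennreal)" for m \<xi>
  have hn: "(\<lambda>(m, \<xi>). h m \<xi> * of_bool (size \<xi> = n)) \<in> borel_measurable (M \<Otimes>\<^sub>M Nsp)" for n
  proof -
    have "(\<lambda>z. indicator A (case z of (m, v) \<Rightarrow> g m (vmset n v)) :: ennreal) \<in> borel_measurable (M \<Otimes>\<^sub>M PiM {..<n} (\<lambda>_. borel))"
      using borel_measurable_indicator[OF A] by (rule measurable_compose[OF g])
    then have "(\<lambda>(m, v). h m (vmset n v)) \<in> borel_measurable (M \<Otimes>\<^sub>M PiM {..<n} (\<lambda>_. borel))"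
      by (simp add: h_def case_prod_beta)
    from borel_measurable_by_vectors_aux[OF this order_refl]
    have 1: "(\<lambda>((m, v :: nat \<Rightarrow> 'a), \<xi>). h m \<xi> * of_bool (size \<xi> = n)) \<in> borel_measurable ((M \<Otimes>\<^sub>M PiM {} (\<lambda>_. borel)) \<Otimes>\<^sub>M Nsp)"
      by (simp add: case_prod_beta)
    have "(\<lambda>z. ((fst z, \<lambda>_. undefined), snd z)) \<in> M \<Otimes>\<^sub>M (Nsp :: 'a multiset measure) \<rightarrow>\<^sub>M (M \<Otimes>\<^sub>M PiM {} (\<lambda>_. borel :: 'a measure)) \<Otimes>\<^sub>M Nsp"
      by (intro measurable_Pair measurable_fst measurable_snd measurable_const) (simp add: space_PiM)
    from measurable_compose[OF this 1] show ?thesis by (simp add: case_prod_beta)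
  qed
  have "(\<lambda>z. \<Sum>n. (case z of (m, \<xi>) \<Rightarrow> h m \<xi> * of_bool (size \<xi> = n))) \<in> borel_measurable (M \<Otimes>\<^sub>M Nsp)"
    by (intro borel_measurable_suminf_order hn)
  also have "(\<lambda>z. \<Sum>n. (case z of (m, \<xi>) \<Rightarrow> h m \<xi> * of_bool (size \<xi> = n))) = (\<lambda>(m, \<xi>). h m \<xi>)"
  proof (rule ext, clarify)
    fix m \<xi>
    have "(\<Sum>n. h m \<xi> * of_bool (size \<xi> = n)) = (\<Sum>n\<in>{size \<xi>}. h m \<xi> * of_bool (size \<xi> = n))"
      by (rule suminf_finite) auto
    then show "(\<Sum>n. h m \<xi> * of_bool (size \<xi> = n)) = h m \<xi>" by simp
  qed
  finally have "(\<lambda>(m, \<xi>). h m \<xi>) -` {1} \<inter> space (M \<Otimes>\<^sub>M Nsp) \<in> sets (M \<Otimes>\<^sub>M Nsp)"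
    by (rule measurable_sets) simp
  also have "(\<lambda>(m, \<xi>). h m \<xi>) -` {1} \<inter> space (M \<Otimes>\<^sub>M Nsp) = (\<lambda>(m, \<xi>). g m \<xi>) -` A \<inter> space (M \<Otimes>\<^sub>M Nsp)"
    by (auto simp: h_def indicator_def)
  finally show "(\<lambda>(m, \<xi>). g m \<xi>) -` A \<inter> space (M \<Otimes>\<^sub>M Nsp) \<in> sets (M \<Otimes>\<^sub>M Nsp)" .
qed

lemma measurable_by_vectors':
  fixes g :: "'a multiset \<Rightarrow> 'b"
  assumes g: "\<And>n. (\<lambda>v. g (vmset n v)) \<in> PiM {..<n} (\<lambda>_. borel) \<rightarrow>\<^sub>M L"
  shows "g \<in> Nsp \<rightarrow>\<^sub>M L"
proof -
  have "(\<lambda>(m::unit, \<xi>). g \<xi>) \<in> count_space UNIV \<Otimes>\<^sub>M Nsp \<rightarrow>\<^sub>M L"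
    by (rule measurable_by_vectors) (use g in \<open>simp add: case_prod_beta measurable_compose[OF measurable_snd]\<close>)
  from measurable_compose[OF measurable_Pair1'[of "()"] this] show ?thesis by simp
qed

end

section \<open>The Stein solution\<close>

text \<open>Iterated integrals of \<open>F (\<eta> + \<delta>\<^sub>x\<^sub>1 + \<dots> + \<delta>\<^sub>x\<^sub>n)\<close> over \<open>n\<close> added points; \<open>rint\<close> is the Bochner version.\<close>

primrec pint :: "'a measure \<Rightarrow> ('a multiset \<Rightarrow> ennreal) \<Rightarrow> nat \<Rightarrow> 'a multiset \<Rightarrow> ennreal" where
  "pint M F 0 \<eta> = F \<eta>"
| "pint M F (Suc n) \<eta> = (\<integral>\<^sup>+x. pint M F n (add_mset x \<eta>) \<partial>M)"

primrec rint :: "'a measure \<Rightarrow> ('a multiset \<Rightarrow> real) \<Rightarrow> nat \<Rightarrow> 'a multiset \<Rightarrow> real" where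
  "rint M f 0 \<eta> = f \<eta>"
| "rint M f (Suc n) \<eta> = (\<integral>x. rint M f n (add_mset x \<eta>) \<partial>M)"

text \<open>Expectation of \<open>F (\<eta> + \<xi>')\<close> where \<open>\<xi>'\<close> keeps each point of \<open>\<xi>\<close> with probability \<open>1 - u\<close>.\<close>

definition thin :: "real \<Rightarrow> ('a multiset \<Rightarrow> real) \<Rightarrow> 'a multiset \<Rightarrow> 'a multiset \<Rightarrow> real" where
  "thin u F \<xi> = fold_mset (\<lambda>x H \<eta>. (1 - u) * H (add_mset x \<eta>) + u * H \<eta>) F \<xi>"

lemma thin_empty [simp]: "thin u F {#} = F"
  by (simp add: thin_def)

text \<open>The one-point operators commute, so the fold does not depend on the order of the points;
  the last argument collects the points kept so far.\<close>

lemma thin_add_mset: "thin u F (add_mset x \<xi>) \<eta> = (1 - u) * thin u F \<xi> (add_mset x \<eta>) + u * thin u F \<xi> \<eta>"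
proof -
  interpret comp_fun_commute "\<lambda>x H \<eta>. (1 - u) * H (add_mset x \<eta>) + u * (H \<eta> :: real)"
    by unfold_locales (auto simp: fun_eq_iff algebra_simps add_mset_commute)
  show ?thesis by (simp add: thin_def)
qed

lemma thin_shift: "thin u (\<lambda>\<eta>. F (add_mset x \<eta>)) \<xi> \<eta> = thin u F \<xi> (add_mset x \<eta>)"
  by (induction \<xi> arbitrary: \<eta>) (simp_all add: thin_add_mset add_mset_commute)

lemma thin_diff: "thin u (\<lambda>\<eta>. F \<eta> - H \<eta>) \<xi> \<eta> = thin u F \<xi> \<eta> - thin u H \<xi> \<eta>"
proof (induction \<xi> arbitrary: \<eta>)
  case (add x \<xi>)
  show ?case unfolding thin_add_mset add by (simp add: algebra_simps)
qed simp

lemma thin_abs_le: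
  assumes "0 \<le> u" "u \<le> 1" "\<And>\<eta>. \<bar>F \<eta>\<bar> \<le> C"
  shows "\<bar>thin u F \<xi> \<eta>\<bar> \<le> C"
proof (induction \<xi> arbitrary: \<eta>)
  case (add x \<xi>)
  have "\<bar>thin u F (add_mset x \<xi>) \<eta>\<bar> \<le> (1 - u) * \<bar>thin u F \<xi> (add_mset x \<eta>)\<bar> + u * \<bar>thin u F \<xi> \<eta>\<bar>"
    unfolding thin_add_mset using assms(1,2) by (intro abs_triangle_ineq[THEN order_trans]) (simp add: abs_mult)
  also have "\<dots> \<le> (1 - u) * C + u * C"
    using assms(1,2) by (intro add_mono mult_left_mono add) auto
  finally show ?case by (simp add: algebra_simps)
qed (use assms in simp)

lemma thin_0: "thin 0 F \<xi> \<eta> = F (\<xi> + \<eta>)"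
  by (induction \<xi> arbitrary: \<eta>) (simp_all add: thin_add_mset)

lemma thin_1: "thin 1 F \<xi> \<eta> = F \<eta>"
  by (induction \<xi> arbitrary: \<eta>) (simp_all add: thin_add_mset)

lemma thin_integral:
  fixes H :: "'b \<Rightarrow> 'a multiset \<Rightarrow> real"
  assumes "\<And>\<eta>. integrable M (\<lambda>x. H x \<eta>)"
  shows "integrable M (\<lambda>x. thin u (H x) \<xi> \<eta>) \<and> thin u (\<lambda>\<eta>. \<integral>x. H x \<eta> \<partial>M) \<xi> \<eta> = (\<integral>x. thin u (H x) \<xi> \<eta> \<partial>M)"
  by (induction \<xi> arbitrary: \<eta>) (use assms in \<open>simp_all add: thin_add_mset\<close>)

text \<open>A product rule over the points: for one point at a time, differentiating (1 - u) * kept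
  + u * deleted leaves minus the difference of kept and deleted, while all other points remain
  thinned.\<close>

lemma thin_has_derivative:
  assumes "\<And>\<eta>. ((\<lambda>u. G u \<eta>) has_real_derivative G' \<eta>) (at u)"
  shows "((\<lambda>u. thin u (G u) \<xi> \<eta>) has_real_derivative
     (thin u G' \<xi> \<eta> - (\<Sum>x\<in>#\<xi>. thin u (G u) (\<xi> - {#x#}) (add_mset x \<eta>) - thin u (G u) (\<xi> - {#x#}) \<eta>))) (at u)"
proof (induction \<xi> arbitrary: \<eta>)
  case empty
  then show ?case using assms by simp
next
  case (add a \<xi>)
  let ?T = "\<lambda>\<zeta> \<eta>. thin u (G u) \<zeta> \<eta>"
  let ?S = "\<lambda>\<eta>. \<Sum>x\<in>#\<xi>. ?T (\<xi> - {#x#}) (add_mset x \<eta>) - ?T (\<xi> - {#x#}) \<eta>"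
  have d: "((\<lambda>u. (1 - u) * thin u (G u) \<xi> (add_mset a \<eta>) + u * thin u (G u) \<xi> \<eta>) has_real_derivative
     (- ?T \<xi> (add_mset a \<eta>) + (1 - u) * (thin u G' \<xi> (add_mset a \<eta>) - ?S (add_mset a \<eta>))
       + (?T \<xi> \<eta> + u * (thin u G' \<xi> \<eta> - ?S \<eta>)))) (at u)"
    by (auto intro!: derivative_eq_intros add.IH)
  have e: "(\<Sum>x\<in>#\<xi>. ?T (add_mset a \<xi> - {#x#}) (add_mset x \<eta>) - ?T (add_mset a \<xi> - {#x#}) \<eta>)
     = (1 - u) * ?S (add_mset a \<eta>) + u * ?S \<eta>"
  proof -
    have "(\<Sum>x\<in>#\<xi>. ?T (add_mset a \<xi> - {#x#}) (add_mset x \<eta>) - ?T (add_mset a \<xi> - {#x#}) \<eta>)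
      = (\<Sum>x\<in>#\<xi>. (1 - u) * (?T (\<xi> - {#x#}) (add_mset x (add_mset a \<eta>)) - ?T (\<xi> - {#x#}) (add_mset a \<eta>))
           + u * (?T (\<xi> - {#x#}) (add_mset x \<eta>) - ?T (\<xi> - {#x#}) \<eta>))"
    proof (intro arg_cong[of _ _ sum_mset] image_mset_cong)
      fix x assume "x \<in># \<xi>"
      then have "add_mset a \<xi> - {#x#} = add_mset a (\<xi> - {#x#})" by simp
      then show "?T (add_mset a \<xi> - {#x#}) (add_mset x \<eta>) - ?T (add_mset a \<xi> - {#x#}) \<eta>
        = (1 - u) * (?T (\<xi> - {#x#}) (add_mset x (add_mset a \<eta>)) - ?T (\<xi> - {#x#}) (add_mset a \<eta>))
           + u * (?T (\<xi> - {#x#}) (add_mset x \<eta>) - ?T (\<xi> - {#x#}) \<eta>)"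
        by (simp add: thin_add_mset add_mset_commute algebra_simps)
    qed
    then show ?thesis by (simp add: sum_mset.distrib sum_mset_distrib_left)
  qed
  have e': "(\<Sum>x\<in>#add_mset a \<xi>. ?T (add_mset a \<xi> - {#x#}) (add_mset x \<eta>) - ?T (add_mset a \<xi> - {#x#}) \<eta>)
     = ?T \<xi> (add_mset a \<eta>) - ?T \<xi> \<eta> + ((1 - u) * ?S (add_mset a \<eta>) + u * ?S \<eta>)"
    using e by simp
  show ?case unfolding e' unfolding thin_add_mset
    by (rule DERIV_cong[OF d]) (simp only: algebra_simps)
qed

section \<open>Iterated integrals over added points\<close>

locale finite_borel = compact_points X for X :: "'a::metric_space itself" +
  fixes M :: "'a measure"
  assumes fin: "finite_measure M" and sets_M [measurable_cong]: "sets M = sets borel"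
begin

sublocale finite_measure M by (rule fin)

lemma space_M [simp]: "space M = UNIV"
  using sets_eq_imp_space_eq[OF sets_M] by simp

abbreviation "l \<equiv> measure M UNIV"

lemma pint_measurable_param:
  assumes "(\<lambda>(m, \<eta>). F m \<eta>) \<in> borel_measurable (N \<Otimes>\<^sub>M Nsp)"
  shows "(\<lambda>(m, \<eta>). pint M (F m) n \<eta>) \<in> borel_measurable (N \<Otimes>\<^sub>M Nsp)"
proof (induction n)
  case 0 then show ?case using assms by simp
next
  case (Suc n)
  have "(\<lambda>w. (fst (fst w), add_mset (snd w) (snd (fst w)))) \<in> (N \<Otimes>\<^sub>M Nsp) \<Otimes>\<^sub>M M \<rightarrow>\<^sub>M N \<Otimes>\<^sub>M Nsp"
    by measurable
  from measurable_compose[OF this Suc]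
  have "(\<lambda>(z, x). pint M (F (fst z)) n (add_mset x (snd z))) \<in> borel_measurable ((N \<Otimes>\<^sub>M Nsp) \<Otimes>\<^sub>M M)"
    by (simp add: case_prod_beta)
  from borel_measurable_nn_integral[OF this] show ?case by (simp add: case_prod_beta)
qed

text \<open>Tonelli, one coordinate at a time. The recursion keeps the points added so far in its
  argument, which spares the later inductions the product measures.\<close>

lemma nn_integral_vmset:
  assumes F: "F \<in> borel_measurable Nsp"
  shows "(\<integral>\<^sup>+v. F (vmset n v + \<eta>) \<partial>PiM {..<n} (\<lambda>_. M)) = pint M F n \<eta>"
proof (induction n arbitrary: \<eta>)
  case 0
  interpret product_sigma_finite "\<lambda>_::nat. M" by unfold_locales
  show ?case by (simp add: PiM_empty)
next
  case (Suc n)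
  interpret product_sigma_finite "\<lambda>_::nat. M" by unfold_locales
  have vm: "vmset k \<in> PiM {..<k} (\<lambda>_. M) \<rightarrow>\<^sub>M Nsp" for k
    using measurable_vmset[of k] by (simp cong: measurable_cong_sets sets_PiM_cong add: sets_M measurable_def)
  have m: "(\<lambda>v. F (vmset (Suc n) v + \<eta>)) \<in> borel_measurable (PiM (insert n {..<n}) (\<lambda>_. M))"
    using measurable_compose[OF measurable_union_mset[OF vm[of "Suc n"] measurable_const] F] by (simp add: lessThan_Suc)
  have "(\<integral>\<^sup>+v. F (vmset (Suc n) v + \<eta>) \<partial>PiM {..<Suc n} (\<lambda>_. M))
     = (\<integral>\<^sup>+x. \<integral>\<^sup>+v. F (vmset (Suc n) (v(n := x)) + \<eta>) \<partial>PiM {..<n} (\<lambda>_. M) \<partial>M)"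
    unfolding lessThan_Suc by (rule product_nn_integral_insert_rev) (use m in auto)
  also have "\<dots> = (\<integral>\<^sup>+x. \<integral>\<^sup>+v. F (vmset n v + add_mset x \<eta>) \<partial>PiM {..<n} (\<lambda>_. M) \<partial>M)"
  proof -
    have "vmset (Suc n) (v(n := x)) + \<eta> = vmset n v + add_mset x \<eta>" for v x
      by (simp add: vmset_Suc cong: vmset_cong)
    then show ?thesis by simp
  qed
  finally show ?case by (simp only: Suc pint.simps)
qed

text \<open>Measurability, range and agreement with \<open>pint\<close> are proved together, since
  integrability at each stage rests on the bound \<open>l ^ n\<close> from the stage before.\<close>

lemma rint_bounds:
  assumes f: "f \<in> borel_measurable Nsp" "\<And>\<xi>. 0 \<le> f \<xi>" "\<And>\<xi>. f \<xi> \<le> 1"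
  shows "rint M f n \<in> borel_measurable Nsp \<and> (\<forall>\<eta>. 0 \<le> rint M f n \<eta> \<and> rint M f n \<eta> \<le> l ^ n
     \<and> ennreal (rint M f n \<eta>) = pint M (\<lambda>\<xi>. ennreal (f \<xi>)) n \<eta>)"
proof (induction n)
  case 0 then show ?case using f by simp
next
  case (Suc n)
  have [measurable]: "rint M f n \<in> borel_measurable Nsp" using Suc by simp
  have meas: "rint M f (Suc n) \<in> borel_measurable Nsp"
    unfolding rint.simps by (rule borel_measurable_lebesgue_integral) measurable
  have int: "integrable M (\<lambda>x. rint M f n (add_mset x \<eta>))" for \<eta>
    by (rule integrable_const_bound[where B = "l ^ n"]) (use Suc in auto)
  have b: "0 \<le> rint M f (Suc n) \<eta>" "rint M f (Suc n) \<eta> \<le> l ^ Suc n" for \<eta>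
  proof -
    show "0 \<le> rint M f (Suc n) \<eta>" using Suc by (simp add: integral_nonneg)
    have "rint M f (Suc n) \<eta> \<le> (\<integral>x. l ^ n \<partial>M)"
      unfolding rint.simps by (rule integral_mono[OF int]) (use Suc in auto)
    then show "rint M f (Suc n) \<eta> \<le> l ^ Suc n" by simp
  qed
  have "ennreal (rint M f (Suc n) \<eta>) = pint M (\<lambda>\<xi>. ennreal (f \<xi>)) (Suc n) \<eta>" for \<eta>
    using Suc by (simp add: nn_integral_eq_integral[OF int, symmetric])
  with meas b show ?case by blast
qed

end

lemma diff_diff_regroup: "(p - q) - (r - s) = p - r - q + s"
  and diff_diff_commute: "(p - q) - (r - s) = (p - r) - (q - s)" for p q r s :: real
  by simp_all

text \<open>Besides the range, \<open>f_move\<close> is all that is kept of the Lipschitz condition: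
  the effect of moving a single point. \<alpha> will be \<open>expo p\<close>.\<close>

locale stein = finite_borel X M for X :: "'a::metric_space itself" and M +
  fixes f :: "'a multiset \<Rightarrow> real" and \<alpha> :: real
  assumes f_meas: "f \<in> borel_measurable Nsp"
    and f_nonneg: "\<And>\<xi>. 0 \<le> f \<xi>" and f_le_1: "\<And>\<xi>. f \<xi> \<le> 1"
    and alpha: "0 \<le> \<alpha>" "\<alpha> \<le> 1"
    and dist_le_1: "\<And>x y :: 'a. dist x y \<le> 1"
    and f_move: "\<And>x y \<zeta>. \<bar>f (add_mset x \<zeta>) - f (add_mset y \<zeta>)\<bar> \<le> real (Suc (size \<zeta>)) powr (- \<alpha>) * dist x y"
begin

abbreviation "a \<equiv> rint M f"

lemma a_meas [measurable]: "a n \<in> borel_measurable Nsp"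
  and a_nonneg: "0 \<le> a n \<eta>" and a_le: "a n \<eta> \<le> l ^ n"
  and a_pint: "ennreal (a n \<eta>) = pint M (\<lambda>\<xi>. ennreal (f \<xi>)) n \<eta>"
  using rint_bounds[OF f_meas f_nonneg f_le_1, of n] by blast+

lemma a_integrable: "integrable M (\<lambda>x. a n (add_mset x \<eta>))"
  by (rule integrable_const_bound[where B = "l ^ n"]) (use a_nonneg a_le in auto)

text \<open>Each integration contributes a factor l and one more point, so the power is taken of the
  final number of points.\<close>

lemma a_move: "\<bar>a k (add_mset x \<eta>) - a k (add_mset y \<eta>)\<bar> \<le> l ^ k * real (Suc (size \<eta> + k)) powr (- \<alpha>) * dist x y"
proof (induction k arbitrary: \<eta>)
  case 0 then show ?case using f_move by simp
next
  case (Suc k)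
  have int: "integrable M (\<lambda>z. a k (add_mset w (add_mset z \<eta>)))" for w
    using a_integrable[of k "add_mset w \<eta>"] by (simp add: add_mset_commute)
  have "\<bar>a (Suc k) (add_mset x \<eta>) - a (Suc k) (add_mset y \<eta>)\<bar>
      = \<bar>\<integral>z. a k (add_mset x (add_mset z \<eta>)) - a k (add_mset y (add_mset z \<eta>)) \<partial>M\<bar>"
    unfolding rint.simps
    by (subst Bochner_Integration.integral_diff[OF int int]) (simp add: add_mset_commute)
  also have "\<dots> \<le> (\<integral>z. \<bar>a k (add_mset x (add_mset z \<eta>)) - a k (add_mset y (add_mset z \<eta>))\<bar> \<partial>M)"
    by (rule integral_abs_bound)
  \<comment> \<open>\<open>undefined\<close> merely holds the place of the integrated point, whose
    position does not affect the size.\<close>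
  also have "\<dots> \<le> (\<integral>z. l ^ k * real (Suc (size (add_mset undefined \<eta>) + k)) powr (- \<alpha>) * dist x y \<partial>M)"
  proof (rule integral_mono)
    show "integrable M (\<lambda>z. \<bar>a k (add_mset x (add_mset z \<eta>)) - a k (add_mset y (add_mset z \<eta>))\<bar>)"
      using int[of x] int[of y] by simp
    show "\<bar>a k (add_mset x (add_mset z \<eta>)) - a k (add_mset y (add_mset z \<eta>))\<bar>
       \<le> l ^ k * real (Suc (size (add_mset undefined \<eta>) + k)) powr (- \<alpha>) * dist x y" for z
      using Suc[of "add_mset z \<eta>"] by simp
  qed simp
  also have "\<dots> = l ^ Suc k * real (Suc (size \<eta> + Suc k)) powr (- \<alpha>) * dist x y" by simp
  finally show ?case .
qed

text \<open>Expectation of \<open>f\<close> at \<open>\<eta>\<close> plus a Poisson process with intensity \<open>u M\<close>.\<close>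

definition G :: "real \<Rightarrow> 'a multiset \<Rightarrow> real" where
  "G u \<eta> = exp (- (u * l)) * (\<Sum>k. a k \<eta> / fact k * u ^ k)"

lemma summable_a: "summable (\<lambda>k. a k \<eta> / fact k * u ^ k)"
proof (rule summable_comparison_test')
  show "summable (\<lambda>k. (l * \<bar>u\<bar>) ^ k /\<^sub>R fact k)" by (rule summable_exp_generic)
  show "norm (a n \<eta> / fact n * u ^ n) \<le> (l * \<bar>u\<bar>) ^ n /\<^sub>R fact n" for n
  proof -
    have "a n \<eta> * \<bar>u\<bar> ^ n \<le> l ^ n * \<bar>u\<bar> ^ n" by (intro mult_right_mono a_le) simp
    from divide_right_mono[OF this, of "fact n"] show ?thesis
      using a_nonneg[of n \<eta>] by (simp add: abs_mult power_abs power_mult_distrib field_simps)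
  qed
qed

lemma G_0: "G 0 \<eta> = f \<eta>"
  using powser_zero[of "\<lambda>k. a k \<eta> / fact k"] by (simp add: G_def)

lemma G_poi:
  assumes "0 < l"
  shows "G u \<eta> = (\<Sum>k. poi (u * l) k * (a k \<eta> / l ^ k))"
proof -
  have "poi (u * l) k * (a k \<eta> / l ^ k) = exp (- (u * l)) * (a k \<eta> / fact k * u ^ k)" for k
    using assms by (simp add: poi_def power_mult_distrib)
  then show ?thesis unfolding G_def by (simp only: suminf_mult[OF summable_a])
qed

lemma G_range:
  assumes "0 \<le> u"
  shows "0 \<le> G u \<eta>" "G u \<eta> \<le> 1"
proof -
  show "0 \<le> G u \<eta>" unfolding G_def using assms a_nonneg by (intro mult_nonneg_nonneg suminf_nonneg summable_a) auto
  have "(\<Sum>k. a k \<eta> / fact k * u ^ k) \<le> (\<Sum>k. (u * l) ^ k /\<^sub>R fact k)"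
  proof (intro suminf_le summable_a summable_exp_generic)
    show "a n \<eta> / fact n * u ^ n \<le> (u * l) ^ n /\<^sub>R fact n" for n
    proof -
      have "a n \<eta> * u ^ n \<le> l ^ n * u ^ n" using assms by (intro mult_right_mono a_le) simp
      from divide_right_mono[OF this, of "fact n"] show ?thesis
        by (simp add: power_mult_distrib field_simps)
    qed
  qed
  also have "\<dots> = exp (u * l)" by (simp add: exp_def)
  finally have "G u \<eta> \<le> exp (- (u * l)) * exp (u * l)" unfolding G_def by (intro mult_left_mono) auto
  then show "G u \<eta> \<le> 1" by (simp add: exp_minus)
qed

lemma G_measurable [measurable (raw)]:
  assumes [measurable]: "U \<in> borel_measurable N" "\<eta> \<in> N \<rightarrow>\<^sub>M Nsp"
  shows "(\<lambda>w. G (U w) (\<eta> w)) \<in> borel_measurable N"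
  unfolding G_def by measurable

lemma G_integrable:
  assumes "0 \<le> u"
  shows "integrable M (\<lambda>x. G u (add_mset x \<eta>))"
  by (rule integrable_const_bound[where B = 1]) (use G_range[OF assms] in auto)

lemma G_integral:
  assumes "0 \<le> u"
  shows "(\<integral>x. G u (add_mset x \<eta>) \<partial>M) = exp (- (u * l)) * (\<Sum>k. a (Suc k) \<eta> / fact k * u ^ k)"
proof -
  have "(\<lambda>k. \<integral>x. a k (add_mset x \<eta>) / fact k * u ^ k \<partial>M) sums (\<integral>x. (\<Sum>k. a k (add_mset x \<eta>) / fact k * u ^ k) \<partial>M)"
  proof (rule sums_integral)
    show "integrable M (\<lambda>x. a k (add_mset x \<eta>) / fact k * u ^ k)" for k
      using a_integrable by simp
    show "AE x in M. summable (\<lambda>k. norm (a k (add_mset x \<eta>) / fact k * u ^ k))"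
      using summable_a[where u = u] assms a_nonneg by (intro AE_I2) (simp add: abs_mult)
    have e: "(\<integral>x. norm (a k (add_mset x \<eta>) / fact k * u ^ k) \<partial>M) = a (Suc k) \<eta> / fact k * u ^ k" for k
      using assms a_nonneg by (simp add: abs_mult)
    show "summable (\<lambda>k. \<integral>x. norm (a k (add_mset x \<eta>) / fact k * u ^ k) \<partial>M)"
    proof (rule summable_comparison_test')
      show "summable (\<lambda>k. l * ((l * u) ^ k /\<^sub>R fact k))" by (intro summable_mult summable_exp_generic)
      show "norm (\<integral>x. norm (a k (add_mset x \<eta>) / fact k * u ^ k) \<partial>M) \<le> l * ((l * u) ^ k /\<^sub>R fact k)" for k
      proof -
        have "a (Suc k) \<eta> * u ^ k \<le> l ^ Suc k * u ^ k" using assms by (intro mult_right_mono a_le) simp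
        from divide_right_mono[OF this, of "fact k"] show ?thesis
          unfolding e using a_nonneg[of "Suc k" \<eta>] assms
          by (simp add: abs_mult power_mult_distrib field_simps del: rint.simps)
      qed
    qed
  qed
  then show ?thesis unfolding G_def by (simp add: sums_iff)
qed

text \<open>Differentiating the power series replaces \<open>a k\<close> by
  \<open>a (Suc k)\<close>, that is, inserts one more integrated point; the exponential prefactor
  subtracts \<open>l * G u \<eta>\<close>.\<close>

lemma G_derivative:
  assumes "0 \<le> u"
  shows "((\<lambda>u. G u \<eta>) has_real_derivative (\<integral>x. G u (add_mset x \<eta>) - G u \<eta> \<partial>M)) (at u)"
proof -
  have d: "diffs (\<lambda>k. a k \<eta> / fact k) = (\<lambda>k. a (Suc k) \<eta> / fact k)"
    by (simp add: diffs_def fun_eq_iff field_simps del: rint.simps of_nat_Suc)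
  have "((\<lambda>u. \<Sum>k. a k \<eta> / fact k * u ^ k) has_real_derivative (\<Sum>k. a (Suc k) \<eta> / fact k * u ^ k)) (at u)"
    using termdiffs_strong_converges_everywhere[of "\<lambda>k. a k \<eta> / fact k" u] summable_a unfolding d by blast
  then have "((\<lambda>u. G u \<eta>) has_real_derivative
     (exp (- (u * l)) * (\<Sum>k. a (Suc k) \<eta> / fact k * u ^ k) - l * G u \<eta>)) (at u)"
    unfolding G_def by (auto intro!: derivative_eq_intros simp: algebra_simps)
  also have "exp (- (u * l)) * (\<Sum>k. a (Suc k) \<eta> / fact k * u ^ k) - l * G u \<eta> = (\<integral>x. G u (add_mset x \<eta>) - G u \<eta> \<partial>M)"
    using G_integrable[OF assms] by (simp add: G_integral[OF assms])
  finally show ?thesis .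
qed

section \<open>Thinned differences and the derivative of the interpolation\<close>

definition V :: "real \<Rightarrow> 'a \<Rightarrow> 'a multiset \<Rightarrow> real" where
  "V u x \<xi> = thin u (\<lambda>\<eta>. G u (add_mset x \<eta>) - G u \<eta>) \<xi> {#}"

lemma V_eq: "V u x \<xi> = thin u (G u) \<xi> {#x#} - thin u (G u) \<xi> {#}"
  by (simp add: V_def thin_diff thin_shift)

text \<open>Once the points are listed as n measurable maps, thinning is a recursion of fixed depth;
  this is the form that the passage from vectors to point measures requires.\<close>

lemma thin_G_measurable:
  assumes "U \<in> borel_measurable N" "\<And>i. i < n \<Longrightarrow> Z i \<in> N \<rightarrow>\<^sub>M borel" "\<eta> \<in> N \<rightarrow>\<^sub>M Nsp"
  shows "(\<lambda>w. thin (U w) (G (U w)) (vmset n (\<lambda>i. Z i w)) (\<eta> w)) \<in> borel_measurable N"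
  using assms
proof (induction n arbitrary: \<eta>)
  case 0 then show ?case by (simp add: G_measurable)
next
  case (Suc n)
  note [measurable] = Suc.prems
  have [measurable]: "(\<lambda>w. thin (U w) (G (U w)) (vmset n (\<lambda>i. Z i w)) (\<eta>' w)) \<in> borel_measurable N" if "\<eta>' \<in> N \<rightarrow>\<^sub>M Nsp" for \<eta>'
    by (rule Suc.IH) (use Suc.prems that in auto)
  have [measurable]: "Z n \<in> N \<rightarrow>\<^sub>M borel" using Suc.prems by simp
  show ?case unfolding vmset_Suc thin_add_mset by measurable
qed

lemma V_measurable: "(\<lambda>w. V (fst (fst w)) (snd (fst w)) (snd w)) \<in> borel_measurable ((borel \<Otimes>\<^sub>M borel) \<Otimes>\<^sub>M Nsp)"
proof -
  have "(\<lambda>(m, \<xi>). case m of (u, x) \<Rightarrow> V u x \<xi>) \<in> borel_measurable ((borel \<Otimes>\<^sub>M borel) \<Otimes>\<^sub>M Nsp)"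
  proof (rule measurable_by_vectors)
    fix n
    let ?N = "(borel \<Otimes>\<^sub>M borel) \<Otimes>\<^sub>M PiM {..<n} (\<lambda>_. borel :: 'a measure) :: ((real \<times> 'a) \<times> (nat \<Rightarrow> 'a)) measure"
    have "(\<lambda>w. thin (fst (fst w)) (G (fst (fst w))) (vmset n (\<lambda>i. snd w i)) (\<eta> w)) \<in> borel_measurable ?N"
      if "\<eta> \<in> ?N \<rightarrow>\<^sub>M Nsp" for \<eta>
    proof (rule thin_G_measurable[OF _ _ that])
      show "(\<lambda>w. snd w i) \<in> ?N \<rightarrow>\<^sub>M borel" if "i < n" for i
        by (rule measurable_compose[OF measurable_snd measurable_component_singleton]) (use that in simp)
    qed measurable
    from borel_measurable_diff[OF this[of "\<lambda>w. {#snd (fst w)#}"] this[of "\<lambda>w. {#}"]]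
    show "(\<lambda>(m, v). case m of (u, x) \<Rightarrow> V u x (vmset n v)) \<in> borel_measurable ?N"
      by (simp add: V_eq case_prod_beta)
  qed
  then show ?thesis by (simp add: case_prod_beta)
qed

lemma V_measurable' [measurable (raw)]:
  assumes [measurable]: "U \<in> borel_measurable N" "Z \<in> N \<rightarrow>\<^sub>M borel" "\<eta> \<in> N \<rightarrow>\<^sub>M Nsp"
  shows "(\<lambda>w. V (U w) (Z w) (\<eta> w)) \<in> borel_measurable N"
proof -
  have "(\<lambda>w. ((U w, Z w), \<eta> w)) \<in> N \<rightarrow>\<^sub>M (borel \<Otimes>\<^sub>M borel) \<Otimes>\<^sub>M Nsp" by measurable
  from measurable_compose[OF this V_measurable] show ?thesis by simp
qed

lemma V_abs_le_1: "0 \<le> u \<Longrightarrow> u \<le> 1 \<Longrightarrow> \<bar>V u x \<xi>\<bar> \<le> 1"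
  unfolding V_def
proof (rule thin_abs_le)
  fix \<eta> assume u: "0 \<le> u"
  show "\<bar>G u (add_mset x \<eta>) - G u \<eta>\<bar> \<le> 1"
    using G_range[OF u, of "add_mset x \<eta>"] G_range[OF u, of \<eta>] by linarith
qed

text \<open>Immigration comes from differentiating \<open>G u\<close>, the integral over x leaving
  the finite combination \<open>thin\<close> by linearity; death comes from differentiating the
  retention probabilities.\<close>

lemma semigroup_derivative:
  assumes u: "0 \<le> u"
  shows "((\<lambda>u. thin u (G u) \<xi> {#}) has_real_derivative
    ((\<integral>x. V u x \<xi> \<partial>M) - (\<Sum>x\<in>#\<xi>. V u x (\<xi> - {#x#})))) (at u)"
proof -
  have i: "integrable M (\<lambda>x. G u (add_mset x \<eta>) - G u \<eta>)" for \<eta>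
    using G_integrable[OF u] by simp
  have "thin u (\<lambda>\<eta>. \<integral>x. G u (add_mset x \<eta>) - G u \<eta> \<partial>M) \<xi> {#} = (\<integral>x. V u x \<xi> \<partial>M)"
    unfolding V_def using thin_integral[of M "\<lambda>x \<eta>. G u (add_mset x \<eta>) - G u \<eta>", OF i] by blast
  then show ?thesis
    using thin_has_derivative[of G "\<lambda>\<eta>. \<integral>x. G u (add_mset x \<eta>) - G u \<eta> \<partial>M" u \<xi> "{#}", OF G_derivative[OF u]] by (simp add: V_eq)
qed

section \<open>Integration over the interpolation parameter\<close>

abbreviation "U01 \<equiv> density lborel (indicator {0..1::real})"

lemma U01_finite: "finite_measure U01"
  by (rule finite_measureI) (simp add: emeasure_density)

text \<open>Two integrals over u are in use: the measure \<open>U01\<close> for measurability and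
  Fubini, the gauge integral for the fundamental theorem and explicit antiderivatives. They agree on
  bounded measurable functions.\<close>

lemma U01_integral:
  fixes \<phi> :: "real \<Rightarrow> real"
  assumes m: "\<phi> \<in> borel_measurable borel" and b: "\<And>u. 0 \<le> u \<Longrightarrow> u \<le> 1 \<Longrightarrow> \<bar>\<phi> u\<bar> \<le> C"
  shows "integrable U01 \<phi>" "(\<phi> has_integral (\<integral>u. \<phi> u \<partial>U01)) {0..1}"
proof -
  interpret U: finite_measure U01 by (rule U01_finite)
  show i: "integrable U01 \<phi>"
  proof (rule U.integrable_const_bound[where B = C])
    show "AE u in U01. norm (\<phi> u) \<le> C" using b by (auto simp: AE_density indicator_def intro!: AE_I2)
  qed (use m in simp)
  have U: "U01 = density lborel (\<lambda>u. ennreal (indicator {0..1} u))"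
    by (simp add: ennreal_indicator)
  have eq: "(\<integral>u. \<phi> u \<partial>U01) = (LINT u:{0..1}|lborel. \<phi> u)"
    unfolding U set_lebesgue_integral_def using m by (subst integral_density) auto
  have si: "set_integrable lborel {0..1} \<phi>"
    using i m unfolding U set_integrable_def by (subst (asm) integrable_density) auto
  show "(\<phi> has_integral (\<integral>u. \<phi> u \<partial>U01)) {0..1}"
    unfolding eq set_borel_integral_eq_integral(2)[OF si]
    by (rule integrable_integral[OF set_borel_integral_eq_integral(1)[OF si]])
qed

text \<open>The majorant is required only for 0 < u < 1, because the estimates need the Poisson mean
  \<open>u * l\<close> to be positive; the endpoints are negligible.\<close>

lemma U01_bound:
  fixes \<phi> g :: "real \<Rightarrow> real"
  assumes m: "\<phi> \<in> borel_measurable borel" and b: "\<And>u. 0 \<le> u \<Longrightarrow> u \<le> 1 \<Longrightarrow> \<bar>\<phi> u\<bar> \<le> C"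
    and g: "(g has_integral I) {0..1}" "\<And>u. 0 < u \<Longrightarrow> u < 1 \<Longrightarrow> \<bar>\<phi> u\<bar> \<le> g u"
  shows "\<bar>\<integral>u. \<phi> u \<partial>U01\<bar> \<le> I"
proof -
  have 1: "(\<phi> has_integral (\<integral>u. \<phi> u \<partial>U01)) {0<..<1}"
    using U01_integral(2)[OF m b] has_integral_open_interval[of \<phi> _ "0::real" 1] by simp
  have 2: "(g has_integral I) {0<..<1}"
    using g(1) has_integral_open_interval[of g _ "0::real" 1] by simp
  show ?thesis
    using has_integral_norm_bound_integral_component[OF 1 2] has_integral_le[OF 1 2] has_integral_le[OF has_integral_neg[OF 1] 2] g(2)
    by (force simp: abs_le_iff)
qed

definition W :: "'a \<Rightarrow> 'a multiset \<Rightarrow> real" where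
  "W x \<xi> = (\<integral>u. V u x \<xi> \<partial>U01)"

lemma W_measurable [measurable (raw)]:
  assumes [measurable]: "Z \<in> N \<rightarrow>\<^sub>M borel" "\<eta> \<in> N \<rightarrow>\<^sub>M Nsp"
  shows "(\<lambda>w. W (Z w) (\<eta> w)) \<in> borel_measurable N"
proof -
  interpret U: finite_measure U01 by (rule U01_finite)
  show ?thesis unfolding W_def by (rule U.borel_measurable_lebesgue_integral) measurable
qed

lemma W_abs_le_1: "\<bar>W x \<xi>\<bar> \<le> 1"
  unfolding W_def
proof (rule U01_bound[where C = 1 and g = "\<lambda>_. 1"])
  show "((\<lambda>_. 1::real) has_integral 1) {0..1::real}" using has_integral_const_real[of "1::real" 0 1] by simp
qed (auto intro: V_abs_le_1)

text \<open>The fundamental theorem of calculus along the interpolation: at u = 0 nothing is thinned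
  or added, at u = 1 nothing of \<xi> is left. Boundedness of \<open>V\<close> permits exchanging
  the integrals over u and x.\<close>

lemma stein_equation:
  "f \<xi> - G 1 {#} = (\<Sum>x\<in>#\<xi>. W x (\<xi> - {#x#})) - (\<integral>x. W x \<xi> \<partial>M)"
proof -
  interpret U: finite_measure U01 by (rule U01_finite)
  interpret P: pair_sigma_finite U01 M by unfold_locales
  have "((\<lambda>u. (\<integral>x. V u x \<xi> \<partial>M) - (\<Sum>x\<in>#\<xi>. V u x (\<xi> - {#x#}))) has_integral
     (thin 1 (G 1) \<xi> {#} - thin 0 (G 0) \<xi> {#})) {0..1}"
    by (rule fundamental_theorem_of_calculus)
      (auto simp flip: has_real_derivative_iff_has_vector_derivative intro: has_field_derivative_at_within semigroup_derivative)
  then have 1: "((\<lambda>u. (\<integral>x. V u x \<xi> \<partial>M) - (\<Sum>x\<in>#\<xi>. V u x (\<xi> - {#x#}))) has_integral (G 1 {#} - f \<xi>)) {0..1}"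
    by (simp add: thin_0 thin_1 G_0)
  have "((\<lambda>u. \<integral>x. V u x \<xi> \<partial>M) has_integral (\<integral>u. (\<integral>x. V u x \<xi> \<partial>M) \<partial>U01)) {0..1}"
  proof (rule U01_integral)
    show "(\<lambda>u. \<integral>x. V u x \<xi> \<partial>M) \<in> borel_measurable borel"
      by (rule borel_measurable_lebesgue_integral) measurable
    fix u :: real assume u: "0 \<le> u" "u \<le> 1"
    have "\<bar>\<integral>x. V u x \<xi> \<partial>M\<bar> \<le> (\<integral>x. \<bar>V u x \<xi>\<bar> \<partial>M)" by (rule integral_abs_bound)
    also have "\<dots> \<le> (\<integral>x. 1 \<partial>M)"
      by (rule integral_mono) (use u V_abs_le_1 in \<open>auto intro!: integrable_const_bound[where B = 1]\<close>)
    finally show "\<bar>\<integral>x. V u x \<xi> \<partial>M\<bar> \<le> l" by simp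
  qed
  moreover have "(\<integral>u. (\<integral>x. V u x \<xi> \<partial>M) \<partial>U01) = (\<integral>x. W x \<xi> \<partial>M)"
    unfolding W_def
  proof (rule P.Fubini_integral[symmetric])
    interpret PF: finite_measure "U01 \<Otimes>\<^sub>M M"
      by (rule finite_measure_pair_measure) (unfold_locales)
    have "integrable (U01 \<Otimes>\<^sub>M M) (\<lambda>z. V (fst z) (snd z) \<xi>)"
    proof (rule PF.integrable_const_bound[where B = 1])
      have "AE z in U01 \<Otimes>\<^sub>M M. 0 \<le> fst z \<and> fst z \<le> 1"
      proof (rule P.AE_pair_measure)
        show "{z \<in> space (U01 \<Otimes>\<^sub>M M). 0 \<le> fst z \<and> fst z \<le> 1} \<in> sets (U01 \<Otimes>\<^sub>M M)" by measurable
        show "AE u in U01. AE x in M. 0 \<le> fst (u, x) \<and> fst (u, x) \<le> 1"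
          by (auto simp: AE_density indicator_def intro!: AE_I2)
      qed
      then show "AE z in U01 \<Otimes>\<^sub>M M. norm (V (fst z) (snd z) \<xi>) \<le> 1"
        by eventually_elim (use V_abs_le_1 in auto)
    qed measurable
    then show "integrable (U01 \<Otimes>\<^sub>M M) (case_prod (\<lambda>u x. V u x \<xi>))" by (simp add: split_beta')
  qed
  ultimately have 2: "((\<lambda>u. \<integral>x. V u x \<xi> \<partial>M) has_integral (\<integral>x. W x \<xi> \<partial>M)) {0..1}" by simp
  have "((\<lambda>u. \<Sum>x\<in>#\<zeta>. V u x (\<xi> - {#x#})) has_integral (\<Sum>x\<in>#\<zeta>. W x (\<xi> - {#x#}))) {0..1}" for \<zeta>
  proof (induction \<zeta>)
    case (add x \<zeta>)
    have "((\<lambda>u. V u x (\<xi> - {#x#})) has_integral W x (\<xi> - {#x#})) {0..1}"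
      unfolding W_def by (rule U01_integral[where C = 1]) (auto intro: V_abs_le_1)
    from has_integral_add[OF this add] show ?case by simp
  qed simp
  from has_integral_unique[OF 1 has_integral_diff[OF 2 this]] show ?thesis by simp
qed

section \<open>Bounds on \<open>W\<close> and on its differences\<close>

definition b :: "nat \<Rightarrow> 'a multiset \<Rightarrow> real" where
  "b k \<eta> = a k \<eta> / l ^ k"

context
  assumes l_pos: "0 < l"
begin

lemma b_range: "0 \<le> b k \<eta>" "b k \<eta> \<le> 1"
  using a_nonneg[of k \<eta>] a_le[of k \<eta>] l_pos by (simp_all add: b_def)

lemma b_move: "\<bar>b k (add_mset x \<eta>) - b k (add_mset y \<eta>)\<bar> \<le> real (Suc (size \<eta> + k)) powr (- \<alpha>) * dist x y"
proof -
  have "\<bar>b k (add_mset x \<eta>) - b k (add_mset y \<eta>)\<bar> = \<bar>a k (add_mset x \<eta>) - a k (add_mset y \<eta>)\<bar> / l ^ k"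
    using l_pos by (simp add: b_def diff_divide_distrib[symmetric])
  also have "\<dots> \<le> l ^ k * real (Suc (size \<eta> + k)) powr (- \<alpha>) * dist x y / l ^ k"
    using l_pos by (intro divide_right_mono a_move) simp
  finally show ?thesis using l_pos by simp
qed

lemma powr_size_le: "real (Suc (m + k)) powr (- \<alpha>) \<le> real (Suc k) powr (- \<alpha>)"
  using alpha by (intro powr_mono2') auto

text \<open>\<open>b k \<eta>\<close> is the mean of f at \<eta> with k independent points of law M
  / l added. Hence \<open>b (Suc k) \<eta>\<close> averages \<open>b k (add_mset z \<eta>)\<close>
  over a random z, and moving x to z costs at most the stated power.\<close>

lemma b_Suc: "\<bar>b k (add_mset x \<eta>) - b (Suc k) \<eta>\<bar> \<le> real (Suc (size \<eta> + k)) powr (- \<alpha>)"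
proof -
  have int: "integrable M (\<lambda>z. b k (add_mset z \<eta>))" unfolding b_def using a_integrable by simp
  have "l * (b k (add_mset x \<eta>) - b (Suc k) \<eta>) = (\<integral>z. b k (add_mset x \<eta>) - b k (add_mset z \<eta>) \<partial>M)"
    using l_pos int by (simp add: b_def algebra_simps)
  also have "\<bar>\<dots>\<bar> \<le> (\<integral>z. \<bar>b k (add_mset x \<eta>) - b k (add_mset z \<eta>)\<bar> \<partial>M)" by (rule integral_abs_bound)
  also have "\<dots> \<le> (\<integral>z. real (Suc (size \<eta> + k)) powr (- \<alpha>) \<partial>M)"
  proof (rule integral_mono)
    fix z
    have "\<bar>b k (add_mset x \<eta>) - b k (add_mset z \<eta>)\<bar> \<le> real (Suc (size \<eta> + k)) powr (- \<alpha>) * dist x z" by (rule b_move)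
    also have "\<dots> \<le> real (Suc (size \<eta> + k)) powr (- \<alpha>) * 1" by (intro mult_left_mono dist_le_1) simp
    finally show "\<bar>b k (add_mset x \<eta>) - b k (add_mset z \<eta>)\<bar> \<le> real (Suc (size \<eta> + k)) powr (- \<alpha>)" by simp
  qed (use int in auto)
  finally have "l * \<bar>b k (add_mset x \<eta>) - b (Suc k) \<eta>\<bar> \<le> l * real (Suc (size \<eta> + k)) powr (- \<alpha>)"
    using l_pos by (simp add: abs_mult)
  then show ?thesis using l_pos by simp
qed

lemma b_Suc': "\<bar>b k (add_mset x \<eta>) - b (Suc k) \<eta>\<bar> \<le> real (Suc k) powr (- \<alpha>)"
  using b_Suc powr_size_le order_trans by blast

lemma G_b: "G u \<eta> = (\<Sum>k. poi (u * l) k * b k \<eta>)"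
  unfolding b_def by (rule G_poi[OF l_pos])

lemma G_first:
  assumes u: "0 < u"
  shows "\<bar>G u (add_mset x \<eta>) - G u \<eta>\<bar> \<le> bd1 \<alpha> (u * l)"
proof -
  have s: "0 < u * l" using u l_pos by simp
  have "\<bar>G u (add_mset x \<eta>) - G u \<eta>\<bar> \<le> 1 / sqrt (2 * exp 1 * (u * l)) + (u * l) powr (- \<alpha>)"
    unfolding G_b by (rule poi_first_difference[OF s alpha b_range b_range b_Suc'])
  moreover have "\<bar>G u (add_mset x \<eta>) - G u \<eta>\<bar> \<le> 1"
    using G_range[of u "add_mset x \<eta>"] G_range[of u \<eta>] u by linarith
  ultimately show ?thesis by (simp add: bd1_def)
qed

lemma G_second:
  assumes u: "0 < u"
  shows "\<bar>G u (add_mset x (add_mset y \<eta>)) - G u (add_mset x \<eta>) - G u (add_mset y \<eta>) + G u \<eta>\<bar> \<le> bd2 \<alpha> (u * l)"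
proof -
  let ?s = "u * l"
  let ?D = "\<bar>G u (add_mset x (add_mset y \<eta>)) - G u (add_mset x \<eta>) - G u (add_mset y \<eta>) + G u \<eta>\<bar>"
  have s: "0 < ?s" using u l_pos by simp
  have 2: "?D \<le> 2"
    using G_range[of u "add_mset x (add_mset y \<eta>)"] G_range[of u "add_mset x \<eta>"] G_range[of u "add_mset y \<eta>"] G_range[of u \<eta>] u
    by linarith
  have GK: "\<bar>b k (add_mset x (add_mset y \<eta>)) - b (Suc k) (add_mset x \<eta>)\<bar> \<le> real (Suc (Suc k)) powr (- \<alpha>)" for k x y
  proof -
    have "\<bar>b k (add_mset y (add_mset x \<eta>)) - b (Suc k) (add_mset x \<eta>)\<bar> \<le> real (Suc (size (add_mset x \<eta>) + k)) powr (- \<alpha>)"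
      by (rule b_Suc)
    also have "\<dots> \<le> real (Suc (Suc k)) powr (- \<alpha>)" using powr_size_le[of "size \<eta>" "Suc k"] by simp
    finally show ?thesis by (simp add: add_mset_commute)
  qed
  have HK: "\<bar>b k (add_mset x (add_mset y \<eta>)) - b (Suc k) (add_mset y \<eta>)\<bar> \<le> real (Suc (Suc k)) powr (- \<alpha>)" for k
    using GK[of k y x] by (simp add: add_mset_commute)
  have 3: "?D \<le> 2 * ?s powr (- \<alpha>) + 1 / ?s"
    unfolding G_b by (rule poi_second_difference[OF s alpha b_range b_range b_range b_range b_Suc' b_Suc' GK HK])
  have "?D \<le> 3 * ?s powr (- \<alpha>)"
  proof (cases "1 \<le> ?s")
    case True
    have "1 / ?s = ?s powr (- 1)" using s by (simp add: powr_minus divide_inverse)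
    also have "\<dots> \<le> ?s powr (- \<alpha>)" using True alpha by (intro powr_mono) auto
    finally show ?thesis using 3 by simp
  next
    case False
    have "?s powr 0 \<le> ?s powr (- \<alpha>)" using False s alpha by (intro powr_mono') auto
    moreover have "?s powr 0 = 1" using u l_pos by simp
    ultimately show ?thesis using 2 by linarith
  qed
  with 2 show ?thesis by (simp add: bd2_def)
qed

text \<open>Moving a point inside a first difference moves it in two configurations; the factor 2
  lets the same majorant \<open>bd2\<close> serve additions and moves.\<close>

lemma G_move:
  assumes u: "0 < u"
  shows "2 * \<bar>G u (add_mset x \<eta>) - G u (add_mset y \<eta>)\<bar> \<le> bd2 \<alpha> (u * l) * dist x y"
proof -
  let ?s = "u * l"
  have s: "0 < ?s" using u l_pos by simp
  have sm: "summable (\<lambda>k. poi ?s k * E k)" if "\<And>k. \<bar>E k\<bar> \<le> C" for E C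
    by (rule summable_poi_bounded) (use s that in auto)
  define r where "r k = real (Suc k) powr (- \<alpha>)" for k
  have r: "\<bar>r k\<bar> \<le> 1" for k using alpha powr_mono[of "- \<alpha>" 0 "real (Suc k)"] by (simp add: r_def)
  have d: "\<bar>b k (add_mset x \<eta>) - b k (add_mset y \<eta>)\<bar> \<le> r k * dist x y" for k
    unfolding r_def by (rule order_trans[OF b_move]) (intro mult_right_mono powr_size_le zero_le_dist)
  have dp: "\<bar>poi ?s k * (b k (add_mset x \<eta>) - b k (add_mset y \<eta>))\<bar> \<le> poi ?s k * r k * dist x y" for k
    unfolding abs_mult mult.assoc using s d[of k] by (simp add: poi_nonneg mult_left_mono)
  have rs: "summable (\<lambda>k. poi ?s k * r k)" using r by (rule sm)
  have bs: "summable (\<lambda>k. poi ?s k * b k \<zeta>)" for \<zeta> by (rule sm[where C = 1]) (use b_range in auto)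
  have sa: "summable (\<lambda>k. \<bar>poi ?s k * (b k (add_mset x \<eta>) - b k (add_mset y \<eta>))\<bar>)"
    by (rule summable_comparison_test'[OF summable_mult2[OF rs, of "dist x y"]]) (use dp in auto)
  have "\<bar>G u (add_mset x \<eta>) - G u (add_mset y \<eta>)\<bar> = \<bar>\<Sum>k. poi ?s k * (b k (add_mset x \<eta>) - b k (add_mset y \<eta>))\<bar>"
    unfolding G_b by (subst suminf_diff[OF bs bs]) (simp add: right_diff_distrib)
  also have "\<dots> \<le> (\<Sum>k. \<bar>poi ?s k * (b k (add_mset x \<eta>) - b k (add_mset y \<eta>))\<bar>)" by (rule summable_rabs[OF sa])
  also have "\<dots> \<le> (\<Sum>k. poi ?s k * r k * dist x y)" by (rule suminf_le[OF dp sa summable_mult2[OF rs]])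
  also have "\<dots> = (\<Sum>k. poi ?s k * r k) * dist x y" by (rule suminf_mult2[symmetric, OF rs])
  finally have G: "\<bar>G u (add_mset x \<eta>) - G u (add_mset y \<eta>)\<bar> \<le> (\<Sum>k. poi ?s k * r k) * dist x y" .
  have R1: "(\<Sum>k. poi ?s k * r k) \<le> ?s powr (- \<alpha>)"
    unfolding r_def by (rule poi_powr_bound[OF s alpha])
  have "(\<Sum>k. poi ?s k * r k) \<le> (\<Sum>k. poi ?s k)"
  proof (rule suminf_le[OF _ rs sums_summable[OF poi_sums]])
    show "poi ?s k * r k \<le> poi ?s k" for k using r[of k] s by (simp add: mult_left_le poi_nonneg)
  qed
  also have "\<dots> = 1" using sums_unique[OF poi_sums] by simp
  finally have R2: "(\<Sum>k. poi ?s k * r k) \<le> 1" .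
  have "2 * (\<Sum>k. poi ?s k * r k) \<le> bd2 \<alpha> ?s"
    using R1 R2 powr_ge_zero[of ?s "- \<alpha>"] unfolding bd2_def by linarith
  then have "2 * (\<Sum>k. poi ?s k * r k) * dist x y \<le> bd2 \<alpha> ?s * dist x y" by (rule mult_right_mono) simp
  with G show ?thesis by simp
qed

lemma W_diff:
  assumes g: "(g has_integral I) {0..1}"
    and le: "\<And>u. 0 < u \<Longrightarrow> u < 1 \<Longrightarrow> \<bar>V u x \<xi> - V u x \<zeta>\<bar> \<le> g u"
  shows "\<bar>W x \<xi> - W x \<zeta>\<bar> \<le> I"
proof -
  have "W x \<xi> - W x \<zeta> = (\<integral>u. V u x \<xi> - V u x \<zeta> \<partial>U01)"
    unfolding W_def using U01_integral(1)[of "\<lambda>u. V u x _" 1] V_abs_le_1 by simp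
  also have "\<bar>\<dots>\<bar> \<le> I"
  proof (rule U01_bound[OF _ _ g le])
    show "\<bar>V u x \<xi> - V u x \<zeta>\<bar> \<le> 2" if "0 \<le> u" "u \<le> 1" for u
      using V_abs_le_1[OF that, of x \<xi>] V_abs_le_1[OF that, of x \<zeta>] by linarith
  qed auto
  finally show ?thesis .
qed

lemma W_bound_c1:
  assumes p: "1 \<le> p" "\<alpha> = expo p"
  shows "\<bar>W x \<xi>\<bar> \<le> c1 p l"
proof -
  obtain g I where g: "(g has_integral I) {0..1}" "\<And>u. 0 < u \<Longrightarrow> u < 1 \<Longrightarrow> bd1 (expo p) (u * l) \<le> g u" "I \<le> c1 p l"
    using bd1_integral[OF p(1) l_pos] by metis
  have "\<bar>W x \<xi>\<bar> \<le> I" unfolding W_def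
  proof (rule U01_bound[OF _ V_abs_le_1 g(1)])
    fix u :: real assume u: "0 < u" "u < 1"
    have "\<bar>V u x \<xi>\<bar> \<le> bd1 \<alpha> (u * l)"
      unfolding V_def by (rule thin_abs_le) (use u G_first in auto)
    then show "\<bar>V u x \<xi>\<bar> \<le> g u" using g(2)[OF u] p by simp
  qed auto
  then show ?thesis using g(3) by simp
qed

text \<open>The added point y survives the thinning with probability 1 - u, and only then is there a
  change, namely a thinned second difference at x and y.\<close>

lemma W_add_c2:
  assumes p: "1 \<le> p" "\<alpha> = expo p"
  shows "\<bar>W x (add_mset y \<xi>) - W x \<xi>\<bar> \<le> c2 p l"
proof -
  obtain g I where g: "(g has_integral I) {0..1}" "\<And>u. 0 < u \<Longrightarrow> u < 1 \<Longrightarrow> (1 - u) * bd2 (expo p) (u * l) \<le> g u" "I \<le> c2 p l"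
    using bd2_integral[OF p(1) l_pos] by metis
  have "\<bar>W x (add_mset y \<xi>) - W x \<xi>\<bar> \<le> I"
  proof (rule W_diff[OF g(1)])
    fix u :: real assume u: "0 < u" "u < 1"
    let ?F = "\<lambda>\<eta>. G u (add_mset x \<eta>) - G u \<eta>"
    have e: "V u x (add_mset y \<xi>) - V u x \<xi> = (1 - u) * thin u (\<lambda>\<eta>. ?F (add_mset y \<eta>) - ?F \<eta>) \<xi> {#}"
      unfolding V_def thin_add_mset thin_diff[of u "\<lambda>\<eta>. ?F (add_mset y \<eta>)" ?F] thin_shift[of u ?F] by (simp add: algebra_simps)
    have "\<bar>V u x (add_mset y \<xi>) - V u x \<xi>\<bar> = (1 - u) * \<bar>thin u (\<lambda>\<eta>. ?F (add_mset y \<eta>) - ?F \<eta>) \<xi> {#}\<bar>" unfolding e using u by (simp only: abs_mult abs_of_pos diff_gt_0_iff_gt)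
    also have "\<dots> \<le> (1 - u) * bd2 \<alpha> (u * l)"
    proof (rule mult_left_mono, rule thin_abs_le)
      show "\<bar>?F (add_mset y \<eta>) - ?F \<eta>\<bar> \<le> bd2 \<alpha> (u * l)" for \<eta>
      proof -
        have "?F (add_mset y \<eta>) - ?F \<eta> = G u (add_mset x (add_mset y \<eta>)) - G u (add_mset x \<eta>) - G u (add_mset y \<eta>) + G u \<eta>"
          by (rule diff_diff_regroup)
        then show ?thesis by (simp only: G_second[OF u(1)])
      qed
    qed (use u in auto)
    also have "\<dots> \<le> g u" using g(2)[OF u] p by simp
    finally show "\<bar>V u x (add_mset y \<xi>) - V u x \<xi>\<bar> \<le> g u" .
  qed
  then show ?thesis using g(3) by simp
qed

lemma W_move_c2:
  assumes p: "1 \<le> p" "\<alpha> = expo p"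
  shows "\<bar>W x (add_mset y \<xi>) - W x (add_mset y' \<xi>)\<bar> \<le> c2 p l * dist y y'"
proof -
  obtain g I where g: "(g has_integral I) {0..1}" "\<And>u. 0 < u \<Longrightarrow> u < 1 \<Longrightarrow> (1 - u) * bd2 (expo p) (u * l) \<le> g u" "I \<le> c2 p l"
    using bd2_integral[OF p(1) l_pos] by metis
  have g': "((\<lambda>u. g u * dist y y') has_integral I * dist y y') {0..1}"
    by (rule has_integral_mult_left[OF g(1)])
  have "\<bar>W x (add_mset y \<xi>) - W x (add_mset y' \<xi>)\<bar> \<le> I * dist y y'"
  proof (rule W_diff[OF g'])
    fix u :: real assume u: "0 < u" "u < 1"
    let ?F = "\<lambda>\<eta>. G u (add_mset x \<eta>) - G u \<eta>"
    have e: "V u x (add_mset y \<xi>) - V u x (add_mset y' \<xi>) = (1 - u) * thin u (\<lambda>\<eta>. ?F (add_mset y \<eta>) - ?F (add_mset y' \<eta>)) \<xi> {#}"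
      unfolding V_def thin_add_mset thin_diff[of u "\<lambda>\<eta>. ?F (add_mset y \<eta>)" "\<lambda>\<eta>. ?F (add_mset y' \<eta>)"] thin_shift[of u ?F]
      by (simp add: algebra_simps)
    have "\<bar>V u x (add_mset y \<xi>) - V u x (add_mset y' \<xi>)\<bar> = (1 - u) * \<bar>thin u (\<lambda>\<eta>. ?F (add_mset y \<eta>) - ?F (add_mset y' \<eta>)) \<xi> {#}\<bar>" unfolding e using u by (simp only: abs_mult abs_of_pos diff_gt_0_iff_gt)
    also have "\<dots> \<le> (1 - u) * (bd2 \<alpha> (u * l) * dist y y')"
    proof (rule mult_left_mono, rule thin_abs_le)
      show "\<bar>?F (add_mset y \<eta>) - ?F (add_mset y' \<eta>)\<bar> \<le> bd2 \<alpha> (u * l) * dist y y'" for \<eta>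
      proof -
        have "\<bar>?F (add_mset y \<eta>) - ?F (add_mset y' \<eta>)\<bar>
          = \<bar>(G u (add_mset y (add_mset x \<eta>)) - G u (add_mset y' (add_mset x \<eta>))) - (G u (add_mset y \<eta>) - G u (add_mset y' \<eta>))\<bar>"
          unfolding add_mset_commute[of x] by (intro arg_cong[of _ _ abs]) (rule diff_diff_commute)
        also have "\<dots> \<le> \<bar>G u (add_mset y (add_mset x \<eta>)) - G u (add_mset y' (add_mset x \<eta>))\<bar> + \<bar>G u (add_mset y \<eta>) - G u (add_mset y' \<eta>)\<bar>"
          by (rule abs_triangle_ineq4)
        also have "\<dots> \<le> bd2 \<alpha> (u * l) * dist y y'"
        proof -
          have half: "2 * p \<le> r \<Longrightarrow> 2 * q \<le> r \<Longrightarrow> p + q \<le> r" for p q r :: real by linarith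
          show ?thesis by (intro half G_move u(1))
        qed
        finally show ?thesis .
      qed
    qed (use u in auto)
    also have "\<dots> = ((1 - u) * bd2 \<alpha> (u * l)) * dist y y'" by simp
    also have "\<dots> \<le> g u * dist y y'" using g(2)[OF u] p by (intro mult_right_mono) auto
    finally show "\<bar>V u x (add_mset y \<xi>) - V u x (add_mset y' \<xi>)\<bar> \<le> g u * dist y y'" .
  qed
  also have "\<dots> \<le> c2 p l * dist y y'" using g(3) by (rule mult_right_mono) simp
  finally show ?thesis .
qed

end

end

section \<open>Poisson processes and the point metrics\<close>

text \<open>On the event of n points, P is the image under \<open>vmset\<close> of a density on the
  n-fold product. With constant weights this serves the Poisson process, with Janossy densities the
  general one.\<close>

lemma nn_integral_by_size:
  fixes F :: "'a::topological_space multiset \<Rightarrow> ennreal"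
  assumes P: "sets P = sets Nsp" and \<mu>: "sets \<mu> = sets borel"
    and w: "\<And>n. w n \<in> borel_measurable (PiM {..<n} (\<lambda>_. \<mu>))"
    and eq: "\<And>n B. B \<in> sets Nsp \<Longrightarrow> emeasure P {\<xi> \<in> B. size \<xi> = n} = (\<integral>\<^sup>+v. w n v * indicator B (vmset n v) \<partial>PiM {..<n} (\<lambda>_. \<mu>))"
    and F: "F \<in> borel_measurable Nsp"
  shows "(\<integral>\<^sup>+\<xi>. F \<xi> \<partial>P) = (\<Sum>n. \<integral>\<^sup>+v. w n v * F (vmset n v) \<partial>PiM {..<n} (\<lambda>_. \<mu>))"
proof -
  note [measurable_cong] = P
  note F[measurable] w[measurable]
  have vm[measurable]: "vmset n \<in> PiM {..<n} (\<lambda>_. \<mu>) \<rightarrow>\<^sub>M Nsp" for n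
    using measurable_vmset[of n] \<mu> by (simp cong: measurable_cong_sets sets_PiM_cong)
  define D where "D n = density P (\<lambda>\<xi>. of_bool (size \<xi> = n))" for n
  have D: "D n = distr (density (PiM {..<n} (\<lambda>_. \<mu>)) (w n)) Nsp (vmset n)" for n
  proof (rule measure_eqI)
    show "sets (D n) = sets (distr (density (PiM {..<n} (\<lambda>_. \<mu>)) (w n)) Nsp (vmset n))" by (simp add: D_def P)
    fix B assume "B \<in> sets (D n)"
    then have B[measurable]: "B \<in> sets Nsp" by (simp add: D_def P)
    have Bn: "{\<xi> \<in> B. size \<xi> = n} \<in> sets P"
    proof -
      have "{\<xi> \<in> B. size \<xi> = n} = B \<inter> {\<xi> \<in> space Nsp. size \<xi> = n}" by auto
      also have "\<dots> \<in> sets Nsp" by measurable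
      finally show ?thesis by (simp add: P)
    qed
    have "emeasure (D n) B = (\<integral>\<^sup>+\<xi>. of_bool (size \<xi> = n) * indicator B \<xi> \<partial>P)"
      unfolding D_def by (rule emeasure_density) (use B P in auto)
    also have "\<dots> = (\<integral>\<^sup>+\<xi>. indicator {\<xi> \<in> B. size \<xi> = n} \<xi> \<partial>P)"
      by (intro nn_integral_cong) (auto simp: indicator_def)
    also have "\<dots> = (\<integral>\<^sup>+v. w n v * indicator B (vmset n v) \<partial>PiM {..<n} (\<lambda>_. \<mu>))"
      using Bn B by (simp add: eq)
    also have "\<dots> = (\<integral>\<^sup>+\<xi>. indicator B \<xi> \<partial>distr (density (PiM {..<n} (\<lambda>_. \<mu>)) (w n)) Nsp (vmset n))"
      by (subst nn_integral_distr, measurable)+ (subst nn_integral_density, measurable)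
    finally show "emeasure (D n) B = emeasure (distr (density (PiM {..<n} (\<lambda>_. \<mu>)) (w n)) Nsp (vmset n)) B"
      by simp
  qed
  have "(\<integral>\<^sup>+\<xi>. F \<xi> \<partial>P) = (\<integral>\<^sup>+\<xi>. (\<Sum>n. of_bool (size \<xi> = n) * F \<xi>) \<partial>P)"
  proof (intro nn_integral_cong)
    fix \<xi>
    have "(\<Sum>n. of_bool (size \<xi> = n) * F \<xi>) = (\<Sum>n\<in>{size \<xi>}. of_bool (size \<xi> = n) * F \<xi>)"
      by (rule suminf_finite) auto
    then show "F \<xi> = (\<Sum>n. of_bool (size \<xi> = n) * F \<xi>)" by simp
  qed
  also have "\<dots> = (\<Sum>n. \<integral>\<^sup>+\<xi>. of_bool (size \<xi> = n) * F \<xi> \<partial>P)"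
    by (rule nn_integral_suminf) measurable
  also have "\<dots> = (\<Sum>n. \<integral>\<^sup>+\<xi>. F \<xi> \<partial>D n)"
    unfolding D_def by (intro suminf_cong, subst nn_integral_density) (use P in auto)
  also have "\<dots> = (\<Sum>n. \<integral>\<^sup>+v. w n v * F (vmset n v) \<partial>PiM {..<n} (\<lambda>_. \<mu>))"
    unfolding D by (intro suminf_cong) (subst nn_integral_distr, measurable, subst nn_integral_density, measurable)
  finally show ?thesis .
qed

context finite_borel
begin

lemma vmset_measurable_M [measurable]: "vmset n \<in> PiM {..<n} (\<lambda>_. M) \<rightarrow>\<^sub>M Nsp"
  using measurable_vmset[of n] sets_M by (simp cong: measurable_cong_sets sets_PiM_cong)

lemma sets_Po [measurable_cong]: "sets (Po M) = sets Nsp"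
  unfolding Po_def using sets.sets_measure_of_eq[of Nsp] by simp

text \<open>\<open>measure_of\<close> returns the given set function only when it is a measure. For
  countable additivity the series over n is read as an integral over counting measure, so that it
  can be exchanged with the sum over the disjoint sets.\<close>

lemma emeasure_Po:
  assumes B: "B \<in> sets Nsp"
  shows "emeasure (Po M) B = (\<Sum>n. ennreal (exp (- l) / fact n) * (\<integral>\<^sup>+v. indicator B (vmset n v) \<partial>PiM {..<n} (\<lambda>_. M)))"
proof -
  let ?c = "\<lambda>n. ennreal (exp (- enn2real (emeasure M UNIV)) / fact n)"
  let ?m = "\<lambda>B. \<Sum>n. ?c n * (\<integral>\<^sup>+v. indicator B (vmset n v) \<partial>PiM {..<n} (\<lambda>_. M))"
  have "countably_additive (sets Nsp) ?m"
  proof (rule countably_additiveI)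
    fix A :: "nat \<Rightarrow> 'a multiset set" assume A: "range A \<subseteq> sets Nsp" "disjoint_family A"
    have [measurable]: "A i \<in> sets Nsp" for i using A by auto
    have "(\<Sum>i. ?m (A i)) = (\<Sum>i. \<integral>\<^sup>+n. ?c n * (\<integral>\<^sup>+v. indicator (A i) (vmset n v) \<partial>PiM {..<n} (\<lambda>_. M)) \<partial>count_space UNIV)"
      by (simp add: nn_integral_count_space_nat)
    also have "\<dots> = (\<integral>\<^sup>+n. (\<Sum>i. ?c n * (\<integral>\<^sup>+v. indicator (A i) (vmset n v) \<partial>PiM {..<n} (\<lambda>_. M))) \<partial>count_space UNIV)"
      by (rule nn_integral_suminf[symmetric]) simp
    also have "\<dots> = (\<integral>\<^sup>+n. ?c n * (\<integral>\<^sup>+v. indicator (\<Union>i. A i) (vmset n v) \<partial>PiM {..<n} (\<lambda>_. M)) \<partial>count_space UNIV)"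
    proof (intro nn_integral_cong)
      fix n
      have "(\<Sum>i. ?c n * (\<integral>\<^sup>+v. indicator (A i) (vmset n v) \<partial>PiM {..<n} (\<lambda>_. M)))
         = ?c n * (\<Sum>i. \<integral>\<^sup>+v. indicator (A i) (vmset n v) \<partial>PiM {..<n} (\<lambda>_. M))"
        by (rule ennreal_suminf_cmult)
      also have "(\<Sum>i. \<integral>\<^sup>+v. indicator (A i) (vmset n v) \<partial>PiM {..<n} (\<lambda>_. M)) = (\<integral>\<^sup>+v. (\<Sum>i. indicator (A i) (vmset n v)) \<partial>PiM {..<n} (\<lambda>_. M))"
        by (rule nn_integral_suminf[symmetric]) measurable
      finally show "(\<Sum>i. ?c n * (\<integral>\<^sup>+v. indicator (A i) (vmset n v) \<partial>PiM {..<n} (\<lambda>_. M)))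
         = ?c n * (\<integral>\<^sup>+v. indicator (\<Union>i. A i) (vmset n v) \<partial>PiM {..<n} (\<lambda>_. M))"
        by (simp add: suminf_indicator[OF A(2)])
    qed
    finally show "(\<Sum>i. ?m (A i)) = ?m (\<Union>i. A i)" by (simp add: nn_integral_count_space_nat)
  qed
  moreover have "positive (sets Nsp) ?m" by (simp add: positive_def)
  moreover have "sigma_algebra UNIV (sets (Nsp :: 'a multiset measure))" using sets.sigma_algebra_axioms[of Nsp] by simp
  ultimately have "emeasure (Po M) B = ?m B" unfolding Po_def using B by (intro emeasure_measure_of_sigma)
  then show ?thesis by (simp add: measure_def)
qed

lemma nn_integral_Po:
  assumes F: "F \<in> borel_measurable Nsp"
  shows "(\<integral>\<^sup>+\<xi>. F \<xi> \<partial>Po M) = (\<Sum>n. ennreal (exp (- l) / fact n) * pint M F n {#})"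
proof -
  note F[measurable]
  have "(\<integral>\<^sup>+\<xi>. F \<xi> \<partial>Po M) = (\<Sum>n. \<integral>\<^sup>+v. ennreal (exp (- l) / fact n) * F (vmset n v) \<partial>PiM {..<n} (\<lambda>_. M))"
  proof (rule nn_integral_by_size[OF sets_Po sets_M _ _ F])
    fix n and B :: "'a multiset set" assume B[measurable]: "B \<in> sets Nsp"
    let ?B = "{\<xi> \<in> B. size \<xi> = n}"
    have Bn: "?B \<in> sets Nsp"
    proof -
      have "?B = B \<inter> {\<xi> \<in> space Nsp. size \<xi> = n}" by auto
      also have "\<dots> \<in> sets Nsp" by measurable
      finally show ?thesis .
    qed
    have "emeasure (Po M) ?B = (\<Sum>k. ennreal (exp (- l) / fact k) * (\<integral>\<^sup>+v. indicator ?B (vmset k v) \<partial>PiM {..<k} (\<lambda>_. M)))"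
      by (rule emeasure_Po[OF Bn])
    also have "\<dots> = (\<Sum>k\<in>{n}. ennreal (exp (- l) / fact k) * (\<integral>\<^sup>+v. indicator ?B (vmset k v) \<partial>PiM {..<k} (\<lambda>_. M)))"
      by (rule suminf_finite) auto
    also have "\<dots> = ennreal (exp (- l) / fact n) * (\<integral>\<^sup>+v. indicator B (vmset n v) \<partial>PiM {..<n} (\<lambda>_. M))"
    proof -
      have "indicator ?B (vmset n v) = (indicator B (vmset n v) :: ennreal)" for v by (simp add: indicator_def)
      then show ?thesis by simp
    qed
    also have "\<dots> = (\<integral>\<^sup>+v. ennreal (exp (- l) / fact n) * indicator B (vmset n v) \<partial>PiM {..<n} (\<lambda>_. M))"
      by (rule nn_integral_cmult[symmetric]) measurable
    finally show "emeasure (Po M) ?B = (\<integral>\<^sup>+v. ennreal (exp (- l) / fact n) * indicator B (vmset n v) \<partial>PiM {..<n} (\<lambda>_. M))" .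
  qed simp
  also have "\<dots> = (\<Sum>n. ennreal (exp (- l) / fact n) * (\<integral>\<^sup>+v. F (vmset n v + {#}) \<partial>PiM {..<n} (\<lambda>_. M)))"
    by (intro suminf_cong) (simp add: nn_integral_cmult)
  finally show ?thesis by (simp only: nn_integral_vmset[OF F])
qed

end

context stein
begin

lemma integral_Po: "(\<integral>\<xi>. f \<xi> \<partial>Po M) = G 1 {#}"
proof -
  have "(\<integral>\<^sup>+\<xi>. ennreal (f \<xi>) \<partial>Po M) = (\<Sum>n. ennreal (exp (- l) / fact n) * pint M (\<lambda>\<xi>. ennreal (f \<xi>)) n {#})"
    by (rule nn_integral_Po) (use f_meas in measurable)
  also have "\<dots> = (\<Sum>n. ennreal (exp (- l) * (a n {#} / fact n * 1 ^ n)))"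
    using a_nonneg by (intro suminf_cong) (simp add: a_pint[symmetric] ennreal_mult[symmetric] mult.commute)
  also have "\<dots> = ennreal (\<Sum>n. exp (- l) * (a n {#} / fact n * 1 ^ n))"
    using a_nonneg by (intro suminf_ennreal2 summable_mult summable_a) auto
  also have "(\<Sum>n. exp (- l) * (a n {#} / fact n * 1 ^ n)) = G 1 {#}"
    unfolding G_def by (subst suminf_mult[OF summable_a]) simp
  finally show ?thesis
    using f_meas f_nonneg G_range[of 1 "{#}"]
    by (subst integral_eq_nn_integral) (auto cong: measurable_cong_sets simp: sets_Po)
qed

end

section \<open>The metrics \<open>d1p\<close> and \<open>d1'\<close>\<close>

lemma list_of_matching:
  assumes "mset us = \<xi>" "mset vs = \<eta>" "length us = n" "length vs = n"
  obtains \<sigma> \<pi> where "\<sigma> permutes {..<n}" "\<pi> permutes {..<n}"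
    "\<And>i. i < n \<Longrightarrow> list_of \<xi> ! i = us ! \<sigma> i" "\<And>i. i < n \<Longrightarrow> list_of \<eta> ! (\<pi> i) = vs ! \<sigma> i"
proof -
  have len: "length (list_of \<xi>) = n" "length (list_of \<eta>) = n"
    using assms by (metis mset_list_of size_mset)+
  obtain \<sigma> where \<sigma>: "\<sigma> permutes {..<n}" "permute_list \<sigma> us = list_of \<xi>"
    using mset_eq_permutation[of "list_of \<xi>" us] assms len by (metis mset_list_of)
  obtain \<tau> where \<tau>: "\<tau> permutes {..<n}" "permute_list \<tau> vs = list_of \<eta>"
    using mset_eq_permutation[of "list_of \<eta>" vs] assms len by (metis mset_list_of)
  \<comment> \<open>\<open>list_of\<close> picks an arbitrary enumeration; this quotient carries the
    positionwise matching of \<open>us\<close> with \<open>vs\<close> over to the enumerations that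
    were picked.\<close>
  define \<pi> where "\<pi> = inv \<tau> \<circ> \<sigma>"
  have \<pi>: "\<pi> permutes {..<n}" unfolding \<pi>_def by (intro permutes_compose permutes_inv \<sigma> \<tau>)
  show thesis
  proof (rule that[OF \<sigma>(1) \<pi>])
    fix i assume i: "i < n"
    show "list_of \<xi> ! i = us ! \<sigma> i"
      using permute_list_nth[of \<sigma> us i] i assms \<sigma> by simp
    have "\<pi> i < n" using permutes_in_image[OF \<pi>, of i] i by simp
    then have "list_of \<eta> ! (\<pi> i) = vs ! \<tau> (\<pi> i)"
      using permute_list_nth[of \<tau> vs "\<pi> i"] assms \<tau> by simp
    also have "\<tau> (\<pi> i) = \<sigma> i" by (simp add: \<pi>_def permutes_inverses(1)[OF \<tau>(1)])
    finally show "list_of \<eta> ! (\<pi> i) = vs ! \<sigma> i" .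
  qed
qed

text \<open>Puts the zero function into \<open>F2\<close>, so that the supremum in \<open>d2\<close>
  is taken over a nonempty set.\<close>

lemma d1p_nonneg:
  fixes \<xi> \<eta> :: "'a::metric_space multiset"
  shows "0 \<le> d1p p \<xi> \<eta>"
proof (cases "size \<xi> = size \<eta> \<and> size \<xi> \<noteq> 0")
  case True
  let ?n = "size \<xi>" let ?xs = "list_of \<xi>" let ?ys = "list_of \<eta>"
  have fin: "finite {\<pi>. \<pi> permutes {..<?n}}" by (rule finite_permutations) simp
  let ?A = "{Max {dist (?xs ! i) (?ys ! (\<pi> i)) | i. i < ?n} | \<pi>. \<pi> permutes {..<?n}}"
  let ?B = "{((1 / real ?n) * (\<Sum>i<?n. dist (?xs ! i) (?ys ! (\<pi> i)) powr real_of_ereal p)) powr (1 / real_of_ereal p) | \<pi>. \<pi> permutes {..<?n}}"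
  have fA: "finite ?A" and fB: "finite ?B" by (rule finite_image_set[OF fin])+
  have "?A \<noteq> {}" "?B \<noteq> {}" using permutes_id[of "{..<?n}"] by blast+
  then have A: "Min ?A \<in> ?A" and B: "Min ?B \<in> ?B" using Min_in[OF fA] Min_in[OF fB] by simp_all
  have "0 \<le> r" if r: "r \<in> ?A" for r
  proof -
    obtain \<pi> where "r = Max {dist (?xs ! i) (?ys ! (\<pi> i)) | i. i < ?n}" using r by blast
    moreover have "dist (?xs ! 0) (?ys ! (\<pi> 0)) \<le> Max {dist (?xs ! i) (?ys ! (\<pi> i)) | i. i < ?n}"
      using True by (intro Max_ge) (auto simp: nonempty_has_size)
    ultimately show ?thesis using zero_le_dist order_trans by metis
  qed
  moreover have "0 \<le> r" if "r \<in> ?B" for r using that by auto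
  ultimately have "0 \<le> Min ?A" "0 \<le> Min ?B" using A B by blast+
  then show ?thesis using True by (simp add: d1p_def Let_def)
next
  case False
  then show ?thesis by (auto simp: d1p_def)
qed

text \<open>The common points are matched with themselves, and a single nonzero term is left. In the
  mean of p-th powers it is divided by the number of points; in the maximum nothing is gained, hence
  \<open>expo \<infinity>\<close> is 0.\<close>

lemma d1p_move:
  fixes x y :: "'a::metric_space"
  assumes p: "1 \<le> p"
  shows "d1p p (add_mset x \<zeta>) (add_mset y \<zeta>) \<le> real (Suc (size \<zeta>)) powr (- expo p) * dist x y"
proof -
  let ?n = "Suc (size \<zeta>)" let ?xs = "list_of (add_mset x \<zeta>)" let ?ys = "list_of (add_mset y \<zeta>)"
  have fin: "finite {\<pi>. \<pi> permutes {..<?n}}" by (rule finite_permutations) simp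
  obtain zs where zs: "mset zs = \<zeta>" using ex_mset by blast
  then have len: "length zs = size \<zeta>" by auto
  obtain \<sigma> \<pi> where \<sigma>: "\<sigma> permutes {..<?n}" and \<pi>: "\<pi> permutes {..<?n}"
    and X: "\<And>i. i < ?n \<Longrightarrow> ?xs ! i = (x # zs) ! \<sigma> i" and Y: "\<And>i. i < ?n \<Longrightarrow> ?ys ! (\<pi> i) = (y # zs) ! \<sigma> i"
    by (rule list_of_matching[of "x # zs" "add_mset x \<zeta>" "y # zs" "add_mset y \<zeta>" ?n]) (use zs len in auto)
  have d: "dist (?xs ! i) (?ys ! (\<pi> i)) = (if \<sigma> i = 0 then dist x y else 0)" if "i < ?n" for i
    using X[OF that] Y[OF that] by (cases "\<sigma> i") auto
  show ?thesis
  proof (cases "p = \<infinity>")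
    case True
    have "d1p p (add_mset x \<zeta>) (add_mset y \<zeta>) = Min {Max {dist (?xs ! i) (?ys ! (\<pi> i)) | i. i < ?n} | \<pi>. \<pi> permutes {..<?n}}"
      using True by (simp add: d1p_def Let_def)
    also have "\<dots> \<le> Max {dist (?xs ! i) (?ys ! (\<pi> i)) | i. i < ?n}"
      by (rule Min_le[OF finite_image_set[OF fin]]) (use \<pi> in blast)
    also have "\<dots> \<le> dist x y"
      by (intro Max.boundedI) (auto simp: d)
    finally show ?thesis using True by (simp add: expo_def)
  next
    case False
    then obtain r where r: "p = ereal r" "1 \<le> r" using p by (cases p) (auto simp: one_ereal_def)
    have "(\<Sum>i<?n. dist (?xs ! i) (?ys ! (\<pi> i)) powr r) = (\<Sum>i<?n. (if \<sigma> i = 0 then dist x y powr r else 0))"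
      by (intro sum.cong refl) (simp add: d)
    also have "\<dots> = (\<Sum>i<?n. (if i = 0 then dist x y powr r else 0))"
      using sum.permute[OF \<sigma>, of "\<lambda>i. if i = 0 then dist x y powr r else 0"] by (simp add: o_def)
    also have "\<dots> = dist x y powr r" by simp
    finally have s: "(\<Sum>i<?n. dist (?xs ! i) (?ys ! (\<pi> i)) powr r) = dist x y powr r" .
    have "d1p p (add_mset x \<zeta>) (add_mset y \<zeta>) = Min {((1 / real ?n) * (\<Sum>i<?n. dist (?xs ! i) (?ys ! (\<pi> i)) powr r)) powr (1 / r) | \<pi>. \<pi> permutes {..<?n}}"
      using r by (simp add: d1p_def Let_def)
    also have "\<dots> \<le> ((1 / real ?n) * (\<Sum>i<?n. dist (?xs ! i) (?ys ! (\<pi> i)) powr r)) powr (1 / r)"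
      by (rule Min_le[OF finite_image_set[OF fin]]) (use \<pi> in blast)
    also have "\<dots> = real ?n powr (- (1 / r)) * dist x y"
      unfolding s using r by (simp add: powr_mult powr_powr powr_divide powr_minus_divide)
    finally show ?thesis using r by (simp add: expo_def)
  qed
qed

lemma abs_diff_lists_le:
  fixes w :: "'a::metric_space multiset \<Rightarrow> real"
  assumes move: "\<And>y y' \<xi>. \<bar>w (add_mset y \<xi>) - w (add_mset y' \<xi>)\<bar> \<le> c * dist y y'"
    and "length xs = length ys"
  shows "\<bar>w (mset xs + \<zeta>) - w (mset ys + \<zeta>)\<bar> \<le> c * (\<Sum>i<length xs. dist (xs ! i) (ys ! i))"
  using assms(2)
proof (induction xs ys arbitrary: \<zeta> rule: list_induct2)
  case (Cons x xs y ys)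
  have "\<bar>w (mset xs + add_mset x \<zeta>) - w (mset ys + add_mset x \<zeta>)\<bar> \<le> c * (\<Sum>i<length xs. dist (xs ! i) (ys ! i))"
    by (rule Cons.IH)
  moreover have "\<bar>w (add_mset x (mset ys + \<zeta>)) - w (add_mset y (mset ys + \<zeta>))\<bar> \<le> c * dist x y" by (rule move)
  moreover have "(\<Sum>i<length (x # xs). dist ((x # xs) ! i) ((y # ys) ! i)) = dist x y + (\<Sum>i<length xs. dist (xs ! i) (ys ! i))"
    by (simp add: sum.lessThan_Suc_shift del: sum.lessThan_Suc)
  ultimately show ?case by (simp add: distrib_left)
qed simp

lemma abs_diff_add_le:
  fixes w :: "'a multiset \<Rightarrow> real"
  assumes add: "\<And>y \<xi>. \<bar>w (add_mset y \<xi>) - w \<xi>\<bar> \<le> c"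
  shows "\<bar>w (\<xi> + \<zeta>) - w \<xi>\<bar> \<le> c * real (size \<zeta>)"
proof (induction \<zeta>)
  case (add y \<zeta>)
  then show ?case using assms[of y "\<xi> + \<zeta>"] by (simp add: algebra_simps)
qed simp

text \<open>The points of the smaller configuration are moved one by one onto their partners under
  an optimal permutation, then the unmatched points are added one by one; \<open>d1'\<close> is the
  total of these costs.\<close>

lemma abs_diff_le_d1':
  fixes w :: "'a::metric_space multiset \<Rightarrow> real"
  assumes add: "\<And>y \<xi>. \<bar>w (add_mset y \<xi>) - w \<xi>\<bar> \<le> c"
    and move: "\<And>y y' \<xi>. \<bar>w (add_mset y \<xi>) - w (add_mset y' \<xi>)\<bar> \<le> c * dist y y'"
  shows "\<bar>w \<xi> - w \<eta>\<bar> \<le> c * d1' \<xi> \<eta>"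
proof -
  have main: "\<bar>w \<xi> - w \<eta>\<bar> \<le> c * d1'_aux \<xi> \<eta>" if le: "size \<xi> \<le> size \<eta>" for \<xi> \<eta>
  proof -
    let ?n = "size \<xi>" let ?m = "size \<eta>" let ?xs = "list_of \<xi>" let ?ys = "list_of \<eta>"
    let ?S = "{(\<Sum>i<?n. dist (?xs ! i) (?ys ! (\<pi> i))) | \<pi>. \<pi> permutes {..<?m}}"
    have len: "length ?xs = ?n" "length ?ys = ?m" by (metis mset_list_of size_mset)+
    have fin: "finite {\<pi>. \<pi> permutes {..<?m}}" by (rule finite_permutations) simp
    have "Min ?S \<in> ?S"
    proof (rule Min_in)
      show "finite ?S" by (rule finite_image_set[OF fin])
      show "?S \<noteq> {}" using permutes_id[of "{..<?m}"] by blast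
    qed
    then obtain \<pi> where \<pi>: "\<pi> permutes {..<?m}" "Min ?S = (\<Sum>i<?n. dist (?xs ! i) (?ys ! (\<pi> i)))" by blast
    \<comment> \<open>The first \<open>?n\<close> entries are now the partners of the points of
      \<xi>, the remaining ones are unmatched.\<close>
    define zs where "zs = permute_list \<pi> ?ys"
    have zs: "mset zs = \<eta>" "length zs = ?m" unfolding zs_def using \<pi> len by simp_all
    have nth: "zs ! i = ?ys ! \<pi> i" if "i < ?m" for i unfolding zs_def using that \<pi> len by (simp add: permute_list_nth)
    have split: "\<eta> = mset (take ?n zs) + mset (drop ?n zs)" using zs by (metis append_take_drop_id mset_append)
    have "\<bar>w (mset ?xs + {#}) - w (mset (take ?n zs) + {#})\<bar> \<le> c * (\<Sum>i<length ?xs. dist (?xs ! i) (take ?n zs ! i))"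
      by (rule abs_diff_lists_le[OF move]) (use zs len le in simp)
    also have "(\<Sum>i<length ?xs. dist (?xs ! i) (take ?n zs ! i)) = Min ?S"
      unfolding \<pi>(2) len using le by (intro sum.cong) (auto simp: nth)
    finally have 1: "\<bar>w \<xi> - w (mset (take ?n zs))\<bar> \<le> c * Min ?S" by simp
    have "\<bar>w (mset (take ?n zs) + mset (drop ?n zs)) - w (mset (take ?n zs))\<bar> \<le> c * real (size (mset (drop ?n zs)))"
      by (rule abs_diff_add_le[OF add])
    then have 2: "\<bar>w \<eta> - w (mset (take ?n zs))\<bar> \<le> c * real (?m - ?n)"
      unfolding split[symmetric] using zs by simp
    have "\<bar>w \<xi> - w \<eta>\<bar> \<le> c * Min ?S + c * real (?m - ?n)" using 1 2 by linarith
    then show ?thesis by (simp only: d1'_aux_def Let_def distrib_left add.commute)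
  qed
  show ?thesis
    using main[of \<xi> \<eta>] main[of \<eta> \<xi>] by (simp add: d1'_def abs_minus_commute)
qed

text \<open>Unlike in \<open>nn_integral_cmult\<close>, the integrand may be nonmeasurable: \<open>nn_integral\<close> is a lower integral.\<close>

lemma nn_integral_cmult_le:
  assumes c: "0 \<le> c"
  shows "(\<integral>\<^sup>+x. ennreal c * F x \<partial>N) \<le> ennreal c * (\<integral>\<^sup>+x. F x \<partial>N)"
proof (cases "c = 0")
  case False
  then have c0: "0 < c" using c by simp
  show ?thesis
    unfolding nn_integral_def[of N "\<lambda>x. ennreal c * F x"]
  proof (rule SUP_least, clarify)
    fix g assume g: "simple_function N g" "g \<le> (\<lambda>x. ennreal c * F x)"
    define h where "h x = ennreal (1 / c) * g x" for x
    have cc: "ennreal c * ennreal (1 / c) = 1" "ennreal (1 / c) * ennreal c = 1"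
      using c0 by (simp_all add: ennreal_mult[symmetric])
    have h: "simple_function N h" unfolding h_def by (intro simple_function_mult simple_function_const g)
    have "h x \<le> F x" for x
    proof -
      have "h x \<le> ennreal (1 / c) * (ennreal c * F x)" unfolding h_def using g(2) by (intro mult_left_mono) (auto simp: le_fun_def)
      then show ?thesis using cc by (simp add: mult.assoc[symmetric])
    qed
    then have "integral\<^sup>S N h \<le> (\<integral>\<^sup>+x. F x \<partial>N)"
      using h by (simp add: nn_integral_eq_simple_integral[symmetric] nn_integral_mono)
    then have "ennreal c * integral\<^sup>S N h \<le> ennreal c * (\<integral>\<^sup>+x. F x \<partial>N)" by (intro mult_left_mono) auto
    moreover have "ennreal c * integral\<^sup>S N h = integral\<^sup>S N g"
    proof -
      have "integral\<^sup>S N (\<lambda>x. ennreal c * h x) = ennreal c * integral\<^sup>S N h" by (rule simple_integral_mult[OF h])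
      moreover have "(\<lambda>x. ennreal c * h x) = g" using cc by (simp add: h_def mult.assoc[symmetric] fun_eq_iff)
      ultimately show ?thesis by simp
    qed
    ultimately show "integral\<^sup>S N g \<le> ennreal c * (\<integral>\<^sup>+x. F x \<partial>N)" by simp
  qed
qed simp

section \<open>Decomposition of the error\<close>

text \<open>Adding 1 to each summand makes it nonnegative at the price of the number of points,
  which reduces signed sums to the extended nonnegative case.\<close>

lemma measurable_sum_points_real:
  fixes h :: "'m \<Rightarrow> 'a::topological_space \<Rightarrow> real"
  assumes h: "(\<lambda>(m, x). h m x) \<in> borel_measurable (N \<Otimes>\<^sub>M borel)" and \<xi>: "\<xi> \<in> N \<rightarrow>\<^sub>M Nsp"
    and b: "\<And>m x. \<bar>h m x\<bar> \<le> 1"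
  shows "(\<lambda>m. \<Sum>x\<in>#\<xi> m. h m x) \<in> borel_measurable N"
    and "ennreal ((\<Sum>x\<in>#\<xi> m. h m x) + real (size (\<xi> m))) = (\<Sum>x\<in>#\<xi> m. ennreal (h m x + 1))"
    and "\<bar>\<Sum>x\<in>#\<xi> m. h m x\<bar> \<le> real (size (\<xi> m))"
proof -
  have b': "0 \<le> h m x + 1" for m x using b[of m x] by linarith
  have e: "ennreal ((\<Sum>x\<in>#\<zeta>. h m x) + real (size \<zeta>)) = (\<Sum>x\<in>#\<zeta>. ennreal (h m x + 1))
     \<and> \<bar>\<Sum>x\<in>#\<zeta>. h m x\<bar> \<le> real (size \<zeta>)" for m \<zeta>
  proof (induction \<zeta>)
    case (add x \<zeta>)
    have "0 \<le> (\<Sum>x\<in>#\<zeta>. h m x) + real (size \<zeta>)" using add by linarith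
    then have "ennreal (h m x + 1 + ((\<Sum>x\<in>#\<zeta>. h m x) + real (size \<zeta>))) = ennreal (h m x + 1) + (\<Sum>x\<in>#\<zeta>. ennreal (h m x + 1))"
      using add b'[of m x] by (subst ennreal_plus) auto
    moreover have "h m x + 1 + ((\<Sum>x\<in>#\<zeta>. h m x) + real (size \<zeta>)) = (\<Sum>x\<in>#add_mset x \<zeta>. h m x) + real (size (add_mset x \<zeta>))" by simp
    moreover have "\<bar>\<Sum>x\<in>#add_mset x \<zeta>. h m x\<bar> \<le> real (size (add_mset x \<zeta>))"
      using add b[of m x] by simp linarith
    ultimately show ?case by simp
  qed simp
  then show "ennreal ((\<Sum>x\<in>#\<xi> m. h m x) + real (size (\<xi> m))) = (\<Sum>x\<in>#\<xi> m. ennreal (h m x + 1))"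
    and "\<bar>\<Sum>x\<in>#\<xi> m. h m x\<bar> \<le> real (size (\<xi> m))" by blast+
  note \<xi>[measurable]
  have [measurable]: "(\<lambda>m. \<Sum>x\<in>#\<xi> m. ennreal (h m x + 1)) \<in> borel_measurable N"
    by (rule measurable_sum_points[OF _ \<xi>]) (use h in measurable)
  have "(\<lambda>m. enn2real (\<Sum>x\<in>#\<xi> m. ennreal (h m x + 1)) - real (size (\<xi> m))) \<in> borel_measurable N"
    by measurable
  moreover have "enn2real (\<Sum>x\<in>#\<xi> m. ennreal (h m x + 1)) - real (size (\<xi> m)) = (\<Sum>x\<in>#\<xi> m. h m x)" for m
  proof -
    have "0 \<le> (\<Sum>x\<in>#\<xi> m. h m x) + real (size (\<xi> m))" using e[of m "\<xi> m"] by linarith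
    then show ?thesis using e[of m "\<xi> m"] by (metis add_diff_cancel_right' enn2real_ennreal)
  qed
  ultimately show "(\<lambda>m. \<Sum>x\<in>#\<xi> m. h m x) \<in> borel_measurable N" by simp
qed

lemma abs_sum_mset_le:
  fixes h k :: "'a \<Rightarrow> real"
  shows "ennreal \<bar>(\<Sum>x\<in>#\<xi>. h x) - (\<Sum>x\<in>#\<xi>. k x)\<bar> \<le> (\<Sum>x\<in>#\<xi>. ennreal \<bar>h x - k x\<bar>)"
proof (induction \<xi>)
  case (add x \<xi>)
  have "\<bar>(\<Sum>x\<in>#add_mset x \<xi>. h x) - (\<Sum>x\<in>#add_mset x \<xi>. k x)\<bar> \<le> \<bar>h x - k x\<bar> + \<bar>(\<Sum>x\<in>#\<xi>. h x) - (\<Sum>x\<in>#\<xi>. k x)\<bar>"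
    by simp
  then have "ennreal \<bar>(\<Sum>x\<in>#add_mset x \<xi>. h x) - (\<Sum>x\<in>#add_mset x \<xi>. k x)\<bar> \<le> ennreal \<bar>h x - k x\<bar> + ennreal \<bar>(\<Sum>x\<in>#\<xi>. h x) - (\<Sum>x\<in>#\<xi>. k x)\<bar>"
    by (metis abs_ge_zero ennreal_leI ennreal_plus)
  also have "\<dots> \<le> ennreal \<bar>h x - k x\<bar> + (\<Sum>x\<in>#\<xi>. ennreal \<bar>h x - k x\<bar>)" by (intro add_mono add order_refl)
  finally show ?case by simp
qed simp

section \<open>Neighbourhoods, Palm kernel and intensity measure\<close>

locale neighborhoods = compact_points X for X :: "'a::metric_space itself" +
  fixes Nb :: "'a \<Rightarrow> 'a set"
  assumes nbhd: "nbhd_structure Nb"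
begin

abbreviation rho :: "'a \<Rightarrow> 'a multiset \<Rightarrow> 'a multiset" where
  "rho x \<xi> \<equiv> restr \<xi> (- Nb x)"

lemma Nb_sets [measurable]: "Nb x \<in> sets borel" and Nb_self: "x \<in> Nb x"
  using nbhd by (auto simp: nbhd_structure_def)

lemma rho_measurable [measurable (raw)]:
  assumes [measurable]: "g \<in> N \<rightarrow>\<^sub>M borel" "h \<in> N \<rightarrow>\<^sub>M Nsp"
  shows "(\<lambda>w. rho (g w) (h w)) \<in> N \<rightarrow>\<^sub>M Nsp"
proof -
  have 1: "(\<lambda>(\<xi>, x). rho x \<xi>) \<in> Nsp \<Otimes>\<^sub>M borel \<rightarrow>\<^sub>M Nsp" using nbhd by (simp add: nbhd_structure_def)
  have "(\<lambda>w. (h w, g w)) \<in> N \<rightarrow>\<^sub>M Nsp \<Otimes>\<^sub>M borel" by measurable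
  from measurable_compose[OF this 1] show ?thesis by simp
qed

lemma size_rho: "size \<xi> = size (rho x \<xi>) + cnt (Nb x) \<xi>"
  by (induction \<xi>) (simp_all add: restr_def cnt_def)

lemma rho_split: "\<xi> = rho x \<xi> + filter_mset (\<lambda>y. y \<in> Nb x) \<xi>"
  using multiset_partition[of \<xi> "\<lambda>y. y \<in> Nb x"] by (simp add: restr_def add.commute)

text \<open>As x lies in its own neighbourhood, it does not matter whether the point at x is removed
  before restricting.\<close>

lemma rho_add_self [simp]: "rho x (add_mset x \<xi>) = rho x \<xi>"
  using Nb_self[of x] by (simp add: restr_def)

end

locale point_process = neighborhoods X Nb for X :: "'a::metric_space itself" and Nb +
  fixes P :: "'a multiset measure" and Pm :: "'a \<Rightarrow> 'a multiset measure"
  assumes P_prob: "prob_space P" and sets_P [measurable_cong]: "sets P = sets Nsp"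
    and lam_fin: "emeasure (exp_meas P) UNIV < \<infinity>"
    and palm: "palm_kernel P Pm"
begin

sublocale P: prob_space P by (rule P_prob)

lemma sets_exp_meas: "sets (exp_meas P) = sets borel"
  unfolding exp_meas_def using sets.sets_measure_of_eq[of "borel :: 'a measure"] by simp

lemma finite_exp_meas: "finite_measure (exp_meas P)"
  using lam_fin sets_eq_imp_space_eq[OF sets_exp_meas] by (intro finite_measureI) auto

sublocale finite_borel X "exp_meas P"
  by (intro finite_borel.intro finite_borel_axioms.intro compact_points_axioms finite_exp_meas sets_exp_meas)

abbreviation "M \<equiv> exp_meas P"

lemma space_P [simp]: "space P = UNIV"
  using sets_eq_imp_space_eq[OF sets_P] by simp

lemma Pm_kernel: "Pm \<in> borel \<rightarrow>\<^sub>M prob_algebra Nsp"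
  using palm by (simp add: palm_kernel_def)

lemma Pm_subprob: "Pm \<in> borel \<rightarrow>\<^sub>M subprob_algebra Nsp"
  by (rule measurable_prob_algebraD[OF Pm_kernel])

lemma Pm_prob: "prob_space (Pm x)" and sets_Pm [measurable_cong]: "sets (Pm x) = sets Nsp"
  using measurable_space[OF Pm_kernel, of x] by (auto simp: space_prob_algebra)

lemma palm_formula:
  assumes "h \<in> borel_measurable (borel \<Otimes>\<^sub>M Nsp)"
  shows "(\<integral>\<^sup>+\<xi>. (\<Sum>x\<in>#\<xi>. h (x, \<xi>)) \<partial>P) = (\<integral>\<^sup>+x. (\<integral>\<^sup>+\<eta>. h (x, \<eta>) \<partial>Pm x) \<partial>M)"
  using palm assms by (simp add: palm_kernel_def)

lemma campbell:
  assumes h: "h \<in> borel_measurable borel"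
  shows "(\<integral>\<^sup>+\<xi>. (\<Sum>x\<in>#\<xi>. h x) \<partial>P) = (\<integral>\<^sup>+x. h x \<partial>M)"
proof -
  have "(\<lambda>z. h (fst z)) \<in> borel_measurable (borel \<Otimes>\<^sub>M Nsp)"
    by (rule measurable_compose[OF measurable_fst h])
  from palm_formula[OF this] show ?thesis
    using prob_space.emeasure_space_1[OF Pm_prob] by simp
qed

lemma nn_integral_size: "(\<integral>\<^sup>+\<xi>. ennreal (real (size \<xi>)) \<partial>P) = emeasure M UNIV"
  using campbell[of "\<lambda>_. 1"] by (simp add: ennreal_of_nat_eq_real_of_nat)

lemma size_integrable: "integrable P (\<lambda>\<xi>. real (size \<xi>))"
  and integral_size: "(\<integral>\<xi>. real (size \<xi>) \<partial>P) = l"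
proof -
  show i: "integrable P (\<lambda>\<xi>. real (size \<xi>))"
  proof (rule integrableI_bounded)
    show "(\<integral>\<^sup>+\<xi>. ennreal (norm (real (size \<xi>))) \<partial>P) < \<infinity>"
      using nn_integral_size lam_fin by simp
  qed measurable
  have "ennreal (\<integral>\<xi>. real (size \<xi>) \<partial>P) = ennreal l"
    using nn_integral_eq_integral[OF i] nn_integral_size by (simp add: emeasure_eq_measure)
  then show "(\<integral>\<xi>. real (size \<xi>) \<partial>P) = l"
    by (subst (asm) ennreal_inj) (auto intro: integral_nonneg)
qed

end

section \<open>The three error terms\<close>

locale stein_point_process = point_process X Nb P Pm + stein X "exp_meas P" f \<alpha>
  for X :: "'a::metric_space itself" and Nb P Pm f \<alpha>
begin

definition "S \<xi> = (\<Sum>x\<in>#\<xi>. W x (\<xi> - {#x#}))"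
definition "I \<xi> = (\<integral>x. W x \<xi> \<partial>M)"
definition "S' \<xi> = (\<Sum>x\<in>#\<xi>. W x (rho x \<xi>))"
definition "I' \<xi> = (\<integral>x. W x (rho x \<xi>) \<partial>M)"

lemma S_measurable [measurable]: "S \<in> borel_measurable Nsp" and S_abs: "\<bar>S \<xi>\<bar> \<le> real (size \<xi>)"
proof -
  note measurable_diff_single[measurable (raw)]
  have m: "(\<lambda>(\<xi>, x). W x (\<xi> - {#x#})) \<in> borel_measurable (Nsp \<Otimes>\<^sub>M borel)" by measurable
  show "S \<in> borel_measurable Nsp" "\<bar>S \<xi>\<bar> \<le> real (size \<xi>)"
    using measurable_sum_points_real(1,3)[OF m measurable_ident_sets[OF refl] W_abs_le_1] by (simp_all add: S_def[abs_def])
qed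

lemma S'_measurable [measurable]: "S' \<in> borel_measurable Nsp" and S'_abs: "\<bar>S' \<xi>\<bar> \<le> real (size \<xi>)"
  and S'_ennreal: "ennreal (S' \<xi> + real (size \<xi>)) = (\<Sum>x\<in>#\<xi>. ennreal (W x (rho x \<xi>) + 1))"
proof -
  have m: "(\<lambda>(\<xi>, x). W x (rho x \<xi>)) \<in> borel_measurable (Nsp \<Otimes>\<^sub>M borel)" by measurable
  show "S' \<in> borel_measurable Nsp" "\<bar>S' \<xi>\<bar> \<le> real (size \<xi>)"
    "ennreal (S' \<xi> + real (size \<xi>)) = (\<Sum>x\<in>#\<xi>. ennreal (W x (rho x \<xi>) + 1))"
    using measurable_sum_points_real[OF m measurable_ident_sets[OF refl] W_abs_le_1] by (simp_all add: S'_def[abs_def])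
qed

lemma W_integrable: "\<zeta> \<in> borel \<rightarrow>\<^sub>M Nsp \<Longrightarrow> integrable M (\<lambda>x. W x (\<zeta> x))"
  by (rule integrable_const_bound[where B = 1]) (use W_abs_le_1 in auto)

lemma I_abs: "\<bar>I \<xi>\<bar> \<le> l" and I'_abs: "\<bar>I' \<xi>\<bar> \<le> l"
proof -
  have "\<bar>\<integral>x. W x (\<zeta> x) \<partial>M\<bar> \<le> l" if "\<zeta> \<in> borel \<rightarrow>\<^sub>M Nsp" for \<zeta> :: "'a \<Rightarrow> 'a multiset"
  proof -
    have "\<bar>\<integral>x. W x (\<zeta> x) \<partial>M\<bar> \<le> (\<integral>x. \<bar>W x (\<zeta> x)\<bar> \<partial>M)" by (rule integral_abs_bound)
    also have "\<dots> \<le> (\<integral>x. 1 \<partial>M)"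
      by (rule integral_mono) (use W_integrable[OF that] W_abs_le_1 in auto)
    finally show ?thesis by simp
  qed
  then show "\<bar>I \<xi>\<bar> \<le> l" "\<bar>I' \<xi>\<bar> \<le> l" unfolding I_def I'_def by measurable
qed

lemma I_measurable [measurable]: "I \<in> borel_measurable Nsp" "I' \<in> borel_measurable Nsp"
  unfolding I_def[abs_def] I'_def[abs_def] by (rule borel_measurable_lebesgue_integral, measurable)+

lemma P_integrable:
  assumes "g \<in> borel_measurable Nsp" "\<And>\<xi>. \<bar>g \<xi>\<bar> \<le> real (size \<xi>) \<or> \<bar>g \<xi>\<bar> \<le> C"
  shows "integrable P g"
proof (rule Bochner_Integration.integrable_bound)
  show "integrable P (\<lambda>\<xi>. real (size \<xi>) + \<bar>C\<bar>)" using size_integrable by simp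
  show "AE \<xi> in P. norm (g \<xi>) \<le> norm (real (size \<xi>) + \<bar>C\<bar>)"
    using assms(2) by (intro AE_I2) (smt (verit) of_nat_0_le_iff real_norm_def)
qed (use assms in measurable)

lemma integrables: "integrable P S" "integrable P S'" "integrable P I" "integrable P I'" "integrable P f"
  using S_abs S'_abs I_abs I'_abs f_nonneg f_le_1 f_meas by (auto intro!: P_integrable[where C = l] P_integrable[where C = 1, of f])

text \<open>The Stein equation is integrated under P, and the versions \<open>S'\<close> and
  \<open>I'\<close> restricted to the complement of the neighbourhood are inserted. The outer terms
  are local; the middle one carries the dependence at a distance.\<close>

lemma decomposition:
  "(\<integral>\<xi>. f \<xi> \<partial>P) - (\<integral>\<xi>. f \<xi> \<partial>Po M)
    = (\<integral>\<xi>. S \<xi> - S' \<xi> \<partial>P) + ((\<integral>\<xi>. S' \<xi> \<partial>P) - (\<integral>\<xi>. I' \<xi> \<partial>P)) + (\<integral>\<xi>. I' \<xi> - I \<xi> \<partial>P)"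
proof -
  have "(\<integral>\<xi>. f \<xi> \<partial>P) - (\<integral>\<xi>. f \<xi> \<partial>Po M) = (\<integral>\<xi>. f \<xi> - G 1 {#} \<partial>P)"
    using integrables P.prob_space by (simp add: integral_Po)
  also have "\<dots> = (\<integral>\<xi>. S \<xi> - I \<xi> \<partial>P)"
    by (simp add: stein_equation S_def I_def)
  finally show ?thesis using integrables by simp
qed

text \<open>For l = 0 and finite p, \<open>c1\<close> and \<open>c2\<close> evaluate to 0, so the
  two expectations have to agree exactly. They do, because \<open>I\<close> vanishes and
  \<open>S\<close> is bounded by the number of points, whose mean is l.\<close>

lemma zero_intensity:
  assumes "l = 0"
  shows "(\<integral>\<xi>. f \<xi> \<partial>P) = (\<integral>\<xi>. f \<xi> \<partial>Po M)"
proof -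
  have "\<bar>\<integral>\<xi>. S \<xi> - I \<xi> \<partial>P\<bar> \<le> (\<integral>\<xi>. \<bar>S \<xi> - I \<xi>\<bar> \<partial>P)" by (rule integral_abs_bound)
  also have "\<dots> \<le> (\<integral>\<xi>. real (size \<xi>) \<partial>P)"
  proof (rule integral_mono)
    show "\<bar>S \<xi> - I \<xi>\<bar> \<le> real (size \<xi>)" for \<xi> using S_abs[of \<xi>] I_abs[of \<xi>] assms by simp
  qed (use integrables size_integrable in auto)
  also have "\<dots> = 0" using assms by (simp add: integral_size)
  finally have "(\<integral>\<xi>. S \<xi> - I \<xi> \<partial>P) = 0" by simp
  moreover have "(\<integral>\<xi>. f \<xi> \<partial>P) - (\<integral>\<xi>. f \<xi> \<partial>Po M) = (\<integral>\<xi>. f \<xi> - G 1 {#} \<partial>P)"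
    using integrables P.prob_space by (simp add: integral_Po)
  ultimately show ?thesis by (simp add: stein_equation S_def I_def)
qed

text \<open>Going from \<xi> without x to its restriction deletes the other points of the
  neighbourhood, at cost c each.\<close>

lemma first_term:
  assumes c: "0 \<le> c" and add: "\<And>x y \<xi>. \<bar>W x (add_mset y \<xi>) - W x \<xi>\<bar> \<le> c"
  shows "ennreal \<bar>\<integral>\<xi>. S \<xi> - S' \<xi> \<partial>P\<bar> \<le> ennreal c * (\<integral>\<^sup>+\<xi>. (\<Sum>x\<in>#\<xi>. of_nat (cnt (Nb x) \<xi> - 1)) \<partial>P)"
proof -
  have "ennreal \<bar>\<integral>\<xi>. S \<xi> - S' \<xi> \<partial>P\<bar> \<le> (\<integral>\<^sup>+\<xi>. ennreal \<bar>S \<xi> - S' \<xi>\<bar> \<partial>P)"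
    using integral_norm_bound_ennreal[of P "\<lambda>\<xi>. S \<xi> - S' \<xi>"] integrables by simp
  also have "\<dots> \<le> (\<integral>\<^sup>+\<xi>. ennreal c * (\<Sum>x\<in>#\<xi>. of_nat (cnt (Nb x) \<xi> - 1)) \<partial>P)"
  proof (rule nn_integral_mono)
    fix \<xi>
    have "ennreal \<bar>S \<xi> - S' \<xi>\<bar> \<le> (\<Sum>x\<in>#\<xi>. ennreal \<bar>W x (\<xi> - {#x#}) - W x (rho x \<xi>)\<bar>)"
      unfolding S_def S'_def by (rule abs_sum_mset_le)
    also have "\<dots> \<le> (\<Sum>x\<in>#\<xi>. ennreal c * of_nat (cnt (Nb x) \<xi> - 1))"
    proof (rule sum_mset_mono)
      fix x assume "x \<in># \<xi>"
      then obtain \<zeta> where \<zeta>: "\<xi> = add_mset x \<zeta>" by (rule mset_add)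
      have "\<bar>W x (rho x \<zeta> + filter_mset (\<lambda>y. y \<in> Nb x) \<zeta>) - W x (rho x \<zeta>)\<bar> \<le> c * real (size (filter_mset (\<lambda>y. y \<in> Nb x) \<zeta>))"
        by (rule abs_diff_add_le[OF add])
      then have "\<bar>W x \<zeta> - W x (rho x \<zeta>)\<bar> \<le> c * real (cnt (Nb x) \<zeta>)"
        unfolding rho_split[symmetric] cnt_def .
      then have "ennreal \<bar>W x \<zeta> - W x (rho x \<zeta>)\<bar> \<le> ennreal (c * real (cnt (Nb x) \<zeta>))" by (rule ennreal_leI)
      \<comment> \<open>The point x is itself counted in \<open>cnt (Nb x) \<xi>\<close>, so the
        truncated subtraction is exact and leaves the count for \<open>\<zeta>\<close>.\<close>
      then show "ennreal \<bar>W x (\<xi> - {#x#}) - W x (rho x \<xi>)\<bar> \<le> ennreal c * of_nat (cnt (Nb x) \<xi> - 1)"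
        using c Nb_self[of x] by (simp add: \<zeta> ennreal_mult ennreal_of_nat_eq_real_of_nat)
    qed
    finally show "ennreal \<bar>S \<xi> - S' \<xi>\<bar> \<le> ennreal c * (\<Sum>x\<in>#\<xi>. of_nat (cnt (Nb x) \<xi> - 1))"
      by (simp add: sum_mset_distrib_left)
  qed
  also have "\<dots> \<le> ennreal c * (\<integral>\<^sup>+\<xi>. (\<Sum>x\<in>#\<xi>. of_nat (cnt (Nb x) \<xi> - 1)) \<partial>P)"
    by (rule nn_integral_cmult_le[OF c])
  finally show ?thesis .
qed

text \<open>Here all points of \<xi> in the neighbourhood are deleted, since x is not one of the
  points summed over; Campbell's formula turns their expected number into
  \<open>emeasure M (Nb x)\<close>.\<close>

lemma last_term:
  assumes c: "0 \<le> c" and add: "\<And>x y \<xi>. \<bar>W x (add_mset y \<xi>) - W x \<xi>\<bar> \<le> c"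
  shows "ennreal \<bar>\<integral>\<xi>. I' \<xi> - I \<xi> \<partial>P\<bar> \<le> ennreal c * (\<integral>\<^sup>+x. emeasure M (Nb x) \<partial>M)"
proof -
  interpret PM: pair_sigma_finite P M by unfold_locales
  \<comment> \<open>A neighbourhood structure makes only the restriction jointly measurable; the
    count is recovered as a difference of two sizes.\<close>
  have [measurable]: "(\<lambda>(\<xi>, x). real (cnt (Nb x) \<xi>)) \<in> borel_measurable (Nsp \<Otimes>\<^sub>M borel)"
  proof -
    have "(\<lambda>(\<xi>, x). real (size \<xi>) - real (size (rho x \<xi>))) \<in> borel_measurable (Nsp \<Otimes>\<^sub>M borel)" by measurable
    moreover have "real (cnt (Nb x) \<xi>) = real (size \<xi>) - real (size (rho x \<xi>))" for x \<xi>
      using size_rho[of \<xi> x] by simp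
    ultimately show ?thesis by simp
  qed
  have "ennreal \<bar>\<integral>\<xi>. I' \<xi> - I \<xi> \<partial>P\<bar> \<le> (\<integral>\<^sup>+\<xi>. ennreal \<bar>I' \<xi> - I \<xi>\<bar> \<partial>P)"
    using integral_norm_bound_ennreal[of P "\<lambda>\<xi>. I' \<xi> - I \<xi>"] integrables by simp
  also have "\<dots> \<le> (\<integral>\<^sup>+\<xi>. (\<integral>\<^sup>+x. ennreal c * ennreal (real (cnt (Nb x) \<xi>)) \<partial>M) \<partial>P)"
  proof (rule nn_integral_mono)
    fix \<xi>
    have i: "integrable M (\<lambda>x. W x (rho x \<xi>))" "integrable M (\<lambda>x. W x \<xi>)"
      by (rule W_integrable, measurable)+
    have "ennreal \<bar>I' \<xi> - I \<xi>\<bar> = ennreal (norm (\<integral>x. W x (rho x \<xi>) - W x \<xi> \<partial>M))"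
      using i by (simp add: I_def I'_def)
    also have "\<dots> \<le> (\<integral>\<^sup>+x. ennreal (norm (W x (rho x \<xi>) - W x \<xi>)) \<partial>M)"
      using i by (intro integral_norm_bound_ennreal) simp
    also have "\<dots> \<le> (\<integral>\<^sup>+x. ennreal c * ennreal (real (cnt (Nb x) \<xi>)) \<partial>M)"
    proof (rule nn_integral_mono)
      fix x
      have "\<bar>W x (rho x \<xi> + filter_mset (\<lambda>y. y \<in> Nb x) \<xi>) - W x (rho x \<xi>)\<bar> \<le> c * real (size (filter_mset (\<lambda>y. y \<in> Nb x) \<xi>))"
        by (rule abs_diff_add_le[OF add])
      then have "\<bar>W x \<xi> - W x (rho x \<xi>)\<bar> \<le> c * real (cnt (Nb x) \<xi>)"
        unfolding rho_split[symmetric] cnt_def .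
      then have "ennreal \<bar>W x \<xi> - W x (rho x \<xi>)\<bar> \<le> ennreal (c * real (cnt (Nb x) \<xi>))" by (rule ennreal_leI)
      then show "ennreal (norm (W x (rho x \<xi>) - W x \<xi>)) \<le> ennreal c * ennreal (real (cnt (Nb x) \<xi>))"
        using c by (simp add: ennreal_mult abs_minus_commute)
    qed
    finally show "ennreal \<bar>I' \<xi> - I \<xi>\<bar> \<le> (\<integral>\<^sup>+x. ennreal c * ennreal (real (cnt (Nb x) \<xi>)) \<partial>M)" .
  qed
  also have "\<dots> = (\<integral>\<^sup>+x. (\<integral>\<^sup>+\<xi>. ennreal c * ennreal (real (cnt (Nb x) \<xi>)) \<partial>P) \<partial>M)"
    by (rule PM.Fubini'[symmetric]) measurable
  also have "\<dots> = (\<integral>\<^sup>+x. ennreal c * emeasure M (Nb x) \<partial>M)"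
  proof (rule nn_integral_cong)
    fix x
    have s: "ennreal (real (cnt (Nb x) \<xi>)) = (\<Sum>y\<in>#\<xi>. indicator (Nb x) y)" for \<xi>
      by (induction \<xi>) (auto simp: indicator_def ennreal_of_nat_eq_real_of_nat[symmetric])
    have "(\<integral>\<^sup>+\<xi>. ennreal (real (cnt (Nb x) \<xi>)) \<partial>P) = emeasure M (Nb x)"
      unfolding s by (subst campbell) (auto simp: sets_M)
    then show "(\<integral>\<^sup>+\<xi>. ennreal c * ennreal (real (cnt (Nb x) \<xi>)) \<partial>P) = ennreal c * emeasure M (Nb x)"
      by (subst nn_integral_cmult) auto
  qed
  also have "\<dots> \<le> ennreal c * (\<integral>\<^sup>+x. emeasure M (Nb x) \<partial>M)"
    by (rule nn_integral_cmult_le[OF c])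
  finally show ?thesis .
qed

text \<open>The formulas of Campbell type hold for nonnegative functions. As \<open>W\<close> is at
  least -1, adding 1 to each summand reaches that case and contributes the mean number of points
  l.\<close>

lemma nn_integral_S': "(\<integral>\<^sup>+\<xi>. (\<Sum>x\<in>#\<xi>. ennreal (W x (rho x \<xi>) + 1)) \<partial>P) = ennreal ((\<integral>\<xi>. S' \<xi> \<partial>P) + l)"
proof -
  have "0 \<le> S' \<xi> + real (size \<xi>)" for \<xi> using S'_abs[of \<xi>] by linarith
  then have "(\<integral>\<^sup>+\<xi>. ennreal (S' \<xi> + real (size \<xi>)) \<partial>P) = ennreal (\<integral>\<xi>. S' \<xi> + real (size \<xi>) \<partial>P)"
    using integrables size_integrable by (intro nn_integral_eq_integral) auto
  then show ?thesis using integrables size_integrable by (simp add: S'_ennreal integral_size)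
qed

lemma S'_plus_l_nonneg: "0 \<le> (\<integral>\<xi>. S' \<xi> \<partial>P) + l"
proof -
  have "0 \<le> S' \<xi> + real (size \<xi>)" for \<xi> using S'_abs[of \<xi>] by linarith
  then have "0 \<le> (\<integral>\<xi>. S' \<xi> + real (size \<xi>) \<partial>P)" by (rule Bochner_Integration.integral_nonneg)
  then show ?thesis using integrables size_integrable by (simp add: integral_size)
qed

text \<open>The Palm formula turns the mean of \<open>S'\<close> into the integral of
  \<open>s\<close>, where the Palm process is restricted; Fubini turns that of \<open>I'\<close>
  into the integral of \<open>t\<close>, where the process itself is. \<open>Q x\<close> realises
  both on one space, and the resulting difference of values of \<open>W x\<close> is controlled by
  \<open>d1'\<close>.\<close>

lemma middle_term_coupling:
  fixes Q :: "'a \<Rightarrow> ('a multiset \<times> 'a multiset) measure"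
  assumes c: "0 \<le> c" and add: "\<And>x y \<xi>. \<bar>W x (add_mset y \<xi>) - W x \<xi>\<bar> \<le> c"
    and move: "\<And>x y y' \<xi>. \<bar>W x (add_mset y \<xi>) - W x (add_mset y' \<xi>)\<bar> \<le> c * dist y y'"
    and Q_kernel: "Q \<in> borel \<rightarrow>\<^sub>M prob_algebra (Nsp \<Otimes>\<^sub>M Nsp)"
    and Q_coupling: "\<And>x. distr (Q x) Nsp fst = P \<and> distr (Q x) Nsp snd = Pm x"
  shows "ennreal \<bar>(\<integral>\<xi>. S' \<xi> \<partial>P) - (\<integral>\<xi>. I' \<xi> \<partial>P)\<bar>
    \<le> ennreal c * (\<integral>\<^sup>+x. (\<integral>\<^sup>+z. ennreal (d1' (rho x (fst z)) (rho x (snd z))) \<partial>Q x) \<partial>M)"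
proof -
  interpret PM: pair_sigma_finite P M by unfold_locales
  have Q_prob: "prob_space (Q x)" and sets_Q: "sets (Q x) = sets (Nsp \<Otimes>\<^sub>M Nsp)" for x
    using measurable_space[OF Q_kernel, of x] by (auto simp: space_prob_algebra)
  note sets_Q[measurable_cong]
  define s where "s x = (\<integral>\<eta>. W x (rho x \<eta>) \<partial>Pm x)" for x
  define t where "t x = (\<integral>\<xi>. W x (rho x \<xi>) \<partial>P)" for x
  have iPm: "integrable (Pm x) (\<lambda>\<eta>. W x (rho x \<eta>))" for x
  proof -
    interpret prob_space "Pm x" by (rule Pm_prob)
    show ?thesis by (rule integrable_const_bound[where B = 1]) (use W_abs_le_1 in auto)
  qed
  have s1: "ennreal (s x + 1) = (\<integral>\<^sup>+\<eta>. ennreal (W x (rho x \<eta>) + 1) \<partial>Pm x)" "0 \<le> s x + 1" "\<bar>s x\<bar> \<le> 1" for x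
  proof -
    interpret prob_space "Pm x" by (rule Pm_prob)
    have nn: "0 \<le> W x (rho x \<eta>) + 1" for \<eta> using W_abs_le_1[of x "rho x \<eta>"] by linarith
    have e: "(\<integral>\<eta>. W x (rho x \<eta>) + 1 \<partial>Pm x) = s x + 1" using iPm by (simp add: s_def prob_space)
    show "ennreal (s x + 1) = (\<integral>\<^sup>+\<eta>. ennreal (W x (rho x \<eta>) + 1) \<partial>Pm x)"
      unfolding e[symmetric] using iPm nn by (intro nn_integral_eq_integral[symmetric]) auto
    show "0 \<le> s x + 1" unfolding e[symmetric] using nn by (rule Bochner_Integration.integral_nonneg)
    have "\<bar>s x\<bar> \<le> (\<integral>\<eta>. \<bar>W x (rho x \<eta>)\<bar> \<partial>Pm x)" unfolding s_def by (rule integral_abs_bound)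
    also have "\<dots> \<le> (\<integral>\<eta>. 1 \<partial>Pm x)" by (rule integral_mono) (use iPm W_abs_le_1 in auto)
    finally show "\<bar>s x\<bar> \<le> 1" by (simp add: prob_space)
  qed
  have m1: "(\<lambda>(x, \<eta>). ennreal (W x (rho x \<eta>) + 1)) \<in> borel_measurable (borel \<Otimes>\<^sub>M Nsp)" by measurable
  have s_meas: "s \<in> borel_measurable borel"
  proof -
    have "(\<lambda>x. enn2real (\<integral>\<^sup>+\<eta>. ennreal (W x (rho x \<eta>) + 1) \<partial>Pm x) - 1) \<in> borel_measurable borel"
      using nn_integral_measurable_subprob_algebra2[OF m1 Pm_subprob] by measurable
    moreover have "enn2real (\<integral>\<^sup>+\<eta>. ennreal (W x (rho x \<eta>) + 1) \<partial>Pm x) - 1 = s x" for x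
      unfolding s1(1)[symmetric] using s1(2)[of x] by simp
    ultimately show ?thesis by simp
  qed
  have int_s: "integrable M s"
    by (rule integrable_const_bound[where B = 1]) (use s_meas s1 in \<open>auto cong: measurable_cong_sets simp: sets_M\<close>)
  have "ennreal ((\<integral>\<xi>. S' \<xi> \<partial>P) + l) = (\<integral>\<^sup>+x. (\<integral>\<^sup>+\<eta>. ennreal (W x (rho x \<eta>) + 1) \<partial>Pm x) \<partial>M)"
    using palm_formula[OF m1] by (simp add: nn_integral_S'[symmetric])
  also have "\<dots> = (\<integral>\<^sup>+x. ennreal (s x + 1) \<partial>M)" by (simp only: s1(1))
  also have "\<dots> = ennreal (\<integral>x. s x + 1 \<partial>M)" using int_s s1 by (intro nn_integral_eq_integral) auto
  also have "(\<integral>x. s x + 1 \<partial>M) = (\<integral>x. s x \<partial>M) + l" using int_s by simp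
  finally have "(\<integral>\<xi>. S' \<xi> \<partial>P) + l = (\<integral>x. s x \<partial>M) + l"
  proof (subst (asm) ennreal_inj)
    have "0 \<le> (\<integral>x. s x + 1 \<partial>M)" using s1 by (intro Bochner_Integration.integral_nonneg) auto
    then show "0 \<le> (\<integral>x. s x \<partial>M) + l" using int_s by simp
  qed (use S'_plus_l_nonneg in auto)
  then have S's: "(\<integral>\<xi>. S' \<xi> \<partial>P) = (\<integral>x. s x \<partial>M)" by simp
  have ip: "integrable (P \<Otimes>\<^sub>M M) (\<lambda>(\<xi>, x). W x (rho x \<xi>))"
  proof -
    interpret F: finite_measure "P \<Otimes>\<^sub>M M" by (rule finite_measure_pair_measure) unfold_locales
    show ?thesis by (rule F.integrable_const_bound[where B = 1]) (use W_abs_le_1 in \<open>auto simp: case_prod_beta\<close>)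
  qed
  have I't: "(\<integral>\<xi>. I' \<xi> \<partial>P) = (\<integral>x. t x \<partial>M)"
    unfolding I'_def t_def by (rule PM.Fubini_integral[OF ip, symmetric])
  have int_t: "integrable M t"
    unfolding t_def using PM.integrable_snd[OF ip] by simp
  have "ennreal \<bar>(\<integral>\<xi>. S' \<xi> \<partial>P) - (\<integral>\<xi>. I' \<xi> \<partial>P)\<bar> = ennreal (norm (\<integral>x. s x - t x \<partial>M))"
    using int_s int_t by (simp add: S's I't)
  also have "\<dots> \<le> (\<integral>\<^sup>+x. ennreal (norm (s x - t x)) \<partial>M)"
    using int_s int_t by (intro integral_norm_bound_ennreal) simp
  also have "\<dots> \<le> (\<integral>\<^sup>+x. ennreal c * (\<integral>\<^sup>+z. ennreal (d1' (rho x (fst z)) (rho x (snd z))) \<partial>Q x) \<partial>M)"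
  proof (rule nn_integral_mono)
    fix x
    interpret Q: prob_space "Q x" by (rule Q_prob)
    have "(\<integral>\<eta>. W x (rho x \<eta>) \<partial>distr (Q x) Nsp snd) = (\<integral>z. W x (rho x (snd z)) \<partial>Q x)"
      by (rule integral_distr) measurable
    then have ss: "s x = (\<integral>z. W x (rho x (snd z)) \<partial>Q x)"
      unfolding s_def using Q_coupling[of x] by simp
    have "(\<integral>\<eta>. W x (rho x \<eta>) \<partial>distr (Q x) Nsp fst) = (\<integral>z. W x (rho x (fst z)) \<partial>Q x)"
      by (rule integral_distr) measurable
    then have tt: "t x = (\<integral>z. W x (rho x (fst z)) \<partial>Q x)"
      unfolding t_def using Q_coupling[of x] by simp
    have i: "integrable (Q x) (\<lambda>z. W x (rho x (snd z)))" "integrable (Q x) (\<lambda>z. W x (rho x (fst z)))"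
      by (rule Q.integrable_const_bound[where B = 1]; use W_abs_le_1 in auto)+
    have "ennreal (norm (s x - t x)) = ennreal (norm (\<integral>z. W x (rho x (snd z)) - W x (rho x (fst z)) \<partial>Q x))"
      unfolding ss tt using i by simp
    also have "\<dots> \<le> (\<integral>\<^sup>+z. ennreal (norm (W x (rho x (snd z)) - W x (rho x (fst z)))) \<partial>Q x)"
      using i by (intro integral_norm_bound_ennreal) simp
    also have "\<dots> \<le> (\<integral>\<^sup>+z. ennreal c * ennreal (d1' (rho x (fst z)) (rho x (snd z))) \<partial>Q x)"
    proof (rule nn_integral_mono)
      fix z
      have "\<bar>W x (rho x (fst z)) - W x (rho x (snd z))\<bar> \<le> c * d1' (rho x (fst z)) (rho x (snd z))"
        by (rule abs_diff_le_d1'[OF add move])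
      then have "ennreal \<bar>W x (rho x (fst z)) - W x (rho x (snd z))\<bar> \<le> ennreal (c * d1' (rho x (fst z)) (rho x (snd z)))" by (rule ennreal_leI)
      then show "ennreal (norm (W x (rho x (snd z)) - W x (rho x (fst z)))) \<le> ennreal c * ennreal (d1' (rho x (fst z)) (rho x (snd z)))"
        using c by (simp add: ennreal_mult' abs_minus_commute)
    qed
    also have "\<dots> \<le> ennreal c * (\<integral>\<^sup>+z. ennreal (d1' (rho x (fst z)) (rho x (snd z))) \<partial>Q x)"
      by (rule nn_integral_cmult_le[OF c])
    finally show "ennreal (norm (s x - t x)) \<le> ennreal c * (\<integral>\<^sup>+z. ennreal (d1' (rho x (fst z)) (rho x (snd z))) \<partial>Q x)" .
  qed
  also have "\<dots> \<le> ennreal c * (\<integral>\<^sup>+x. (\<integral>\<^sup>+z. ennreal (d1' (rho x (fst z)) (rho x (snd z))) \<partial>Q x) \<partial>M)"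
    by (rule nn_integral_cmult_le[OF c])
  finally show ?thesis .
qed

end

section \<open>Mecke formula and independence of disjoint restrictions\<close>

lemma suminf_swap_ennreal:
  fixes g :: "nat \<Rightarrow> nat \<Rightarrow> ennreal"
  shows "(\<Sum>m. \<Sum>k. g m k) = (\<Sum>k. \<Sum>m. g m k)"
proof -
  have "(\<Sum>m. \<Sum>k. g m k) = (\<integral>\<^sup>+m. (\<Sum>k. g m k) \<partial>count_space UNIV)" by (simp add: nn_integral_count_space_nat)
  also have "\<dots> = (\<Sum>k. \<integral>\<^sup>+m. g m k \<partial>count_space UNIV)" by (rule nn_integral_suminf) simp
  finally show ?thesis by (simp add: nn_integral_count_space_nat)
qed

lemma suminf_cauchy_ennreal:
  fixes g :: "nat \<Rightarrow> nat \<Rightarrow> ennreal"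
  shows "(\<Sum>m. \<Sum>k\<le>m. g k (m - k)) = (\<Sum>k. \<Sum>r. g k r)"
proof -
  have "(\<Sum>k\<le>m. g k (m - k)) = (\<Sum>k. of_bool (k \<le> m) * g k (m - k))" for m
    by (subst suminf_finite[of "{..m}"]) auto
  then have "(\<Sum>m. \<Sum>k\<le>m. g k (m - k)) = (\<Sum>k. \<Sum>m. of_bool (k \<le> m) * g k (m - k))"
    by (simp add: suminf_swap_ennreal[of "\<lambda>m k. of_bool (k \<le> m) * g k (m - k)"])
  moreover have "(\<Sum>m. of_bool (k \<le> m) * g k (m - k)) = (\<Sum>r. g k r)" for k
    by (subst suminf_offset[where i = k]) auto
  ultimately show ?thesis by simp
qed

lemma nn_integral_sum_mset:
  assumes "\<And>y. y \<in># \<eta> \<Longrightarrow> h y \<in> borel_measurable N"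
  shows "(\<integral>\<^sup>+x. (\<Sum>y\<in>#\<eta>. h y x) \<partial>N) = (\<Sum>y\<in>#\<eta>. \<integral>\<^sup>+x. h y x \<partial>N)
    \<and> (\<lambda>x. \<Sum>y\<in>#\<eta>. h y x) \<in> borel_measurable N"
  using assms
proof (induction \<eta>)
  case (add y \<eta>)
  have [measurable]: "h y \<in> borel_measurable N" by (rule add.prems) simp
  have IH: "(\<integral>\<^sup>+x. (\<Sum>y\<in>#\<eta>. h y x) \<partial>N) = (\<Sum>y\<in>#\<eta>. \<integral>\<^sup>+x. h y x \<partial>N)"
    "(\<lambda>x. \<Sum>y\<in>#\<eta>. h y x) \<in> borel_measurable N"
    using add.IH add.prems by auto
  note IH(2)[measurable]
  have "(\<integral>\<^sup>+x. h y x + (\<Sum>y\<in>#\<eta>. h y x) \<partial>N) = (\<integral>\<^sup>+x. h y x \<partial>N) + (\<integral>\<^sup>+x. (\<Sum>y\<in>#\<eta>. h y x) \<partial>N)"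
    by (rule nn_integral_add) measurable
  moreover have "(\<lambda>x. h y x + (\<Sum>y\<in>#\<eta>. h y x)) \<in> borel_measurable N" by measurable
  ultimately show ?case by (simp add: IH(1))
next
  case empty
  show ?case by simp
qed

section \<open>Mecke formula and splitting of the Poisson process\<close>

context finite_borel
begin

lemma M_pair: "pair_sigma_finite M M"
  by (intro pair_sigma_finite.intro sigma_finite_measure_axioms)

lemma pint_cmult:
  assumes F[measurable]: "F \<in> borel_measurable Nsp"
  shows "pint M (\<lambda>\<xi>. c * F \<xi>) n \<eta> = c * pint M F n \<eta>"
proof -
  have "(\<integral>\<^sup>+v. c * F (vmset n v + \<eta>) \<partial>PiM {..<n} (\<lambda>_. M)) = c * (\<integral>\<^sup>+v. F (vmset n v + \<eta>) \<partial>PiM {..<n} (\<lambda>_. M))"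
    by (rule nn_integral_cmult) measurable
  moreover have m: "(\<lambda>\<xi>. c * F \<xi>) \<in> borel_measurable Nsp" by measurable
  ultimately show ?thesis by (simp only: nn_integral_vmset[OF m] nn_integral_vmset[OF F])
qed

lemma pint_suminf:
  assumes F[measurable]: "\<And>i. F i \<in> borel_measurable Nsp"
  shows "pint M (\<lambda>\<xi>. \<Sum>i. F i \<xi>) n \<eta> = (\<Sum>i. pint M (F i) n \<eta>)"
proof -
  have m: "(\<lambda>\<xi>. \<Sum>i. F i \<xi>) \<in> borel_measurable Nsp" by measurable
  have "(\<integral>\<^sup>+v. (\<Sum>i. F i (vmset n v + \<eta>)) \<partial>PiM {..<n} (\<lambda>_. M)) = (\<Sum>i. \<integral>\<^sup>+v. F i (vmset n v + \<eta>) \<partial>PiM {..<n} (\<lambda>_. M))"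
    by (rule nn_integral_suminf) measurable
  then show ?thesis by (simp only: nn_integral_vmset[OF m] nn_integral_vmset[OF F])
qed

text \<open>Only configurations containing \<eta> are ever evaluated. This removes terms whose
  indicator already fails at \<eta>.\<close>

lemma pint_cong_on:
  assumes "\<And>\<xi>. \<eta> \<subseteq># \<xi> \<Longrightarrow> F \<xi> = H \<xi>"
  shows "pint M F n \<eta> = pint M H n \<eta>"
  using assms
proof (induction n arbitrary: \<eta>)
  case (Suc n)
  have "pint M F n (add_mset x \<eta>) = pint M H n (add_mset x \<eta>)" for x
    by (rule Suc.IH) (meson Suc.prems mset_subset_eq_insertD subset_mset.less_imp_le)
  then show ?case by simp
next
  case 0
  then show ?case
    by simp
qed

lemma pint_zero [simp]: "pint M (\<lambda>_. 0) n \<eta> = 0"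
proof (induction n arbitrary: \<eta>)
  case (Suc n)
  show ?case
    by (simp add: Suc)
qed (rule pint.simps(1))

lemma pint_swap:
  assumes H: "(\<lambda>(x, \<xi>). H x \<xi>) \<in> borel_measurable (borel \<Otimes>\<^sub>M Nsp)"
  shows "pint M (\<lambda>\<xi>. \<integral>\<^sup>+x. H x \<xi> \<partial>M) n \<eta> = (\<integral>\<^sup>+x. pint M (H x) n \<eta> \<partial>M)"
proof (induction n arbitrary: \<eta>)
  case (Suc n)
  interpret pair_sigma_finite M M by (rule M_pair)
  have [measurable]: "(\<lambda>(x, \<xi>). pint M (H x) n \<xi>) \<in> borel_measurable (borel \<Otimes>\<^sub>M Nsp)"
    by (rule pint_measurable_param[OF H])
  have m: "(\<lambda>(x, y). pint M (H x) n (add_mset y \<eta>)) \<in> borel_measurable (M \<Otimes>\<^sub>M M)" by measurable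
  show ?case by (simp add: Suc Fubini'[OF m])
next
  case 0
  show ?case
    by simp
qed

text \<open>The point summed over is either one of the n integrated points, which all contribute
  equally, or one of the fixed points \<eta>. Keeping \<eta> general drives the induction, because
  each integration turns its point into a fixed one.\<close>

lemma pint_mecke:
  assumes h: "(\<lambda>(x, \<xi>). h x \<xi>) \<in> borel_measurable (borel \<Otimes>\<^sub>M Nsp)"
  shows "pint M (\<lambda>\<xi>. \<Sum>x\<in>#\<xi>. h x (\<xi> - {#x#})) n \<eta>
    = of_nat n * (\<integral>\<^sup>+x. pint M (h x) (n - 1) \<eta> \<partial>M) + (\<Sum>x\<in>#\<eta>. pint M (h x) n (\<eta> - {#x#}))"
proof (induction n arbitrary: \<eta>)
  case 0
  show ?case by simp
next
  case (Suc n)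
  interpret pair_sigma_finite M M by (rule M_pair)
  let ?H = "\<lambda>\<xi>. \<Sum>x\<in>#\<xi>. h x (\<xi> - {#x#})"
  have [measurable]: "(\<lambda>(x, \<xi>). pint M (h x) k \<xi>) \<in> borel_measurable (borel \<Otimes>\<^sub>M Nsp)" for k
    by (rule pint_measurable_param[OF h])
  have m: "(\<lambda>(x, y). pint M (h x) k (add_mset y \<eta>)) \<in> borel_measurable (M \<Otimes>\<^sub>M M)" for k by measurable
  have sw: "(\<integral>\<^sup>+y. (\<integral>\<^sup>+x. pint M (h x) k (add_mset y \<eta>) \<partial>M) \<partial>M) = (\<integral>\<^sup>+x. pint M (h x) (Suc k) \<eta> \<partial>M)" for k
    using Fubini'[OF m] by simp
  have sm: "(\<lambda>y. \<Sum>x\<in>#\<eta>. pint M (h x) n (add_mset y (\<eta> - {#x#}))) \<in> borel_measurable M"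
    "(\<integral>\<^sup>+y. (\<Sum>x\<in>#\<eta>. pint M (h x) n (add_mset y (\<eta> - {#x#}))) \<partial>M) = (\<Sum>x\<in>#\<eta>. pint M (h x) (Suc n) (\<eta> - {#x#}))"
    using nn_integral_sum_mset[of \<eta> "\<lambda>x y. pint M (h x) n (add_mset y (\<eta> - {#x#}))" M] by simp_all
  have "pint M ?H (Suc n) \<eta> = (\<integral>\<^sup>+y. of_nat n * (\<integral>\<^sup>+x. pint M (h x) (n - 1) (add_mset y \<eta>) \<partial>M)
      + (\<Sum>x\<in>#add_mset y \<eta>. pint M (h x) n (add_mset y \<eta> - {#x#})) \<partial>M)"
    by (simp add: Suc)
  also have "\<dots> = (\<integral>\<^sup>+y. of_nat n * (\<integral>\<^sup>+x. pint M (h x) (n - 1) (add_mset y \<eta>) \<partial>M)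
      + (pint M (h y) n \<eta> + (\<Sum>x\<in>#\<eta>. pint M (h x) n (add_mset y (\<eta> - {#x#})))) \<partial>M)"
  proof (intro nn_integral_cong)
    fix y
    have "(\<Sum>x\<in>#\<eta>. pint M (h x) n (add_mset y \<eta> - {#x#})) = (\<Sum>x\<in>#\<eta>. pint M (h x) n (add_mset y (\<eta> - {#x#})))"
      by (intro arg_cong[of _ _ sum_mset] image_mset_cong) simp
    then show "of_nat n * (\<integral>\<^sup>+x. pint M (h x) (n - 1) (add_mset y \<eta>) \<partial>M) + (\<Sum>x\<in>#add_mset y \<eta>. pint M (h x) n (add_mset y \<eta> - {#x#}))
      = of_nat n * (\<integral>\<^sup>+x. pint M (h x) (n - 1) (add_mset y \<eta>) \<partial>M) + (pint M (h y) n \<eta> + (\<Sum>x\<in>#\<eta>. pint M (h x) n (add_mset y (\<eta> - {#x#}))))"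
      by simp
  qed
  also have "\<dots> = of_nat n * (\<integral>\<^sup>+y. (\<integral>\<^sup>+x. pint M (h x) (n - 1) (add_mset y \<eta>) \<partial>M) \<partial>M)
      + ((\<integral>\<^sup>+y. pint M (h y) n \<eta> \<partial>M) + (\<integral>\<^sup>+y. (\<Sum>x\<in>#\<eta>. pint M (h x) n (add_mset y (\<eta> - {#x#}))) \<partial>M))"
  proof -
    have [measurable]: "(\<lambda>y. \<integral>\<^sup>+x. pint M (h x) (n - 1) (add_mset y \<eta>) \<partial>M) \<in> borel_measurable M"
      by measurable
    note sm(1)[measurable]
    show ?thesis by (subst nn_integral_add, measurable)+ (subst nn_integral_cmult, measurable)
  qed
  \<comment> \<open>For n = 0 the truncated index n - 1 is harmless, since the factor n
    vanishes.\<close>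
  also have "of_nat n * (\<integral>\<^sup>+y. (\<integral>\<^sup>+x. pint M (h x) (n - 1) (add_mset y \<eta>) \<partial>M) \<partial>M) = of_nat n * (\<integral>\<^sup>+x. pint M (h x) n \<eta> \<partial>M)"
    by (cases n) (simp_all add: sw del: pint.simps)
  also have "of_nat n * (\<integral>\<^sup>+x. pint M (h x) n \<eta> \<partial>M) + ((\<integral>\<^sup>+y. pint M (h y) n \<eta> \<partial>M) + (\<integral>\<^sup>+y. (\<Sum>x\<in>#\<eta>. pint M (h x) n (add_mset y (\<eta> - {#x#}))) \<partial>M))
     = of_nat (Suc n) * (\<integral>\<^sup>+x. pint M (h x) (Suc n - 1) \<eta> \<partial>M) + (\<Sum>x\<in>#\<eta>. pint M (h x) (Suc n) (\<eta> - {#x#}))"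
    unfolding sm(2) by (simp add: distrib_right ac_simps del: pint.simps)
  finally show ?case .
qed

lemma nn_integral_Po':
  assumes F: "F \<in> borel_measurable Nsp"
  shows "(\<integral>\<^sup>+\<xi>. F \<xi> \<partial>Po M) = ennreal (exp (- l)) * (\<Sum>n. ennreal (1 / fact n) * pint M F n {#})"
proof -
  have "ennreal (exp (- l) / fact n) * pint M F n {#} = ennreal (exp (- l)) * (ennreal (1 / fact n) * pint M F n {#})" for n
    by (simp add: ennreal_mult[symmetric] mult.assoc[symmetric])
  then show ?thesis unfolding nn_integral_Po[OF F] by simp
qed

lemma exp_cancel: "ennreal (exp l) * (ennreal (exp (- l)) * x) = x"
proof -
  have "ennreal (exp l) * ennreal (exp (- l)) = ennreal (exp l * exp (- l))" by (rule ennreal_mult[symmetric]) simp_all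
  then have "ennreal (exp l) * ennreal (exp (- l)) = 1" by (simp only: exp_minus_inverse ennreal_1)
  then show ?thesis by (simp only: mult.assoc[symmetric] mult_1)
qed

lemma prob_space_Po: "prob_space (Po M)"
proof
  have p: "pint M (\<lambda>_. 1) n \<eta> = ennreal (l ^ n)" for n \<eta>
    by (induction n arbitrary: \<eta>) (simp_all add: emeasure_eq_measure ennreal_mult mult.commute)
  have "(\<Sum>n. ennreal (1 / fact n) * pint M (\<lambda>_. 1) n {#}) = (\<Sum>n. ennreal (l ^ n /\<^sub>R fact n))"
    by (simp add: p ennreal_mult[symmetric] divide_inverse)
  also have "\<dots> = ennreal (exp l)"
    unfolding exp_def by (intro suminf_ennreal2 summable_exp_generic) simp
  finally have "(\<integral>\<^sup>+\<xi>. 1 \<partial>Po M) = ennreal (exp (- l)) * ennreal (exp l)"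
    by (subst nn_integral_Po') simp_all
  then show "emeasure (Po M) (space (Po M)) = 1"
    by (simp add: ennreal_mult[symmetric] exp_minus)
qed

text \<open>The n + 1 equal contributions turn 1 / (n + 1)! into 1 / n!, so after removal of the
  point the series is again the Poisson series.\<close>

lemma mecke_Po:
  assumes h: "(\<lambda>(x, \<xi>). h x \<xi>) \<in> borel_measurable (borel \<Otimes>\<^sub>M Nsp)"
  shows "(\<integral>\<^sup>+\<xi>. (\<Sum>x\<in>#\<xi>. h x (\<xi> - {#x#})) \<partial>Po M) = (\<integral>\<^sup>+x. (\<integral>\<^sup>+\<xi>. h x \<xi> \<partial>Po M) \<partial>M)"
proof -
  let ?H = "\<lambda>\<xi>. \<Sum>x\<in>#\<xi>. h x (\<xi> - {#x#})"
  note measurable_diff_single[measurable (raw)] h[measurable]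
  have H: "?H \<in> borel_measurable Nsp"
    by (rule measurable_sum_points) measurable
  have pm[measurable]: "(\<lambda>(x, \<xi>). pint M (h x) n \<xi>) \<in> borel_measurable (borel \<Otimes>\<^sub>M Nsp)" for n
    by (rule pint_measurable_param[OF h])
  have [measurable]: "h x \<in> borel_measurable Nsp" for x by measurable
  let ?c = "\<lambda>n. ennreal (1 / fact n)"
  have step: "?c (Suc n) * pint M ?H (Suc n) {#} = ?c n * (\<integral>\<^sup>+x. pint M (h x) n {#} \<partial>M)" for n
  proof -
    have "?c (Suc n) * of_nat (Suc n) = ?c n"
      by (simp add: ennreal_of_nat_eq_real_of_nat ennreal_mult[symmetric] del: of_nat_Suc)
    then show ?thesis by (simp add: pint_mecke[OF h] mult.assoc[symmetric] del: pint.simps of_nat_Suc)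
  qed
  have "(\<Sum>n. ?c n * pint M ?H n {#}) = (\<Sum>n. ?c (n + 1) * pint M ?H (n + 1) {#}) + (\<Sum>n<1. ?c n * pint M ?H n {#})"
    by (rule suminf_offset) simp
  also have "\<dots> = (\<Sum>n. ?c n * (\<integral>\<^sup>+x. pint M (h x) n {#} \<partial>M))" by (simp only: Suc_eq_plus1[symmetric] step) simp
  also have "\<dots> = (\<Sum>n. \<integral>\<^sup>+x. ?c n * pint M (h x) n {#} \<partial>M)"
    by (intro suminf_cong nn_integral_cmult[symmetric]) measurable
  also have "\<dots> = (\<integral>\<^sup>+x. (\<Sum>n. ?c n * pint M (h x) n {#}) \<partial>M)"
    by (rule nn_integral_suminf[symmetric]) measurable
  finally have "(\<integral>\<^sup>+\<xi>. ?H \<xi> \<partial>Po M) = ennreal (exp (- l)) * (\<integral>\<^sup>+x. (\<Sum>n. ?c n * pint M (h x) n {#}) \<partial>M)"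
    by (simp add: nn_integral_Po'[OF H])
  also have "\<dots> = (\<integral>\<^sup>+x. ennreal (exp (- l)) * (\<Sum>n. ?c n * pint M (h x) n {#}) \<partial>M)"
    by (rule nn_integral_cmult[symmetric]) measurable
  also have "\<dots> = (\<integral>\<^sup>+x. (\<integral>\<^sup>+\<xi>. h x \<xi> \<partial>Po M) \<partial>M)"
    by (intro nn_integral_cong nn_integral_Po'[symmetric]) measurable
  finally show ?thesis .
qed

text \<open>\<open>F (\<xi> + \<zeta>)\<close> with \<open>\<xi>\<close> confined to the complement of \<open>N\<close> and \<open>\<zeta>\<close> to \<open>N\<close>.\<close>

definition splitK :: "'a set \<Rightarrow> ('a multiset \<Rightarrow> ennreal) \<Rightarrow> 'a multiset \<Rightarrow> 'a multiset \<Rightarrow> ennreal" where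
  "splitK N F \<xi> \<zeta> = of_bool (cnt N \<xi> = 0) * of_bool (cnt (- N) \<zeta> = 0) * F (\<xi> + \<zeta>)"

lemma splitK_measurable:
  assumes N: "N \<in> sets borel" and F[measurable]: "F \<in> borel_measurable Nsp"
  shows "(\<lambda>(\<xi>, \<zeta>). splitK N F \<xi> \<zeta>) \<in> borel_measurable (Nsp \<Otimes>\<^sub>M Nsp)"
proof -
  note measurable_cnt[OF N, measurable (raw)] measurable_cnt[OF borel_comp[OF N], measurable (raw)]
  show ?thesis unfolding splitK_def by measurable
qed

text \<open>A binomial expansion, each added point falling inside or outside N. Starting from \<xi>
  and \<zeta> that already respect the two regions, the induction appends a new point to the side
  where it falls; the term for the other side vanishes, and Pascal's rule recombines the
  sum.\<close>

lemma pint_split: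
  assumes N: "N \<in> sets borel" and F: "F \<in> borel_measurable Nsp"
    and \<xi>: "cnt N \<xi> = 0" and \<zeta>: "cnt (- N) \<zeta> = 0"
  shows "pint M F m (\<xi> + \<zeta>) = (\<Sum>k\<le>m. of_nat (m choose k) * pint M (\<lambda>\<xi>'. pint M (splitK N F \<xi>') (m - k) \<zeta>) k \<xi>)"
  using \<xi> \<zeta>
proof (induction m arbitrary: \<xi> \<zeta>)
  case 0
  then show ?case by (simp add: splitK_def)
next
  case (Suc m)
  define D where "D k r \<xi> \<zeta> = pint M (\<lambda>\<xi>'. pint M (splitK N F \<xi>') r \<zeta>) k \<xi>" for k r \<xi> \<zeta>
  have Kp: "(\<lambda>(\<xi>', \<zeta>). pint M (splitK N F \<xi>') r \<zeta>) \<in> borel_measurable (Nsp \<Otimes>\<^sub>M Nsp)" for r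
    by (rule pint_measurable_param[OF splitK_measurable[OF N F]])
  note Kp[measurable]
  have Dm[measurable]: "(\<lambda>(\<zeta>, \<xi>). D k r \<xi> \<zeta>) \<in> borel_measurable (Nsp \<Otimes>\<^sub>M Nsp)" for k r
    unfolding D_def by (rule pint_measurable_param) measurable
  have D1: "D (Suc k) r \<xi> \<zeta> = (\<integral>\<^sup>+x. D k r (add_mset x \<xi>) \<zeta> \<partial>M)" for k r \<xi> \<zeta>
    by (simp add: D_def)
  have D2: "D k (Suc r) \<xi> \<zeta> = (\<integral>\<^sup>+x. D k r \<xi> (add_mset x \<zeta>) \<partial>M)" for k r \<xi> \<zeta>
    unfolding D_def pint.simps by (rule pint_swap) measurable
  \<comment> \<open>A point in the wrong region stays in every larger configuration, so the
    indicator in \<open>splitK\<close> is 0 throughout.\<close>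
  have Z1: "D k r \<xi> \<zeta> = 0" if "cnt N \<xi> \<noteq> 0" for k r \<xi> \<zeta>
  proof -
    have "D k r \<xi> \<zeta> = pint M (\<lambda>_. 0) k \<xi>" unfolding D_def
    proof (rule pint_cong_on)
      fix \<xi>' assume "\<xi> \<subseteq># \<xi>'"
      then obtain \<theta> where "\<xi>' = \<xi> + \<theta>" by (metis subset_mset.less_eqE)
      then have "splitK N F \<xi>' = (\<lambda>_. 0)" using that by (auto simp: splitK_def)
      then show "pint M (splitK N F \<xi>') r \<zeta> = 0" by simp
    qed
    then show ?thesis by simp
  qed
  have Z2: "D k r \<xi> \<zeta> = 0" if "cnt (- N) \<zeta> \<noteq> 0" for k r \<xi> \<zeta>
  proof -
    have "pint M (splitK N F \<xi>') r \<zeta> = pint M (\<lambda>_. 0) r \<zeta>" for \<xi>'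
    proof (rule pint_cong_on)
      fix \<zeta>' assume "\<zeta> \<subseteq># \<zeta>'"
      then obtain \<theta> where "\<zeta>' = \<zeta> + \<theta>" by (metis subset_mset.less_eqE)
      then show "splitK N F \<xi>' \<zeta>' = 0" using that by (auto simp: splitK_def)
    qed
    then show ?thesis by (simp add: D_def)
  qed
  have "pint M F (Suc m) (\<xi> + \<zeta>) = (\<integral>\<^sup>+x. (\<Sum>k\<le>m. of_nat (m choose k) * (D k (m - k) (add_mset x \<xi>) \<zeta> + D k (m - k) \<xi> (add_mset x \<zeta>))) \<partial>M)"
    unfolding pint.simps
  proof (intro nn_integral_cong)
    fix x
    show "pint M F m (add_mset x (\<xi> + \<zeta>)) = (\<Sum>k\<le>m. of_nat (m choose k) * (D k (m - k) (add_mset x \<xi>) \<zeta> + D k (m - k) \<xi> (add_mset x \<zeta>)))"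
    proof (cases "x \<in> N")
      case True
      then have "D k (m - k) (add_mset x \<xi>) \<zeta> = 0" for k by (intro Z1) simp
      moreover have "pint M F m (\<xi> + add_mset x \<zeta>) = (\<Sum>k\<le>m. of_nat (m choose k) * D k (m - k) \<xi> (add_mset x \<zeta>))"
        unfolding D_def by (rule Suc.IH) (use Suc.prems True in auto)
      ultimately show ?thesis by simp
    next
      case False
      then have "D k (m - k) \<xi> (add_mset x \<zeta>) = 0" for k by (intro Z2) simp
      moreover have "pint M F m (add_mset x \<xi> + \<zeta>) = (\<Sum>k\<le>m. of_nat (m choose k) * D k (m - k) (add_mset x \<xi>) \<zeta>)"
        unfolding D_def by (rule Suc.IH) (use Suc.prems False in auto)
      ultimately show ?thesis by simp
    qed
  qed
  also have "\<dots> = (\<Sum>k\<le>m. of_nat (m choose k) * (D (Suc k) (m - k) \<xi> \<zeta> + D k (Suc (m - k)) \<xi> \<zeta>))"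
  proof -
    have "(\<integral>\<^sup>+x. of_nat (m choose k) * (D k (m - k) (add_mset x \<xi>) \<zeta> + D k (m - k) \<xi> (add_mset x \<zeta>)) \<partial>M)
       = of_nat (m choose k) * (D (Suc k) (m - k) \<xi> \<zeta> + D k (Suc (m - k)) \<xi> \<zeta>)" for k
      unfolding D1 D2 by (subst nn_integral_cmult, measurable) (subst nn_integral_add, measurable)
    then show ?thesis by (subst nn_integral_sum) auto
  qed
  also have "\<dots> = (\<Sum>k\<le>m. of_nat (m choose k) * D (Suc k) (m - k) \<xi> \<zeta>) + (\<Sum>k\<le>m. of_nat (m choose k) * D k (Suc m - k) \<xi> \<zeta>)"
    by (simp add: distrib_left sum.distrib Suc_diff_le)
  also have "(\<Sum>k\<le>m. of_nat (m choose k) * D k (Suc m - k) \<xi> \<zeta>) = (\<Sum>k\<le>Suc m. of_nat (m choose k) * D k (Suc m - k) \<xi> \<zeta>)"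
    by (simp add: binomial_eq_0)
  also have "\<dots> = D 0 (Suc m) \<xi> \<zeta> + (\<Sum>k\<le>m. of_nat (m choose Suc k) * D (Suc k) (m - k) \<xi> \<zeta>)"
    by (subst sum.atMost_Suc_shift) simp
  also have "(\<Sum>k\<le>m. of_nat (m choose k) * D (Suc k) (m - k) \<xi> \<zeta>) + (D 0 (Suc m) \<xi> \<zeta> + (\<Sum>k\<le>m. of_nat (m choose Suc k) * D (Suc k) (m - k) \<xi> \<zeta>))
     = (\<Sum>k\<le>Suc m. of_nat (Suc m choose k) * D k (Suc m - k) \<xi> \<zeta>)"
    by (subst sum.atMost_Suc_shift) (simp add: distrib_right sum.distrib add.commute add.left_commute)
  finally show ?case unfolding D_def .
qed

text \<open>Independence of the restrictions to N and to its complement. Both copies are full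
  Poisson processes, forced by indicators to avoid one region each; these two events have joint
  probability exp(-l), which the factor \<open>exp l\<close> undoes.\<close>

lemma split_Po:
  assumes N: "N \<in> sets borel" and F: "F \<in> borel_measurable Nsp"
  shows "(\<integral>\<^sup>+\<xi>. F \<xi> \<partial>Po M) = ennreal (exp l) * (\<integral>\<^sup>+\<xi>. (\<integral>\<^sup>+\<zeta>. splitK N F \<xi> \<zeta> \<partial>Po M) \<partial>Po M)"
proof -
  let ?c = "\<lambda>n. ennreal (1 / fact n)"
  let ?D = "\<lambda>k r. pint M (\<lambda>\<xi>'. pint M (splitK N F \<xi>') r {#}) k {#}"
  have Kp[measurable]: "(\<lambda>(\<xi>', \<zeta>). pint M (splitK N F \<xi>') r \<zeta>) \<in> borel_measurable (Nsp \<Otimes>\<^sub>M Nsp)" for r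
    by (rule pint_measurable_param[OF splitK_measurable[OF N F]])
  have Km: "splitK N F \<xi> \<in> borel_measurable Nsp" for \<xi>
    using measurable_compose[OF measurable_Pair1' splitK_measurable[OF N F], of \<xi>] by simp
  have trm: "?c m * pint M F m {#} = (\<Sum>k\<le>m. ?c k * (?c (m - k) * ?D k (m - k)))" for m
  proof -
    have "pint M F m {#} = (\<Sum>k\<le>m. of_nat (m choose k) * ?D k (m - k))"
      using pint_split[OF N F, of "{#}" "{#}" m] by simp
    moreover have "?c m * of_nat (m choose k) = ?c k * ?c (m - k)" if "k \<le> m" for k
      using that by (simp add: ennreal_of_nat_eq_real_of_nat ennreal_mult[symmetric] binomial_fact)
    ultimately show ?thesis by (simp add: sum_distrib_left mult.assoc[symmetric])
  qed
  have "(\<integral>\<^sup>+\<xi>. F \<xi> \<partial>Po M) = ennreal (exp (- l)) * (\<Sum>m. \<Sum>k\<le>m. ?c k * (?c (m - k) * ?D k (m - k)))"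
    by (simp only: nn_integral_Po'[OF F] trm)
  also have "(\<Sum>m. \<Sum>k\<le>m. ?c k * (?c (m - k) * ?D k (m - k))) = (\<Sum>k. \<Sum>r. ?c k * (?c r * ?D k r))"
    by (rule suminf_cauchy_ennreal[of "\<lambda>k r. ?c k * (?c r * ?D k r)"])
  also have "(\<Sum>k. \<Sum>r. ?c k * (?c r * ?D k r)) = (\<Sum>k. ?c k * pint M (\<lambda>\<xi>'. \<Sum>r. ?c r * pint M (splitK N F \<xi>') r {#}) k {#})"
    by (simp add: pint_suminf pint_cmult)
  also have "ennreal (exp (- l)) * \<dots> = (\<integral>\<^sup>+\<xi>. (\<Sum>r. ?c r * pint M (splitK N F \<xi>) r {#}) \<partial>Po M)"
    by (rule nn_integral_Po'[symmetric]) measurable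
  also have "\<dots> = (\<integral>\<^sup>+\<xi>. ennreal (exp l) * (\<integral>\<^sup>+\<zeta>. splitK N F \<xi> \<zeta> \<partial>Po M) \<partial>Po M)"
    by (simp add: nn_integral_Po'[OF Km] exp_cancel)
  also have "\<dots> = ennreal (exp l) * (\<integral>\<^sup>+\<xi>. (\<integral>\<^sup>+\<zeta>. splitK N F \<xi> \<zeta> \<partial>Po M) \<partial>Po M)"
  proof (rule nn_integral_cmult)
    interpret Po: prob_space "Po M" by (rule prob_space_Po)
    show "(\<lambda>\<xi>. \<integral>\<^sup>+\<zeta>. splitK N F \<xi> \<zeta> \<partial>Po M) \<in> borel_measurable (Po M)"
      by (rule Po.borel_measurable_nn_integral) (use splitK_measurable[OF N F] in measurable)
  qed
  finally show ?thesis .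
qed

end

section \<open>Janossy densities\<close>

locale janossy_process = neighborhoods X Nb + finite_borel X M
  for X :: "'a::metric_space itself" and Nb and M +
  fixes P :: "'a multiset measure" and j :: "nat \<Rightarrow> (nat \<Rightarrow> 'a) \<Rightarrow> real"
  assumes P_prob: "prob_space P" and sets_P [measurable_cong]: "sets P = sets Nsp"
    and size_fin: "(\<integral>\<^sup>+\<xi>. ennreal (real (size \<xi>)) \<partial>P) \<noteq> \<infinity>"
    and jan: "janossy P M j" and her: "hereditary j"
begin

sublocale P: prob_space P by (rule P_prob)

sublocale Po: prob_space "Po M" by (rule prob_space_Po)

text \<open>All Janossy densities in one function of the configuration; the enumeration is
  immaterial by their symmetry. Up to the factor \<open>exp l\<close> it is the density of P with
  respect to the Poisson process.\<close>

definition J :: "'a multiset \<Rightarrow> ennreal" where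
  "J \<xi> = ennreal (j (size \<xi>) (vec_of (list_of \<xi>)))"

lemma j_sym: "xs \<in> extensional {..<n} \<Longrightarrow> \<pi> permutes {..<n} \<Longrightarrow> j n (restrict (xs \<circ> \<pi>) {..<n}) = j n xs"
  and j_meas: "j n \<in> borel_measurable (PiM {..<n} (\<lambda>_. M))" and j_nonneg: "0 \<le> j n xs"
  using jan by (auto simp: janossy_def)

lemma vec_of_extensional: "vec_of us \<in> extensional {..<length us}"
  by (simp add: vec_of_def)

lemma j_mset_eq:
  assumes "mset us = mset vs"
  shows "j (length us) (vec_of us) = j (length vs) (vec_of vs)"
proof -
  obtain \<pi> where \<pi>: "\<pi> permutes {..<length vs}" "permute_list \<pi> vs = us"
    using mset_eq_permutation[OF assms] by blast
  have len: "length us = length vs" using assms by (rule mset_eq_length)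
  have "vec_of us = restrict (vec_of vs \<circ> \<pi>) {..<length vs}"
  proof
    fix i
    show "vec_of us i = restrict (vec_of vs \<circ> \<pi>) {..<length vs} i"
      using permute_list_nth[of \<pi> vs i] \<pi> permutes_in_image[OF \<pi>(1), of i] len by (simp add: vec_of_def)
  qed
  then show ?thesis using j_sym[OF vec_of_extensional \<pi>(1)] len by simp
qed

lemma J_mset: "J (mset us) = ennreal (j (length us) (vec_of us))"
  using j_mset_eq[of "list_of (mset us)" us] by (simp add: J_def) (metis mset_list_of size_mset)

lemma J_vmset: "J (vmset n v) = ennreal (j n (restrict v {..<n}))"
  unfolding vmset_def J_mset vec_of_map_upt by simp

lemma J_measurable [measurable]: "J \<in> borel_measurable Nsp"
proof (rule measurable_by_vectors')
  fix n
  have "(\<lambda>v. ennreal (j n v)) \<in> borel_measurable (PiM {..<n} (\<lambda>_. M))" using j_meas by measurable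
  also have "borel_measurable (PiM {..<n} (\<lambda>_. M)) = borel_measurable (PiM {..<n} (\<lambda>_. borel))"
    by (intro measurable_cong_sets sets_PiM_cong refl) (simp add: sets_M)
  finally show "(\<lambda>v. J (vmset n v)) \<in> borel_measurable (PiM {..<n} (\<lambda>_. borel))"
    by (rule measurable_cong[THEN iffD1, rotated])
       (auto simp: J_vmset space_PiM PiE_def extensional_restrict)
qed

lemma J_heredity: "J \<xi> = 0 \<Longrightarrow> J (add_mset x \<xi>) = 0"
proof -
  assume J0: "J \<xi> = 0"
  obtain us where us: "mset us = \<xi>" using ex_mset by blast
  have "j (length us) (vec_of us) = 0"
    using J0 j_nonneg[of "length us" "vec_of us"] unfolding us[symmetric] J_mset by (simp add: ennreal_eq_0_iff)
  then have "j (Suc (length us)) ((vec_of us)(length us := x)) = 0"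
    using her vec_of_extensional[of us] unfolding hereditary_def by blast
  also have "(vec_of us)(length us := x) = vec_of (us @ [x])"
    by (auto simp: vec_of_def fun_eq_iff nth_append)
  finally show "J (add_mset x \<xi>) = 0"
    using J_mset[of "us @ [x]"] by (simp add: us)
qed

text \<open>The factors 1 / n! are common to the Janossy and the Poisson series, so only the
  normalisation exp(-l) has to be undone.\<close>

lemma janossy_integral:
  assumes F: "F \<in> borel_measurable Nsp"
  shows "(\<integral>\<^sup>+\<xi>. F \<xi> \<partial>P) = ennreal (exp l) * (\<integral>\<^sup>+\<xi>. J \<xi> * F \<xi> \<partial>Po M)"
proof -
  note F[measurable]
  have JF: "(\<lambda>\<xi>. J \<xi> * F \<xi>) \<in> borel_measurable Nsp" by measurable
  have jJ: "ennreal (j n v) = J (vmset n v)" if "v \<in> space (PiM {..<n} (\<lambda>_. M))" for n v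
    using that by (auto simp: J_vmset space_PiM PiE_def extensional_restrict)
  have [measurable]: "(\<lambda>v. ennreal (j n v)) \<in> borel_measurable (PiM {..<n} (\<lambda>_. M))" for n
    using j_meas by measurable
  have "(\<integral>\<^sup>+\<xi>. F \<xi> \<partial>P) = (\<Sum>n. \<integral>\<^sup>+v. (ennreal (1 / fact n) * ennreal (j n v)) * F (vmset n v) \<partial>PiM {..<n} (\<lambda>_. M))"
  proof (rule nn_integral_by_size[OF sets_P sets_M _ _ F])
    fix n and B :: "'a multiset set" assume B[measurable]: "B \<in> sets Nsp"
    have "emeasure P {\<xi> \<in> B. size \<xi> = n} = ennreal (1 / fact n) * (\<integral>\<^sup>+v. ennreal (j n v) * indicator B (vmset n v) \<partial>PiM {..<n} (\<lambda>_. M))"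
      using jan B by (simp add: janossy_def)
    also have "\<dots> = (\<integral>\<^sup>+v. ennreal (1 / fact n) * (ennreal (j n v) * indicator B (vmset n v)) \<partial>PiM {..<n} (\<lambda>_. M))"
      by (rule nn_integral_cmult[symmetric]) measurable
    finally show "emeasure P {\<xi> \<in> B. size \<xi> = n} = (\<integral>\<^sup>+v. ennreal (1 / fact n) * ennreal (j n v) * indicator B (vmset n v) \<partial>PiM {..<n} (\<lambda>_. M))"
      by (simp only: mult.assoc)
  qed measurable
  also have "\<dots> = (\<Sum>n. ennreal (1 / fact n) * pint M (\<lambda>\<xi>. J \<xi> * F \<xi>) n {#})"
  proof (intro suminf_cong)
    fix n
    have "(\<integral>\<^sup>+v. (ennreal (1 / fact n) * ennreal (j n v)) * F (vmset n v) \<partial>PiM {..<n} (\<lambda>_. M))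
       = (\<integral>\<^sup>+v. ennreal (1 / fact n) * (J (vmset n v) * F (vmset n v)) \<partial>PiM {..<n} (\<lambda>_. M))"
      by (intro nn_integral_cong) (simp add: jJ mult.assoc)
    also have "\<dots> = ennreal (1 / fact n) * (\<integral>\<^sup>+v. J (vmset n v) * F (vmset n v) \<partial>PiM {..<n} (\<lambda>_. M))"
      by (rule nn_integral_cmult) measurable
    finally show "(\<integral>\<^sup>+v. (ennreal (1 / fact n) * ennreal (j n v)) * F (vmset n v) \<partial>PiM {..<n} (\<lambda>_. M)) = ennreal (1 / fact n) * pint M (\<lambda>\<xi>. J \<xi> * F \<xi>) n {#}"
      using nn_integral_vmset[OF JF, of n "{#}"] by simp
  qed
  also have "\<dots> = ennreal (exp l) * (\<integral>\<^sup>+\<xi>. J \<xi> * F \<xi> \<partial>Po M)"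
    by (simp add: nn_integral_Po'[OF JF] exp_cancel)
  finally show ?thesis .
qed

text \<open>The denominator of \<open>gcond\<close>; adding \<open>x\<close> to \<open>\<xi>\<close> gives the numerator.\<close>

definition D :: "'a \<Rightarrow> 'a multiset \<Rightarrow> ennreal" where
  "D x \<xi> = ennreal (exp l) * (\<integral>\<^sup>+\<zeta>. of_bool (cnt (- Nb x) \<zeta> = 0) * J (\<xi> + \<zeta>) \<partial>Po M)"

lemma cnt_compl_rho: "cnt (- Nb x) \<zeta> = size (rho x \<zeta>)"
  by (simp add: cnt_def restr_def)

lemma D_measurable [measurable (raw)]:
  assumes [measurable]: "f \<in> N \<rightarrow>\<^sub>M borel" "g \<in> N \<rightarrow>\<^sub>M Nsp"
  shows "(\<lambda>w. D (f w) (g w)) \<in> borel_measurable N"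
proof -
  note sets_Po[measurable_cong]
  have [measurable]: "(\<lambda>w. \<integral>\<^sup>+\<zeta>. of_bool (cnt (- Nb (f w)) \<zeta> = 0) * J (g w + \<zeta>) \<partial>Po M) \<in> borel_measurable N"
    unfolding cnt_compl_rho by (rule Po.borel_measurable_nn_integral) measurable
  show ?thesis unfolding D_def by measurable
qed

text \<open>The series over powers of the neighbourhood is a Poisson integral over configurations
  lying inside it, which brings the Poisson identities to bear on \<open>gcond\<close>.\<close>

lemma jan_sum_eq: "jan_sum j M (Nb x) us = D x (mset us)"
proof -
  let ?F = "\<lambda>\<zeta>. of_bool (cnt (- Nb x) \<zeta> = 0) * J (mset us + \<zeta>)"
  have F: "?F \<in> borel_measurable Nsp" unfolding cnt_compl_rho by measurable
  have "(\<integral>\<^sup>+ys. ennreal (j (length us + n) (vec_of (us @ map ys [0..<n]))) * indicator (PiE {..<n} (\<lambda>_. Nb x)) ys \<partial>PiM {..<n} (\<lambda>_. M))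
    = pint M ?F n {#}" for n
  proof -
    have "(\<integral>\<^sup>+ys. ennreal (j (length us + n) (vec_of (us @ map ys [0..<n]))) * indicator (PiE {..<n} (\<lambda>_. Nb x)) ys \<partial>PiM {..<n} (\<lambda>_. M))
      = (\<integral>\<^sup>+v. ?F (vmset n v + {#}) \<partial>PiM {..<n} (\<lambda>_. M))"
    proof (rule nn_integral_cong)
      fix v assume v: "v \<in> space (PiM {..<n} (\<lambda>_. M))"
      have "cnt (- Nb x) (vmset n v) = 0 \<longleftrightarrow> (\<forall>y\<in>#vmset n v. y \<in> Nb x)"
        using cnt_pos_iff[of "- Nb x" "vmset n v"] by auto
      also have "\<dots> \<longleftrightarrow> v \<in> PiE {..<n} (\<lambda>_. Nb x)" using v by (auto simp: vmset_def space_PiM PiE_def)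
      finally have "indicator (PiE {..<n} (\<lambda>_. Nb x)) v = (of_bool (cnt (- Nb x) (vmset n v) = 0) :: ennreal)"
        by (simp add: indicator_def)
      moreover have "J (mset us + vmset n v) = ennreal (j (length us + n) (vec_of (us @ map v [0..<n])))"
        using J_mset[of "us @ map v [0..<n]"] by (simp add: vmset_def)
      ultimately show "ennreal (j (length us + n) (vec_of (us @ map v [0..<n]))) * indicator (PiE {..<n} (\<lambda>_. Nb x)) v = ?F (vmset n v + {#})"
        by (simp add: mult.commute)
    qed
    then show ?thesis by (simp only: nn_integral_vmset[OF F])
  qed
  then show ?thesis unfolding jan_sum_def D_def nn_integral_Po'[OF F] by (simp only: exp_cancel)
qed

lemma gcond_eq: "gcond j M Nb x \<xi> = (if D x \<xi> = 0 then 0 else enn2real (D x (add_mset x \<xi>) / D x \<xi>))"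
  by (simp add: gcond_def Let_def jan_sum_eq)

lemma gcond_measurable [measurable (raw)]:
  assumes [measurable]: "f \<in> N \<rightarrow>\<^sub>M borel" "g \<in> N \<rightarrow>\<^sub>M Nsp"
  shows "(\<lambda>w. gcond j M Nb (f w) (g w)) \<in> borel_measurable N"
  unfolding gcond_eq by measurable

lemma gcond_nonneg: "0 \<le> gcond j M Nb x \<xi>"
  by (simp add: gcond_eq)

text \<open>If the denominator vanishes then \<open>J\<close> vanishes for almost all completions
  inside the neighbourhood, and heredity passes this on when x is added: the convention 0/0 = 0
  loses no mass.\<close>

lemma D_zero:
  assumes "D x \<xi> = 0"
  shows "D x (add_mset x \<xi>) = 0"
proof -
  note sets_Po[measurable_cong]
  have m: "(\<lambda>\<zeta>. of_bool (cnt (- Nb x) \<zeta> = 0) * J (\<theta> + \<zeta>)) \<in> borel_measurable (Po M)" for \<theta>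
    unfolding cnt_compl_rho by measurable
  have "(\<integral>\<^sup>+\<zeta>. of_bool (cnt (- Nb x) \<zeta> = 0) * J (\<xi> + \<zeta>) \<partial>Po M) = 0"
    using assms by (auto simp: D_def)
  then have "AE \<zeta> in Po M. of_bool (cnt (- Nb x) \<zeta> = 0) * J (\<xi> + \<zeta>) = 0"
    by (subst (asm) nn_integral_0_iff_AE[OF m])
  then have "AE \<zeta> in Po M. of_bool (cnt (- Nb x) \<zeta> = 0) * J (add_mset x \<xi> + \<zeta>) = 0"
    by eventually_elim (auto simp: J_heredity)
  then have "(\<integral>\<^sup>+\<zeta>. of_bool (cnt (- Nb x) \<zeta> = 0) * J (add_mset x \<xi> + \<zeta>) \<partial>Po M) = 0"
    by (subst nn_integral_0_iff_AE[OF m])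
  then show ?thesis by (simp add: D_def)
qed

lemma rho_union:
  assumes "cnt (Nb x) \<xi> = 0" "cnt (- Nb x) \<zeta> = 0"
  shows "rho x (\<xi> + \<zeta>) = \<xi>"
proof -
  have "rho x \<zeta> = {#}" using assms(2) by (simp add: cnt_compl_rho)
  moreover have "filter_mset (\<lambda>y. y \<in> Nb x) \<xi> = {#}" using assms(1) by (simp add: cnt_def)
  then have "rho x \<xi> = \<xi>" using rho_split[of \<xi> x] by (metis add.right_neutral)
  ultimately show ?thesis by (simp add: restr_def)
qed

text \<open>Integrating out the points inside the neighbourhood produces \<open>D\<close>. The
  argument \<open>z\<close> is empty for the denominator of \<open>gcond\<close> and
  \<open>{#x#}\<close> for its numerator.\<close>

lemma split_J:
  assumes q: "q \<in> borel_measurable Nsp"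
  shows "(\<integral>\<^sup>+\<theta>. J (z + \<theta>) * q (rho x \<theta>) \<partial>Po M) = (\<integral>\<^sup>+\<xi>. of_bool (cnt (Nb x) \<xi> = 0) * q \<xi> * D x (z + \<xi>) \<partial>Po M)"
proof -
  note sets_Po[measurable_cong] q[measurable]
  let ?F = "\<lambda>\<theta>. J (z + \<theta>) * q (rho x \<theta>)"
  have F: "?F \<in> borel_measurable Nsp" by measurable
  have Jm: "(\<lambda>\<zeta>. of_bool (cnt (- Nb x) \<zeta> = 0) * J (\<xi> + \<zeta>)) \<in> borel_measurable (Po M)" for \<xi>
    unfolding cnt_compl_rho by measurable
  have cm[measurable]: "(\<lambda>\<xi>. cnt (Nb x) \<xi>) \<in> Nsp \<rightarrow>\<^sub>M count_space UNIV"
    by (rule measurable_cnt) measurable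
  have inner: "ennreal (exp l) * (\<integral>\<^sup>+\<zeta>. splitK (Nb x) ?F \<xi> \<zeta> \<partial>Po M) = of_bool (cnt (Nb x) \<xi> = 0) * q \<xi> * D x (z + \<xi>)" for \<xi>
  proof -
    have "(\<integral>\<^sup>+\<zeta>. splitK (Nb x) ?F \<xi> \<zeta> \<partial>Po M) = (\<integral>\<^sup>+\<zeta>. (of_bool (cnt (Nb x) \<xi> = 0) * q \<xi>) * (of_bool (cnt (- Nb x) \<zeta> = 0) * J ((z + \<xi>) + \<zeta>)) \<partial>Po M)"
      by (intro nn_integral_cong) (auto simp: splitK_def rho_union mult.commute mult.left_commute add.assoc)
    also have "\<dots> = of_bool (cnt (Nb x) \<xi> = 0) * q \<xi> * (\<integral>\<^sup>+\<zeta>. of_bool (cnt (- Nb x) \<zeta> = 0) * J ((z + \<xi>) + \<zeta>) \<partial>Po M)"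
      by (rule nn_integral_cmult[OF Jm])
    finally show ?thesis by (simp add: D_def ac_simps)
  qed
  have "(\<integral>\<^sup>+\<theta>. ?F \<theta> \<partial>Po M) = ennreal (exp l) * (\<integral>\<^sup>+\<xi>. (\<integral>\<^sup>+\<zeta>. splitK (Nb x) ?F \<xi> \<zeta> \<partial>Po M) \<partial>Po M)"
    by (rule split_Po[OF Nb_sets F])
  also have "\<dots> = (\<integral>\<^sup>+\<xi>. ennreal (exp l) * (\<integral>\<^sup>+\<zeta>. splitK (Nb x) ?F \<xi> \<zeta> \<partial>Po M) \<partial>Po M)"
  proof (rule nn_integral_cmult[symmetric])
    show "(\<lambda>\<xi>. \<integral>\<^sup>+\<zeta>. splitK (Nb x) ?F \<xi> \<zeta> \<partial>Po M) \<in> borel_measurable (Po M)"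
      by (rule Po.borel_measurable_nn_integral) (use splitK_measurable[OF Nb_sets F] in measurable)
  qed
  finally show ?thesis by (simp only: inner)
qed

text \<open>A change of measure to the Poisson process, removal of the point summed over by the
  Mecke formula, and integration over the points near x.\<close>

lemma campbell_density:
  assumes w: "(\<lambda>(x, \<xi>). w x \<xi>) \<in> borel_measurable (borel \<Otimes>\<^sub>M Nsp)"
  shows "(\<integral>\<^sup>+\<xi>. (\<Sum>x\<in>#\<xi>. w x (rho x \<xi>)) \<partial>P)
    = ennreal (exp l) * (\<integral>\<^sup>+x. (\<integral>\<^sup>+\<xi>. of_bool (cnt (Nb x) \<xi> = 0) * w x \<xi> * D x (add_mset x \<xi>) \<partial>Po M) \<partial>M)"
proof -
  note w[measurable] sets_Po[measurable_cong]
  define h where "h x \<xi> = J (add_mset x \<xi>) * w x (rho x \<xi>)" for x \<xi>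
  have h: "(\<lambda>(x, \<xi>). h x \<xi>) \<in> borel_measurable (borel \<Otimes>\<^sub>M Nsp)" unfolding h_def by measurable
  have "(\<integral>\<^sup>+\<xi>. (\<Sum>x\<in>#\<xi>. w x (rho x \<xi>)) \<partial>P) = ennreal (exp l) * (\<integral>\<^sup>+\<xi>. J \<xi> * (\<Sum>x\<in>#\<xi>. w x (rho x \<xi>)) \<partial>Po M)"
    by (rule janossy_integral) (rule measurable_sum_points, measurable)
  also have "(\<integral>\<^sup>+\<xi>. J \<xi> * (\<Sum>x\<in>#\<xi>. w x (rho x \<xi>)) \<partial>Po M) = (\<integral>\<^sup>+\<xi>. (\<Sum>x\<in>#\<xi>. h x (\<xi> - {#x#})) \<partial>Po M)"
  proof (rule nn_integral_cong)
    fix \<xi>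
    have "J \<xi> * w x (rho x \<xi>) = h x (\<xi> - {#x#})" if "x \<in># \<xi>" for x
    proof -
      from that obtain \<zeta> where "\<xi> = add_mset x \<zeta>" by (rule mset_add)
      then show ?thesis by (simp add: h_def)
    qed
    then show "J \<xi> * (\<Sum>x\<in>#\<xi>. w x (rho x \<xi>)) = (\<Sum>x\<in>#\<xi>. h x (\<xi> - {#x#}))"
      by (simp add: sum_mset_distrib_left cong: image_mset_cong)
  qed
  also have "\<dots> = (\<integral>\<^sup>+x. (\<integral>\<^sup>+\<xi>. h x \<xi> \<partial>Po M) \<partial>M)" by (rule mecke_Po[OF h])
  also have "\<dots> = (\<integral>\<^sup>+x. (\<integral>\<^sup>+\<xi>. of_bool (cnt (Nb x) \<xi> = 0) * w x \<xi> * D x (add_mset x \<xi>) \<partial>Po M) \<partial>M)"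
  proof (rule nn_integral_cong)
    fix x
    have "w x \<in> borel_measurable Nsp" by measurable
    from split_J[OF this, of "{#x#}" x]
    show "(\<integral>\<^sup>+\<xi>. h x \<xi> \<partial>Po M) = (\<integral>\<^sup>+\<xi>. of_bool (cnt (Nb x) \<xi> = 0) * w x \<xi> * D x (add_mset x \<xi>) \<partial>Po M)"
      by (simp add: h_def)
  qed
  finally show ?thesis .
qed

lemma cnt_Nb_measurable [measurable]: "(\<lambda>(x, \<xi>). cnt (Nb x) \<xi>) \<in> borel \<Otimes>\<^sub>M Nsp \<rightarrow>\<^sub>M count_space UNIV"
proof -
  have "cnt (Nb x) \<xi> = size \<xi> - size (rho x \<xi>)" for x \<xi> using size_rho[of \<xi> x] by simp
  then show ?thesis by simp
qed

text \<open>Times \<open>exp l\<close>, the integral is the total mass 1 of P. Finiteness is needed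
  to cancel \<open>D\<close> against the quotient in \<open>gcond\<close>.\<close>

lemma D_finite_AE: "AE \<xi> in Po M. of_bool (cnt (Nb x) \<xi> = 0) * D x \<xi> \<noteq> \<infinity>"
proof (rule nn_integral_PInf_AE)
  note sets_Po[measurable_cong]
  show "(\<lambda>\<xi>. of_bool (cnt (Nb x) \<xi> = 0) * D x \<xi>) \<in> borel_measurable (Po M)" by measurable
  have "ennreal (exp l) * (\<integral>\<^sup>+\<xi>. of_bool (cnt (Nb x) \<xi> = 0) * D x \<xi> \<partial>Po M) = (\<integral>\<^sup>+\<xi>. 1 \<partial>P)"
    using split_J[of "\<lambda>_. 1" "{#}" x] by (simp add: janossy_integral[of "\<lambda>_. 1"] del: nn_integral_const)
  also have "\<dots> = 1" by (simp add: P.emeasure_space_1)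
  finally show "(\<integral>\<^sup>+\<xi>. of_bool (cnt (Nb x) \<xi> = 0) * D x \<xi> \<partial>Po M) \<noteq> \<infinity>"
    by (auto simp: ennreal_mult_eq_top_iff ennreal_mult_top)
qed

text \<open>Here the integral is, up to the factor \<open>exp l\<close>, the expected number of
  points. An infinite numerator would be turned into 0 by \<open>enn2real\<close>.\<close>

lemma D_add_finite_AE: "AE x in M. AE \<xi> in Po M. of_bool (cnt (Nb x) \<xi> = 0) * D x (add_mset x \<xi>) \<noteq> \<infinity>"
proof -
  note sets_Po[measurable_cong]
  let ?I = "\<lambda>x. \<integral>\<^sup>+\<xi>. of_bool (cnt (Nb x) \<xi> = 0) * D x (add_mset x \<xi>) \<partial>Po M"
  have I: "?I \<in> borel_measurable M" by (rule Po.borel_measurable_nn_integral) measurable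
  have "ennreal (exp l) * (\<integral>\<^sup>+x. ?I x \<partial>M) = (\<integral>\<^sup>+\<xi>. (\<Sum>x\<in>#\<xi>. 1) \<partial>P)"
    using campbell_density[of "\<lambda>_ _. 1"] by simp
  also have "\<dots> \<noteq> \<infinity>" using size_fin by (simp add: ennreal_of_nat_eq_real_of_nat)
  finally have "(\<integral>\<^sup>+x. ?I x \<partial>M) \<noteq> \<infinity>" by (auto simp: ennreal_mult_eq_top_iff ennreal_mult_top)
  from nn_integral_PInf_AE[OF I this] show ?thesis
  proof eventually_elim
    case (elim x)
    show ?case by (rule nn_integral_PInf_AE[OF _ elim]) measurable
  qed
qed

text \<open>The conditional counterpart of the Palm formula: given the points away from x, a point
  at x has density \<open>gcond\<close>. Both sides become integrals against \<open>D\<close>,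
  because \<open>gcond\<close> times \<open>D x \<xi>\<close> is
  \<open>D x (add_mset x \<xi>)\<close> almost everywhere.\<close>

lemma campbell_gcond:
  assumes w: "(\<lambda>(x, \<xi>). w x \<xi>) \<in> borel_measurable (borel \<Otimes>\<^sub>M Nsp)"
  shows "(\<integral>\<^sup>+\<xi>. (\<Sum>x\<in>#\<xi>. w x (rho x \<xi>)) \<partial>P)
    = (\<integral>\<^sup>+\<xi>. (\<integral>\<^sup>+x. w x (rho x \<xi>) * ennreal (gcond j M Nb x (rho x \<xi>)) \<partial>M) \<partial>P)"
proof -
  interpret PM: pair_sigma_finite P M by (intro pair_sigma_finite.intro sigma_finite_measure_axioms P.sigma_finite_measure_axioms)
  note w[measurable] sets_Po[measurable_cong]
  let ?g = "\<lambda>x \<xi>. ennreal (gcond j M Nb x \<xi>)"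
  have "(\<integral>\<^sup>+\<xi>. (\<integral>\<^sup>+x. w x (rho x \<xi>) * ?g x (rho x \<xi>) \<partial>M) \<partial>P) = (\<integral>\<^sup>+x. (\<integral>\<^sup>+\<xi>. w x (rho x \<xi>) * ?g x (rho x \<xi>) \<partial>P) \<partial>M)"
    by (rule PM.Fubini'[symmetric]) measurable
  also have "\<dots> = (\<integral>\<^sup>+x. ennreal (exp l) * (\<integral>\<^sup>+\<xi>. of_bool (cnt (Nb x) \<xi> = 0) * (w x \<xi> * ?g x \<xi>) * D x \<xi> \<partial>Po M) \<partial>M)"
  proof (rule nn_integral_cong)
    fix x
    have q: "(\<lambda>\<xi>. w x \<xi> * ?g x \<xi>) \<in> borel_measurable Nsp" by measurable
    have "(\<integral>\<^sup>+\<xi>. w x (rho x \<xi>) * ?g x (rho x \<xi>) \<partial>P) = ennreal (exp l) * (\<integral>\<^sup>+\<xi>. J \<xi> * (w x (rho x \<xi>) * ?g x (rho x \<xi>)) \<partial>Po M)"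
      by (rule janossy_integral) measurable
    then show "(\<integral>\<^sup>+\<xi>. w x (rho x \<xi>) * ?g x (rho x \<xi>) \<partial>P) = ennreal (exp l) * (\<integral>\<^sup>+\<xi>. of_bool (cnt (Nb x) \<xi> = 0) * (w x \<xi> * ?g x \<xi>) * D x \<xi> \<partial>Po M)"
      using split_J[OF q, of "{#}" x] by simp
  qed
  also have "\<dots> = (\<integral>\<^sup>+x. ennreal (exp l) * (\<integral>\<^sup>+\<xi>. of_bool (cnt (Nb x) \<xi> = 0) * w x \<xi> * D x (add_mset x \<xi>) \<partial>Po M) \<partial>M)"
  proof (rule nn_integral_cong_AE)
    show "AE x in M. ennreal (exp l) * (\<integral>\<^sup>+\<xi>. of_bool (cnt (Nb x) \<xi> = 0) * (w x \<xi> * ?g x \<xi>) * D x \<xi> \<partial>Po M)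
       = ennreal (exp l) * (\<integral>\<^sup>+\<xi>. of_bool (cnt (Nb x) \<xi> = 0) * w x \<xi> * D x (add_mset x \<xi>) \<partial>Po M)"
      using D_add_finite_AE
    proof eventually_elim
      case (elim x)
      have "(\<integral>\<^sup>+\<xi>. of_bool (cnt (Nb x) \<xi> = 0) * (w x \<xi> * ?g x \<xi>) * D x \<xi> \<partial>Po M)
        = (\<integral>\<^sup>+\<xi>. of_bool (cnt (Nb x) \<xi> = 0) * w x \<xi> * D x (add_mset x \<xi>) \<partial>Po M)"
      proof (rule nn_integral_cong_AE)
        show "AE \<xi> in Po M. of_bool (cnt (Nb x) \<xi> = 0) * (w x \<xi> * ?g x \<xi>) * D x \<xi> = of_bool (cnt (Nb x) \<xi> = 0) * w x \<xi> * D x (add_mset x \<xi>)"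
          using elim D_finite_AE[of x]
        proof eventually_elim
          case (elim \<xi>)
          show ?case
          proof (cases "cnt (Nb x) \<xi> = 0")
            case True
            have "?g x \<xi> * D x \<xi> = D x (add_mset x \<xi>)"
            proof (cases "D x \<xi> = 0")
              case True
              then show ?thesis by (simp add: D_zero)
            next
              case False
              have fin: "D x (add_mset x \<xi>) < top" "D x \<xi> < top" using elim \<open>cnt (Nb x) \<xi> = 0\<close> by (auto simp: less_top)
              then have "D x (add_mset x \<xi>) / D x \<xi> < top" using False by (simp add: ennreal_divide_eq_top_iff less_top[symmetric])
              then have "?g x \<xi> = D x (add_mset x \<xi>) / D x \<xi>" using False by (simp add: gcond_eq)
              then show ?thesis using False fin by (simp add: ennreal_divide_times mult_divide_eq_ennreal less_top[symmetric] ennreal_times_divide[symmetric])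
            qed
            then show ?thesis by (simp add: mult.assoc)
          qed simp
        qed
      qed
      then show ?case by simp
    qed
  qed
  also have "\<dots> = ennreal (exp l) * (\<integral>\<^sup>+x. (\<integral>\<^sup>+\<xi>. of_bool (cnt (Nb x) \<xi> = 0) * w x \<xi> * D x (add_mset x \<xi>) \<partial>Po M) \<partial>M)"
    by (rule nn_integral_cmult, rule Po.borel_measurable_nn_integral) measurable
  also have "\<dots> = (\<integral>\<^sup>+\<xi>. (\<Sum>x\<in>#\<xi>. w x (rho x \<xi>)) \<partial>P)" by (rule campbell_density[OF w, symmetric])
  finally show ?thesis ..
qed

end


section \<open>The middle term through conditional densities, and the final assembly\<close>

context stein_point_process
begin

text \<open>Both expectations integrate the same weight \<open>w\<close> over the product of P and
  \<mu>: once against \<open>g\<close>, by the conditional formula, and once against \<phi>, the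
  density of the intensity. Hence only a bound on \<open>W\<close> itself enters.\<close>

lemma middle_term_density:
  assumes dc: "density_conditions P \<mu> j" and \<phi>: "\<phi> \<in> borel_measurable borel" "\<And>x. 0 \<le> \<phi> x"
    and M: "M = density \<mu> (\<lambda>x. ennreal (\<phi> x))"
    and c: "0 \<le> c" "\<And>x \<xi>. \<bar>W x \<xi>\<bar> \<le> c"
  shows "ennreal \<bar>(\<integral>\<xi>. S' \<xi> \<partial>P) - (\<integral>\<xi>. I' \<xi> \<partial>P)\<bar>
    \<le> ennreal c * (\<integral>\<^sup>+\<xi>. (\<integral>\<^sup>+x. ennreal \<bar>gcond j \<mu> Nb x (rho x \<xi>) - \<phi> x\<bar> \<partial>\<mu>) \<partial>P)"
proof -
  have mu_fin: "finite_measure \<mu>" and sets_mu [measurable_cong]: "sets \<mu> = sets borel"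
    using dc by (auto simp: density_conditions_def)
  interpret J: janossy_process X Nb \<mu> P j
  proof (intro janossy_process.intro janossy_process_axioms.intro finite_borel.intro finite_borel_axioms.intro)
    show "(\<integral>\<^sup>+\<xi>. ennreal (real (size \<xi>)) \<partial>P) \<noteq> \<infinity>"
      using lam_fin unfolding nn_integral_size by simp
    show "janossy P \<mu> j" "hereditary j" using dc by (auto simp: density_conditions_def)
  qed (fact neighborhoods_axioms compact_points_axioms mu_fin sets_mu P_prob sets_P)+
  interpret PM: pair_sigma_finite P \<mu>
    by (intro pair_sigma_finite.intro J.sigma_finite_measure_axioms P.sigma_finite_measure_axioms)
  note \<phi>(1)[measurable]
  let ?R = "P \<Otimes>\<^sub>M \<mu>"
  define g where "g z = gcond j \<mu> Nb (snd z) (rho (snd z) (fst z))" for z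
  define w where "w z = W (snd z) (rho (snd z) (fst z))" for z
  have g[measurable]: "g \<in> borel_measurable ?R" unfolding g_def[abs_def] by measurable
  have w[measurable]: "w \<in> borel_measurable ?R" unfolding w_def[abs_def] by measurable
  have ph[measurable]: "(\<lambda>z. \<phi> (snd z)) \<in> borel_measurable ?R" by measurable
  have g0: "0 \<le> g z" for z by (simp add: g_def J.gcond_nonneg)
  have w1: "\<bar>w z\<bar> \<le> 1" for z by (simp add: w_def W_abs_le_1)
  have wp: "0 \<le> w z + 1" for z using w1[of z] by linarith
  have fst_int: "(\<integral>\<^sup>+z. F z \<partial>?R) = (\<integral>\<^sup>+\<xi>. (\<integral>\<^sup>+x. F (\<xi>, x) \<partial>\<mu>) \<partial>P)" if "F \<in> borel_measurable ?R" for F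
    using J.nn_integral_fst[OF that] by simp
  \<comment> \<open>The integral of \<open>g\<close> is the mean number of points, so
    \<open>g\<close> is integrable and the shift of \<open>w\<close> by 1 can be taken back.\<close>
  have "(\<integral>\<^sup>+z. ennreal (g z) \<partial>?R) = (\<integral>\<^sup>+\<xi>. (\<Sum>x\<in>#\<xi>. 1) \<partial>P)"
    using J.campbell_gcond[of "\<lambda>_ _. 1"] by (subst fst_int) (simp_all add: g_def)
  then have gi: "(\<integral>\<^sup>+z. ennreal (g z) \<partial>?R) = ennreal l"
    using nn_integral_size by (simp add: ennreal_of_nat_eq_real_of_nat emeasure_eq_measure)
  have ig: "integrable ?R g"
    by (rule integrableI_nonneg) (use g0 gi in \<open>auto\<close>)
  have lg: "(\<integral>z. g z \<partial>?R) = l"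
    using nn_integral_eq_integral[OF ig] g0 gi by (simp add: integral_nonneg)
  have "(\<integral>\<^sup>+z. ennreal (\<phi> (snd z)) \<partial>?R) = (\<integral>\<^sup>+\<xi>. (\<integral>\<^sup>+x. ennreal (\<phi> x) \<partial>\<mu>) \<partial>P)"
    by (subst fst_int) simp_all
  also have "\<dots> = emeasure M UNIV"
    using P.emeasure_space_1 unfolding M by (subst emeasure_density) (auto simp: sets_mu)
  finally have iph: "integrable ?R (\<lambda>z. \<phi> (snd z))"
    using lam_fin \<phi>(2) by (intro integrableI_nonneg) auto
  have iwg: "integrable ?R (\<lambda>z. w z * g z)"
    by (rule Bochner_Integration.integrable_bound[OF ig]) (use w1 g0 in \<open>auto simp: abs_mult intro!: mult_left_le_one_le\<close>)
  have iwp: "integrable ?R (\<lambda>z. w z * \<phi> (snd z))"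
    by (rule Bochner_Integration.integrable_bound[OF iph]) (use w1 \<phi>(2) in \<open>auto simp: abs_mult intro!: mult_left_le_one_le\<close>)
  have mW: "(\<lambda>(x, \<xi>). ennreal (W x \<xi> + 1)) \<in> borel_measurable (borel \<Otimes>\<^sub>M Nsp)" by measurable
  have wg0: "0 \<le> (w z + 1) * g z" for z using wp g0 by simp
  have iwg1: "integrable ?R (\<lambda>z. (w z + 1) * g z)"
    using iwg ig by (simp add: distrib_right)
  have "ennreal ((\<integral>\<xi>. S' \<xi> \<partial>P) + l) = (\<integral>\<^sup>+z. ennreal (w z + 1) * ennreal (g z) \<partial>?R)"
    unfolding nn_integral_S'[symmetric] J.campbell_gcond[OF mW]
    by (subst fst_int) (simp_all add: g_def w_def)
  also have "\<dots> = (\<integral>\<^sup>+z. ennreal ((w z + 1) * g z) \<partial>?R)"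
    using wp g0 by (simp add: ennreal_mult)
  also have "\<dots> = ennreal (\<integral>z. (w z + 1) * g z \<partial>?R)"
    using iwg1 wg0 by (intro nn_integral_eq_integral) auto
  finally have "(\<integral>\<xi>. S' \<xi> \<partial>P) + l = (\<integral>z. (w z + 1) * g z \<partial>?R)"
    by (subst (asm) ennreal_inj) (use S'_plus_l_nonneg wg0 in \<open>auto intro!: Bochner_Integration.integral_nonneg\<close>)
  also have "\<dots> = (\<integral>z. w z * g z \<partial>?R) + l"
    using iwg ig by (simp add: distrib_right lg)
  finally have S: "(\<integral>\<xi>. S' \<xi> \<partial>P) = (\<integral>z. w z * g z \<partial>?R)" by simp
  have "I' \<xi> = (\<integral>x. w (\<xi>, x) * \<phi> x \<partial>\<mu>)" for \<xi>
  proof -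
    have "(\<integral>x. W x (rho x \<xi>) \<partial>density \<mu> (\<lambda>x. ennreal (\<phi> x))) = (\<integral>x. \<phi> x *\<^sub>R W x (rho x \<xi>) \<partial>\<mu>)"
      using \<phi>(2) by (intro integral_density) auto
    moreover have "I' \<xi> = (\<integral>x. W x (rho x \<xi>) \<partial>density \<mu> (\<lambda>x. ennreal (\<phi> x)))"
      unfolding I'_def by (rule arg_cong[where f = "\<lambda>N. \<integral>x. W x (rho x \<xi>) \<partial>N", OF M])
    ultimately show ?thesis by (simp add: w_def mult.commute)
  qed
  then have I: "(\<integral>\<xi>. I' \<xi> \<partial>P) = (\<integral>z. w z * \<phi> (snd z) \<partial>?R)"
    using PM.integral_fst'[OF iwp] by simp
  have "ennreal \<bar>(\<integral>\<xi>. S' \<xi> \<partial>P) - (\<integral>\<xi>. I' \<xi> \<partial>P)\<bar> = ennreal (norm (\<integral>z. w z * g z - w z * \<phi> (snd z) \<partial>?R))"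
    using iwg iwp by (simp add: S I)
  also have "\<dots> \<le> (\<integral>\<^sup>+z. ennreal (norm (w z * g z - w z * \<phi> (snd z))) \<partial>?R)"
    using iwg iwp by (intro integral_norm_bound_ennreal) simp
  also have "\<dots> \<le> (\<integral>\<^sup>+z. ennreal c * ennreal \<bar>g z - \<phi> (snd z)\<bar> \<partial>?R)"
  proof (rule nn_integral_mono)
    fix z
    have "norm (w z * g z - w z * \<phi> (snd z)) = \<bar>w z\<bar> * \<bar>g z - \<phi> (snd z)\<bar>"
      by (simp add: abs_mult[symmetric] right_diff_distrib)
    also have "\<dots> \<le> c * \<bar>g z - \<phi> (snd z)\<bar>" using c(2) by (intro mult_right_mono) (auto simp: w_def)
    finally show "ennreal (norm (w z * g z - w z * \<phi> (snd z))) \<le> ennreal c * ennreal \<bar>g z - \<phi> (snd z)\<bar>"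
      using c(1) by (simp add: ennreal_mult[symmetric] ennreal_leI)
  qed
  also have "\<dots> = ennreal c * (\<integral>\<^sup>+z. ennreal \<bar>g z - \<phi> (snd z)\<bar> \<partial>?R)"
    by (rule nn_integral_cmult) measurable
  also have "(\<integral>\<^sup>+z. ennreal \<bar>g z - \<phi> (snd z)\<bar> \<partial>?R) = (\<integral>\<^sup>+\<xi>. (\<integral>\<^sup>+x. ennreal \<bar>gcond j \<mu> Nb x (rho x \<xi>) - \<phi> x\<bar> \<partial>\<mu>) \<partial>P)"
    by (subst fst_int) (simp_all add: g_def)
  finally show ?thesis .
qed

lemma error_bound:
  assumes c: "0 \<le> c" and add: "\<And>x y \<xi>. \<bar>W x (add_mset y \<xi>) - W x \<xi>\<bar> \<le> c"
    and mid: "ennreal \<bar>(\<integral>\<xi>. S' \<xi> \<partial>P) - (\<integral>\<xi>. I' \<xi> \<partial>P)\<bar> \<le> E"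
  shows "ennreal \<bar>(\<integral>\<xi>. f \<xi> \<partial>P) - (\<integral>\<xi>. f \<xi> \<partial>Po M)\<bar>
    \<le> ennreal c * ((\<integral>\<^sup>+x. emeasure M (Nb x) \<partial>M) + (\<integral>\<^sup>+\<xi>. (\<Sum>x\<in>#\<xi>. of_nat (cnt (Nb x) \<xi> - 1)) \<partial>P)) + E"
proof -
  have "ennreal \<bar>(\<integral>\<xi>. f \<xi> \<partial>P) - (\<integral>\<xi>. f \<xi> \<partial>Po M)\<bar>
    \<le> ennreal (\<bar>\<integral>\<xi>. S \<xi> - S' \<xi> \<partial>P\<bar> + \<bar>(\<integral>\<xi>. S' \<xi> \<partial>P) - (\<integral>\<xi>. I' \<xi> \<partial>P)\<bar> + \<bar>\<integral>\<xi>. I' \<xi> - I \<xi> \<partial>P\<bar>)"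
    unfolding decomposition by (rule ennreal_leI) linarith
  also have "\<dots> = ennreal \<bar>\<integral>\<xi>. S \<xi> - S' \<xi> \<partial>P\<bar> + ennreal \<bar>(\<integral>\<xi>. S' \<xi> \<partial>P) - (\<integral>\<xi>. I' \<xi> \<partial>P)\<bar> + ennreal \<bar>\<integral>\<xi>. I' \<xi> - I \<xi> \<partial>P\<bar>"
    by (simp add: ennreal_plus)
  also have "\<dots> \<le> ennreal c * (\<integral>\<^sup>+\<xi>. (\<Sum>x\<in>#\<xi>. of_nat (cnt (Nb x) \<xi> - 1)) \<partial>P) + E + ennreal c * (\<integral>\<^sup>+x. emeasure M (Nb x) \<partial>M)"
    by (intro add_mono first_term[OF c add] last_term[OF c add] mid)
  finally show ?thesis by (simp add: distrib_left ac_simps)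
qed

end

text \<open>A uniform bound passes to the real supremum because \<open>F2\<close> is nonempty; for
  infinite R nothing remains to be shown.\<close>

lemma d2_le:
  fixes P Q :: "'a::metric_space multiset measure"
  assumes "\<And>f. f \<in> F2 p \<Longrightarrow> ennreal \<bar>(\<integral>\<xi>. f \<xi> \<partial>P) - (\<integral>\<xi>. f \<xi> \<partial>Q)\<bar> \<le> R"
  shows "ennreal (d2 p P Q) \<le> R"
proof (cases R)
  case (real r)
  have "(\<lambda>_. 0) \<in> (F2 p :: ('a multiset \<Rightarrow> real) set)" by (simp add: F2_def d1p_nonneg)
  then have "F2 p \<noteq> ({} :: ('a multiset \<Rightarrow> real) set)" by blast
  then have "d2 p P Q \<le> r" unfolding d2_def
    by (rule cSUP_least) (use assms real in \<open>simp add: ennreal_le_iff\<close>)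
  then show ?thesis using real by (simp add: ennreal_leI)
qed simp

theorem theorem3:
  fixes P :: "'a::metric_space multiset measure"
    and p :: ereal
    and Nb :: "'a \<Rightarrow> 'a set"
    and Pm :: "'a \<Rightarrow> 'a multiset measure"
    and Q :: "'a \<Rightarrow> ('a multiset \<times> 'a multiset) measure"
  assumes compact_X: "compact (UNIV :: 'a set)"
    and d0_le1: "\<forall>x y::'a. dist x y \<le> 1"
    and p_ge1: "1 \<le> p"
    and P_pp: "prob_space P" "sets P = sets Nsp"
    and lam_fin: "emeasure (exp_meas P) UNIV < \<infinity>"
    and nbhd: "nbhd_structure Nb"
    and palm: "palm_kernel P Pm"
    and Q_kernel: "Q \<in> borel \<rightarrow>\<^sub>M prob_algebra (Nsp \<Otimes>\<^sub>M Nsp)"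
    and Q_coupling: "\<forall>x. distr (Q x) Nsp fst = P \<and> distr (Q x) Nsp snd = Pm x"
  shows
   "(let lamM = exp_meas P; lam = enn2real (emeasure lamM UNIV);
         A = (\<integral>\<^sup>+x. emeasure lamM (Nb x) \<partial>lamM);
         B = (\<integral>\<^sup>+\<xi>. sum_mset (image_mset (\<lambda>x. of_nat (cnt (Nb x) \<xi> - 1)) \<xi>) \<partial>P);
         eps2 = ennreal (c2 p lam) *
                (\<integral>\<^sup>+x. (\<integral>\<^sup>+z. ennreal (d1' (restr (fst z) (- Nb x)) (restr (snd z) (- Nb x))) \<partial>Q x) \<partial>lamM)
     in ennreal (d2 p P (Po lamM)) \<le> ennreal (c2 p lam) * (A + B) + eps2 \<and>
        (\<forall>\<mu> j \<phi>. density_conditions P \<mu> j \<and> \<phi> \<in> borel_measurable borel \<and> (\<forall>x. 0 \<le> \<phi> x) \<and>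
              lamM = density \<mu> (\<lambda>x. ennreal (\<phi> x)) \<longrightarrow>
           ennreal (d2 p P (Po lamM)) \<le> ennreal (c2 p lam) * (A + B) +
              ennreal (c1 p lam) *
              (\<integral>\<^sup>+\<xi>. (\<integral>\<^sup>+x. ennreal \<bar>gcond j \<mu> Nb x (restr \<xi> (- Nb x)) - \<phi> x\<bar> \<partial>\<mu>) \<partial>P)))"
proof -
  interpret point_process "TYPE('a)" Nb P Pm
    by (intro point_process.intro neighborhoods.intro compact_points.intro neighborhoods_axioms.intro
        point_process_axioms.intro compact_X nbhd P_pp lam_fin palm)
  have l: "enn2real (emeasure M UNIV) = l" by (simp add: measure_def)
  have stein: "stein_point_process Nb P Pm f (expo p)" if f: "f \<in> F2 p" for f
  proof (intro stein_point_process.intro stein.intro stein_axioms.intro point_process_axioms finite_borel_axioms expo_bounds p_ge1)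
    show "f \<in> borel_measurable Nsp" "0 \<le> f \<xi>" "f \<xi> \<le> 1" for \<xi> using f by (auto simp: F2_def)
    show "dist x y \<le> 1" for x y :: 'a using d0_le1 by simp
    show "\<bar>f (add_mset x \<zeta>) - f (add_mset y \<zeta>)\<bar> \<le> real (Suc (size \<zeta>)) powr - expo p * dist x y" for x y \<zeta>
      using f d1p_move[OF p_ge1, of x \<zeta> y] unfolding F2_def by (blast intro: order_trans)
  qed
  \<comment> \<open>The Stein factors are available only for positive total mass; for mass 0 the two
    expectations coincide.\<close>
  have cases: "ennreal (d2 p P (Po M)) \<le> R"
    if "\<And>f. f \<in> F2 p \<Longrightarrow> 0 < l \<Longrightarrow> ennreal \<bar>(\<integral>\<xi>. f \<xi> \<partial>P) - (\<integral>\<xi>. f \<xi> \<partial>Po M)\<bar> \<le> R" for R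
  proof (rule d2_le)
    fix f :: "'a multiset \<Rightarrow> real" assume f: "f \<in> F2 p"
    interpret stein_point_process "TYPE('a)" Nb P Pm f "expo p" by (rule stein[OF f])
    show "ennreal \<bar>(\<integral>\<xi>. f \<xi> \<partial>P) - (\<integral>\<xi>. f \<xi> \<partial>Po M)\<bar> \<le> R"
      using that[OF f] zero_intensity by (cases "l = 0") (auto simp: less_le)
  qed
  \<comment> \<open>Nonnegativity is read off from the fact that \<open>c2\<close> bounds an
    absolute value.\<close>
  have c2: "0 \<le> c2 p l" if "0 < l" and f: "f \<in> F2 p" for f :: "'a multiset \<Rightarrow> real"
  proof -
    interpret stein_point_process "TYPE('a)" Nb P Pm f "expo p" by (rule stein[OF f])
    show ?thesis using W_add_c2[OF \<open>0 < l\<close> p_ge1 refl] abs_ge_zero order_trans by blast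
  qed
  have 1: "ennreal (d2 p P (Po M)) \<le> ennreal (c2 p l) * ((\<integral>\<^sup>+x. emeasure M (Nb x) \<partial>M) + (\<integral>\<^sup>+\<xi>. (\<Sum>x\<in>#\<xi>. of_nat (cnt (Nb x) \<xi> - 1)) \<partial>P))
      + ennreal (c2 p l) * (\<integral>\<^sup>+x. (\<integral>\<^sup>+z. ennreal (d1' (rho x (fst z)) (rho x (snd z))) \<partial>Q x) \<partial>M)"
  proof (rule cases)
    fix f :: "'a multiset \<Rightarrow> real" assume f: "f \<in> F2 p" and l0: "0 < l"
    interpret stein_point_process "TYPE('a)" Nb P Pm f "expo p" by (rule stein[OF f])
    note add = W_add_c2[OF l0 p_ge1 refl] and move = W_move_c2[OF l0 p_ge1 refl] and c = c2[OF l0 f]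
    show "ennreal \<bar>(\<integral>\<xi>. f \<xi> \<partial>P) - (\<integral>\<xi>. f \<xi> \<partial>Po M)\<bar>
      \<le> ennreal (c2 p l) * ((\<integral>\<^sup>+x. emeasure M (Nb x) \<partial>M) + (\<integral>\<^sup>+\<xi>. (\<Sum>x\<in>#\<xi>. of_nat (cnt (Nb x) \<xi> - 1)) \<partial>P))
      + ennreal (c2 p l) * (\<integral>\<^sup>+x. (\<integral>\<^sup>+z. ennreal (d1' (rho x (fst z)) (rho x (snd z))) \<partial>Q x) \<partial>M)"
      using Q_coupling by (intro error_bound[OF c add] middle_term_coupling[OF c add move Q_kernel]) blast
  qed
  have 2: "ennreal (d2 p P (Po M)) \<le> ennreal (c2 p l) * ((\<integral>\<^sup>+x. emeasure M (Nb x) \<partial>M) + (\<integral>\<^sup>+\<xi>. (\<Sum>x\<in>#\<xi>. of_nat (cnt (Nb x) \<xi> - 1)) \<partial>P))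
      + ennreal (c1 p l) * (\<integral>\<^sup>+\<xi>. (\<integral>\<^sup>+x. ennreal \<bar>gcond j \<mu> Nb x (rho x \<xi>) - \<phi> x\<bar> \<partial>\<mu>) \<partial>P)"
    if "density_conditions P \<mu> j" "\<phi> \<in> borel_measurable borel" "\<And>x. 0 \<le> \<phi> x" "M = density \<mu> (\<lambda>x. ennreal (\<phi> x))"
    for \<mu> j \<phi>
  proof (rule cases)
    fix f :: "'a multiset \<Rightarrow> real" assume f: "f \<in> F2 p" and l0: "0 < l"
    interpret stein_point_process "TYPE('a)" Nb P Pm f "expo p" by (rule stein[OF f])
    note add = W_add_c2[OF l0 p_ge1 refl] and bound = W_bound_c1[OF l0 p_ge1 refl] and c = c2[OF l0 f]
    have c1: "0 \<le> c1 p l" using bound abs_ge_zero order_trans by blast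
    show "ennreal \<bar>(\<integral>\<xi>. f \<xi> \<partial>P) - (\<integral>\<xi>. f \<xi> \<partial>Po M)\<bar>
      \<le> ennreal (c2 p l) * ((\<integral>\<^sup>+x. emeasure M (Nb x) \<partial>M) + (\<integral>\<^sup>+\<xi>. (\<Sum>x\<in>#\<xi>. of_nat (cnt (Nb x) \<xi> - 1)) \<partial>P))
      + ennreal (c1 p l) * (\<integral>\<^sup>+\<xi>. (\<integral>\<^sup>+x. ennreal \<bar>gcond j \<mu> Nb x (rho x \<xi>) - \<phi> x\<bar> \<partial>\<mu>) \<partial>P)"
      by (intro error_bound[OF c add] middle_term_density[OF that c1 bound])
  qed
  show ?thesis unfolding Let_def l using 1 2 by blast
qed

end
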